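(* Let $\mathbf{x}\in\mathbb{C}^d$ be an arbitrary fixed vector and let $\mathbf{b}=(b_1,\ldots,b_m)^\top\in\mathbb{C}^m$ satisfy $\|\mathbf{b}\|_2\ge c_0\sqrt{m}\,\|\mathbf{x}\|_2$, $\sum_{j=1}^m|b_j|^4\lesssim m\|\mathbf{x}\|_2^4$ and $\|\mathbf{b}\|_\infty\lesssim\sqrt{\log m}\,\|\mathbf{x}\|_2$, where $c_0>\sqrt{4.4/1.96}$ is a positive constant. Let $\mathbf{a}_1,\ldots,\mathbf{a}_m\in\mathbb{C}^d$ be i.i.d. complex Gaussian random vectors and $y_j=|\mathbf{a}_j^*\mathbf{x}+b_j|^2$, $j=1,\ldots,m$. There are positive universal constants $C,c_a,c_b,c_c,c_d$ such that if $m\ge Cd\log d$, then with probability at least $1-c_am^{-1}-18\exp(-c_dd)-c_b\exp(-c_cm/\log m)$, \[ \begin{pmatrix}\mathbf{v}\\ \bar{\mathbf{v}}\end{pmatrix}^*\nabla^2 f(\mathbf{z})\begin{pmatrix}\mathbf{v}\\ \bar{\mathbf{v}}\end{pmatrix}\ \ge\ (1.96c_0^2-4.4)\,\|\mathbf{x}\|_2^2\quad\text{for all } \mathbf{v}\in\mathbb{C}^d \text{ with }\|\mathbf{v}\|_2=1 \text{ and all } \mathbf{z}\in\mathbb{C}^d, \] where $\nabla^2 f$ is the Wirtinger Hessian of $f(\mathbf{z})=\frac1{2m}\sum_{j=1}^m\big(|\mathbf{a}_j^*\mathbf{z}+b_j|^2-y_j\big)^2$.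
   Context: A complex Gaussian random vector $\mathbf{a}\in\mathbb{C}^d$ means $\mathbf{a}\sim\frac{1}{\sqrt2}\mathcal{N}(0,I_d)+\frac{i}{\sqrt2}\mathcal{N}(0,I_d)$. $A\lesssim B$ means $A\le C_0B$ for an absolute constant $C_0>0$. The Wirtinger Hessian of $f$ is the $2d\times 2d$ matrix \[ \nabla^2 f(\mathbf{z})=\frac1m\sum_{j=1}^m\begin{pmatrix}(2|\mathbf{a}_j^*\mathbf{z}+b_j|^2-y_j)\mathbf{a}_j\mathbf{a}_j^* & (\mathbf{a}_j^*\mathbf{z}+b_j)^2\mathbf{a}_j\mathbf{a}_j^\top\\ (\mathbf{z}^*\mathbf{a}_j+\bar b_j)^2\bar{\mathbf{a}}_j\mathbf{a}_j^* & (2|\mathbf{a}_j^*\mathbf{z}+b_j|^2-y_j)\bar{\mathbf{a}}_j\mathbf{a}_j^\top\end{pmatrix}. \] *)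

theory Defs
  imports "HOL-Probability.Probability"
begin

text \<open>Vectors in C^d are represented as functions nat => complex; only indices < d matter.\<close>

definition vnorm :: "nat \<Rightarrow> (nat \<Rightarrow> complex) \<Rightarrow> real" where
  "vnorm d x = sqrt (\<Sum>k<d. (cmod (x k))\<^sup>2)"

definition adj_dot :: "nat \<Rightarrow> (nat \<Rightarrow> complex) \<Rightarrow> (nat \<Rightarrow> complex) \<Rightarrow> complex" where
  "adj_dot d a z = (\<Sum>k<d. cnj (a k) * z k)"

definition cgauss :: "complex measure" where
  "cgauss = distr
     (density (lborel \<Otimes>\<^sub>M lborel)
        (\<lambda>(s, t). ennreal (normal_density 0 (1 / sqrt 2) s * normal_density 0 (1 / sqrt 2) t)))
     borel (\<lambda>(s, t). Complex s t)"

definition gauss_vectors :: "nat \<Rightarrow> nat \<Rightarrow> (nat \<Rightarrow> nat \<Rightarrow> complex) measure" where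
  "gauss_vectors m d = PiM {..<m} (\<lambda>_. PiM {..<d} (\<lambda>_. cgauss))"

definition wirtinger_hessian ::
  "nat \<Rightarrow> nat \<Rightarrow> (nat \<Rightarrow> nat \<Rightarrow> complex) \<Rightarrow> (nat \<Rightarrow> complex) \<Rightarrow> (nat \<Rightarrow> real)
    \<Rightarrow> (nat \<Rightarrow> complex) \<Rightarrow> nat \<Rightarrow> nat \<Rightarrow> complex" where
  "wirtinger_hessian m d a b y z i k =
     (1 / of_nat m) * (\<Sum>j<m.
        (let u = adj_dot d (a j) z + b j;
             \<alpha> = complex_of_real (2 * (cmod u)\<^sup>2 - y j) in
         if i < d \<and> k < d then \<alpha> * a j i * cnj (a j k)
         else if i < d \<and> d \<le> k then u\<^sup>2 * a j i * a j (k - d)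
         else if d \<le> i \<and> k < d then (cnj u)\<^sup>2 * cnj (a j (i - d)) * cnj (a j k)
         else \<alpha> * cnj (a j (i - d)) * a j (k - d)))"

definition stack_conj :: "nat \<Rightarrow> (nat \<Rightarrow> complex) \<Rightarrow> nat \<Rightarrow> complex" where
  "stack_conj d v i = (if i < d then v i else cnj (v (i - d)))"

definition quad_form :: "nat \<Rightarrow> (nat \<Rightarrow> nat \<Rightarrow> complex) \<Rightarrow> (nat \<Rightarrow> complex) \<Rightarrow> complex" where
  "quad_form n H w = (\<Sum>i<n. \<Sum>k<n. cnj (w i) * H i k * w k)"

end

theory Submission
  imports Defs
begin

text \<open>
  After scaling to \<open>\<parallel>x\<parallel> = 1\<close>, put \<open>u\<^sub>j = a\<^sub>j\<^sup>*z + b\<^sub>j\<close> and \<open>w\<^sub>j = a\<^sub>j\<^sup>*v\<close>. The form equals the mean of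
  \<open>2 |u\<^sub>j w\<^sub>j|\<^sup>2 + 4 (Re (u\<^sub>j cnj w\<^sub>j))\<^sup>2 - 2 y\<^sub>j |w\<^sub>j|\<^sup>2\<close>. With \<open>\<beta> = \<parallel>b\<parallel>\<^sup>2 / m\<close> the nonnegative quartic part has
  expectation at least \<open>4 \<beta> + 2 \<parallel>z\<parallel>\<^sup>2\<close> and the mean of \<open>y\<^sub>j |w\<^sub>j|\<^sup>2\<close> has expectation at most \<open>2 + \<beta>\<close>, which
  leaves \<open>2 \<beta> - 4 \<ge> 2 c\<^sub>0\<^sup>2 - 4\<close> up to a small error.

  Only a lower bound is needed for the quartic part, so \<open>u\<^sub>j\<close> and \<open>w\<^sub>j\<close> may be clipped to a disc of constant
  radius; the clipped terms are bounded and Lipschitz, and a Chernoff bound with a net over \<open>(z, v)\<close> costs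
  only \<open>m \<ge> C d\<close>. The upper bound is a bound on the norm of a weighted sample covariance whose weights
  \<open>y\<^sub>j\<close> are \<open>O (log m)\<close> with probability \<open>1 - O (1 / m)\<close>; Chernoff with parameter of order \<open>1 / log m\<close> gives
  the factor \<open>exp (- c m / log m)\<close>, which beats the net once \<open>m \<ge> C d log d\<close>.
\<close>

section \<open>Complex Gaussian vectors\<close>

text \<open>The characteristic function identifies the law of one real projection
  \<open>Re (adj_dot d a v)\<close>, and joint moments are recovered from it: imaginary parts are
  real parts in the direction \<open>- \<i> * v\<close>, mixed moments come from polarisation, and
  products inside exponential bounds are separated by the inequality of arithmetic and geometric
  means. The obstacle is that a product of four Gaussian factors has no positive exponential moment.
  A term bounded from below may be shrunk at will, but one bounded from above may not. There the
  factor \<open>a\<^sub>j\<^sup>*x\<close> is truncated at a level that all m samples respect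
  outside probability \<open>2 / m\<close>, which is the source of the term of order 1 / m. The two
  nets work differently. The covariance is the square of a seminorm, so its net loses only a factor
  \<open>1 / (1 - \<delta>)\<^sup>2\<close> close to 1. The clipped sum is not homogeneous and needs
  a Lipschitz estimate, whose average over the samples is controlled by a crude covariance bound.
  Exceptional sets are carried as measurable supersets of the failures; measurability of the full
  event, over all v and z, is settled once at the end.\<close>

definition cgauss_vec :: "nat \<Rightarrow> (nat \<Rightarrow> complex) measure" where
  "cgauss_vec d = PiM {..<d} (\<lambda>_. cgauss)"

lemma sets_cgauss [measurable_cong, simp]: "sets cgauss = sets borel"
  by (simp add: cgauss_def)

lemma measurable_Complex [measurable]:
  "(\<lambda>(s, t). Complex s t) \<in> borel_measurable (borel \<Otimes>\<^sub>M borel)"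
proof -
  have "(\<lambda>p. complex_of_real (fst p) + \<i> * complex_of_real (snd p))
      \<in> borel_measurable (borel \<Otimes>\<^sub>M borel)"
    by measurable
  moreover have "(\<lambda>(s, t). Complex s t) = (\<lambda>p. complex_of_real (fst p) + \<i> * complex_of_real (snd p))"
    by (auto simp: complex_eq_iff)
  ultimately show ?thesis by simp
qed

abbreviation half_normal :: "real measure" where
  "half_normal \<equiv> density lborel (\<lambda>x. ennreal (normal_density 0 (1 / sqrt 2) x))"

lemma half_normal_eq_distr: "half_normal = distr std_normal_distribution borel (\<lambda>s. s / sqrt 2)"
proof -
  interpret prob_space std_normal_distribution
    by (rule prob_space_normal_density) simp
  have "distributed std_normal_distribution lborel (\<lambda>x. x) (normal_density 0 1)"
    by (auto simp: distributed_def intro!: distr_id2)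
  from normal_density_affine[OF this, of "1 / sqrt 2" 0]
  have "distributed std_normal_distribution lborel (\<lambda>x. x / sqrt 2) (normal_density 0 (1 / sqrt 2))"
    by simp
  from distributed_distr_eq_density[OF this] show ?thesis
    by (metis (no_types, lifting) distr_cong sets_lborel)
qed

lemma prob_space_half_normal: "prob_space half_normal"
  by (rule prob_space_normal_density) simp

text \<open>The definition uses a joint density. As the image of a product measure the law admits
  Fubini, so that its characteristic function factors.\<close>

lemma cgauss_eq_distr:
  "cgauss = distr (half_normal \<Otimes>\<^sub>M half_normal) borel (\<lambda>(s, t). Complex s t)"
proof -
  interpret h: prob_space half_normal by (rule prob_space_half_normal)
  have "half_normal \<Otimes>\<^sub>M half_normal =
     density (lborel \<Otimes>\<^sub>M lborel)
        (\<lambda>(s, t). ennreal (normal_density 0 (1 / sqrt 2) s) * ennreal (normal_density 0 (1 / sqrt 2) t))"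
    by (rule pair_measure_density)
       (auto intro: h.sigma_finite_measure_axioms lborel.sigma_finite_measure_axioms)
  then show ?thesis
    by (simp add: cgauss_def ennreal_mult)
qed

lemma prob_space_cgauss: "prob_space cgauss"
proof -
  interpret h: prob_space half_normal by (rule prob_space_half_normal)
  interpret p: pair_prob_space half_normal half_normal ..
  show ?thesis
    unfolding cgauss_eq_distr by (rule p.prob_space_distr) simp
qed

lemma prob_space_cgauss_vec: "prob_space (cgauss_vec d)"
  unfolding cgauss_vec_def by (intro prob_space_PiM prob_space_cgauss)

lemma prob_space_gauss_vectors: "prob_space (gauss_vectors m d)"
  unfolding gauss_vectors_def by (intro prob_space_PiM prob_space_cgauss)

lemma gauss_vectors_eq: "gauss_vectors m d = PiM {..<m} (\<lambda>_. cgauss_vec d)"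
  by (simp add: gauss_vectors_def cgauss_vec_def)

lemma measurable_cgauss_vec_component:
  "k < d \<Longrightarrow> (\<lambda>a. a k) \<in> borel_measurable (cgauss_vec d)"
  unfolding cgauss_vec_def
  by (subst measurable_cong_sets[OF refl sets_cgauss[symmetric]]) simp

lemma borel_measurable_cnj [measurable (raw)]:
  "f \<in> borel_measurable M \<Longrightarrow> (\<lambda>x. cnj (f x)) \<in> borel_measurable M"
  by (rule borel_measurable_continuous_on[where f = cnj]) (auto intro!: continuous_intros)

lemma adj_dot_scale: "adj_dot d a (\<lambda>k. c * v k) = c * adj_dot d a v"
  by (simp add: adj_dot_def sum_distrib_left mult_ac)

lemma adj_dot_add: "adj_dot d a (\<lambda>k. v k + w k) = adj_dot d a v + adj_dot d a w"
  by (simp add: adj_dot_def ring_distribs sum.distrib)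

lemma adj_dot_diff: "adj_dot d a (\<lambda>k. v k - w k) = adj_dot d a v - adj_dot d a w"
  by (simp add: adj_dot_def ring_distribs sum_subtractf)

lemma measurable_adj_dot [measurable]: "(\<lambda>a. adj_dot d a v) \<in> borel_measurable (cgauss_vec d)"
  unfolding adj_dot_def
  by (intro borel_measurable_sum borel_measurable_times borel_measurable_cnj
      measurable_cgauss_vec_component) auto

lemma measurable_gauss_vectors_component:
  "j < m \<Longrightarrow> (\<lambda>a. a j) \<in> measurable (gauss_vectors m d) (cgauss_vec d)"
  unfolding gauss_vectors_eq by simp

lemma of_real_sqrt_2_power2: "(complex_of_real (sqrt 2))\<^sup>2 = 2"
  by (simp flip: of_real_power)

section \<open>Characteristic functions and the law of a real projection\<close>

lemma char_half_normal: "(CLINT s|half_normal. iexp (r * s)) = exp (- (complex_of_real (r\<^sup>2 / 4)))"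
proof -
  have "(CLINT s|half_normal. iexp (r * s)) = char std_normal_distribution (r / sqrt 2)"
    unfolding half_normal_eq_distr char_def
    by (subst integral_distr) (auto simp: field_simps)
  also have "\<dots> = exp (- (complex_of_real (r\<^sup>2 / 4)))"
    by (simp add: char_std_normal_distribution power_divide of_real_sqrt_2_power2 flip: exp_of_real)
  finally show ?thesis .
qed

lemma char_cgauss:
  "(CLINT a|cgauss. iexp (Re (cnj a * c))) = exp (- (complex_of_real ((cmod c)\<^sup>2 / 4)))"
proof -
  interpret h: prob_space half_normal by (rule prob_space_half_normal)
  interpret p: pair_prob_space half_normal half_normal ..
  have "(CLINT a|cgauss. iexp (Re (cnj a * c)))
      = (CLINT p|half_normal \<Otimes>\<^sub>M half_normal. iexp (Re c * fst p) * iexp (Im c * snd p))"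
    unfolding cgauss_eq_distr
    by (subst integral_distr)
       (auto simp: case_prod_unfold ring_distribs exp_add mult_ac intro!: Bochner_Integration.integral_cong)
  also have "\<dots> = (CLINT s|half_normal. CLINT t|half_normal. iexp (Re c * s) * iexp (Im c * t))"
  proof -
    have "integrable (half_normal \<Otimes>\<^sub>M half_normal) (\<lambda>p. iexp (Re c * fst p) * iexp (Im c * snd p))"
      by (rule p.integrable_const_bound[where B = 1]) (auto simp: norm_mult)
    from p.integral_fst'[OF this] show ?thesis by simp
  qed
  also have "\<dots> = exp (- (complex_of_real ((Re c)\<^sup>2 / 4))) * exp (- (complex_of_real ((Im c)\<^sup>2 / 4)))"
    by (simp only: Bochner_Integration.integral_mult_right_zero Bochner_Integration.integral_mult_left_zero
        char_half_normal)
  also have "\<dots> = exp (- (complex_of_real ((cmod c)\<^sup>2 / 4)))"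
    by (simp add: mult_exp_exp cmod_power2 add_divide_distrib)
  finally show ?thesis .
qed

lemma vnorm_nonneg [simp]: "0 \<le> vnorm d v"
  by (simp add: vnorm_def sum_nonneg)

lemma vnorm_power2: "(vnorm d v)\<^sup>2 = (\<Sum>k<d. (cmod (v k))\<^sup>2)"
  by (simp add: vnorm_def sum_nonneg)

lemma char_cgauss_vec:
  "(CLINT a|cgauss_vec d. iexp (Re (adj_dot d a v))) = exp (- (complex_of_real ((vnorm d v)\<^sup>2 / 4)))"
proof -
  interpret c: prob_space cgauss by (rule prob_space_cgauss)
  interpret p: product_sigma_finite "\<lambda>_::nat. cgauss" ..
  have "(CLINT a|cgauss_vec d. iexp (Re (adj_dot d a v)))
      = (CLINT a|cgauss_vec d. (\<Prod>k<d. iexp (Re (cnj (a k) * v k))))"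
    by (simp add: adj_dot_def sum_distrib_left exp_sum)
  also have "\<dots> = (\<Prod>k<d. (CLINT a|cgauss. iexp (Re (cnj a * v k))))"
    unfolding cgauss_vec_def
    by (intro p.product_integral_prod c.integrable_const_bound[where B = 1] AE_I2)
       (simp_all only: norm_exp_i_times finite_lessThan, measurable)
  also have "\<dots> = exp (- (complex_of_real ((vnorm d v)\<^sup>2 / 4)))"
    unfolding char_cgauss vnorm_power2
    by (simp add: sum_divide_distrib sum_negf flip: exp_sum)
  finally show ?thesis .
qed

text \<open>By Levy uniqueness: the characteristic function at \<open>t\<close> is the integral in
  \<open>char_cgauss_vec\<close> for the vector \<open>t * v\<close>. Writing the law as an image of
  the standard normal rather than by a density includes \<open>vnorm d v = 0\<close>, where it is a
  point mass.\<close>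

lemma distr_Re_adj_dot:
  "distr (cgauss_vec d) borel (\<lambda>a. Re (adj_dot d a v))
     = distr std_normal_distribution borel (\<lambda>s. vnorm d v / sqrt 2 * s)"
proof (rule Levy_uniqueness)
  interpret c: prob_space "cgauss_vec d" by (rule prob_space_cgauss_vec)
  interpret n: prob_space std_normal_distribution by (rule prob_space_normal_density) simp
  show "real_distribution (distr (cgauss_vec d) borel (\<lambda>a. Re (adj_dot d a v)))"
    by (intro real_distribution.intro c.prob_space_distr) (auto simp: real_distribution_axioms_def)
  show "real_distribution (distr std_normal_distribution borel (\<lambda>s. vnorm d v / sqrt 2 * s))"
    by (intro real_distribution.intro n.prob_space_distr) (auto simp: real_distribution_axioms_def)
  show "char (distr (cgauss_vec d) borel (\<lambda>a. Re (adj_dot d a v)))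
      = char (distr std_normal_distribution borel (\<lambda>s. vnorm d v / sqrt 2 * s))"
  proof
    fix t
    have "char (distr (cgauss_vec d) borel (\<lambda>a. Re (adj_dot d a v))) t
        = (CLINT a|cgauss_vec d. iexp (Re (adj_dot d a (\<lambda>k. t * v k))))"
      unfolding char_def by (subst integral_distr) (auto simp: adj_dot_scale)
    also have "\<dots> = exp (- (complex_of_real (t\<^sup>2 * (vnorm d v)\<^sup>2 / 4)))"
      by (simp only: char_cgauss_vec vnorm_power2) (simp add: norm_mult power_mult_distrib sum_distrib_left)
    also have "\<dots> = char std_normal_distribution (t * (vnorm d v / sqrt 2))"
      by (simp add: char_std_normal_distribution power_mult_distrib power_divide of_real_sqrt_2_power2
          flip: exp_of_real)
    also have "\<dots> = char (distr std_normal_distribution borel (\<lambda>s. vnorm d v / sqrt 2 * s)) t"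
      unfolding char_def by (subst integral_distr) (auto simp: mult_ac)
    finally show "char (distr (cgauss_vec d) borel (\<lambda>a. Re (adj_dot d a v))) t
      = char (distr std_normal_distribution borel (\<lambda>s. vnorm d v / sqrt 2 * s)) t" .
  qed
qed

lemma
  assumes [measurable]: "f \<in> borel_measurable borel"
  shows integral_Re_adj_dot:
    "(LINT a|cgauss_vec d. f (Re (adj_dot d a v)) :: real)
      = (LINT s|std_normal_distribution. f (vnorm d v / sqrt 2 * s))" (is ?A)
  and integrable_Re_adj_dot:
    "integrable (cgauss_vec d) (\<lambda>a. f (Re (adj_dot d a v)))
      \<longleftrightarrow> integrable std_normal_distribution (\<lambda>s. f (vnorm d v / sqrt 2 * s))" (is ?B)
proof -
  have "(LINT a|cgauss_vec d. f (Re (adj_dot d a v)))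
      = (LINT s|distr (cgauss_vec d) borel (\<lambda>a. Re (adj_dot d a v)). f s)"
    by (subst integral_distr) auto
  also have "\<dots> = (LINT s|std_normal_distribution. f (vnorm d v / sqrt 2 * s))"
    unfolding distr_Re_adj_dot by (subst integral_distr) auto
  finally show ?A .
  have "integrable (cgauss_vec d) (\<lambda>a. f (Re (adj_dot d a v)))
      \<longleftrightarrow> integrable (distr (cgauss_vec d) borel (\<lambda>a. Re (adj_dot d a v))) f"
    by (subst integrable_distr_eq) auto
  also have "\<dots> \<longleftrightarrow> integrable std_normal_distribution (\<lambda>s. f (vnorm d v / sqrt 2 * s))"
    unfolding distr_Re_adj_dot by (subst integrable_distr_eq) auto
  finally show ?B .
qed

section \<open>Moments\<close>

lemma vnorm_scale: "vnorm d (\<lambda>k. c * v k) = cmod c * vnorm d v"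
proof -
  have "(vnorm d (\<lambda>k. c * v k))\<^sup>2 = (cmod c * vnorm d v)\<^sup>2"
    by (simp add: vnorm_power2 norm_mult power_mult_distrib sum_distrib_left)
  then show ?thesis by (simp add: power2_eq_iff_nonneg)
qed

lemma
  shows integrable_Re_adj_dot_power: "integrable (cgauss_vec d) (\<lambda>a. Re (adj_dot d a v) ^ n)"
    and integral_Re_adj_dot_2: "(LINT a|cgauss_vec d. (Re (adj_dot d a v))\<^sup>2) = (vnorm d v)\<^sup>2 / 2"
    and integral_Re_adj_dot_3: "(LINT a|cgauss_vec d. (Re (adj_dot d a v)) ^ 3) = 0"
    and integral_Re_adj_dot_4: "(LINT a|cgauss_vec d. (Re (adj_dot d a v)) ^ 4) = 3 / 4 * (vnorm d v) ^ 4"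
proof -
  have m2: "(LINT s|std_normal_distribution. s\<^sup>2) = 1"
    using std_normal_distribution_even_moments(1)[of 1] by simp
  have m4: "(LINT s|std_normal_distribution. s ^ 4) = 3"
    using std_normal_distribution_even_moments(1)[of 2] by (simp add: fact_numeral)
  have m3: "(LINT s|std_normal_distribution. s ^ 3) = 0"
    using integral_std_normal_distribution_moment_odd[of 3] by simp
  show "integrable (cgauss_vec d) (\<lambda>a. Re (adj_dot d a v) ^ n)"
    by (subst integrable_Re_adj_dot[where f = "\<lambda>x. x ^ n"])
       (auto simp: power_mult_distrib power_divide intro!: integrable_divide integrable_mult_right integrable_std_normal_distribution_moment)
  show "(LINT a|cgauss_vec d. (Re (adj_dot d a v))\<^sup>2) = (vnorm d v)\<^sup>2 / 2"
    by (subst integral_Re_adj_dot[where f = "\<lambda>x. x\<^sup>2"]) (simp_all add: power_mult_distrib m2 power_divide)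
  show "(LINT a|cgauss_vec d. (Re (adj_dot d a v)) ^ 3) = 0"
    by (subst integral_Re_adj_dot[where f = "\<lambda>x. x ^ 3"]) (simp_all add: power_mult_distrib power_divide m3)
  have "(sqrt 2) ^ 4 = (4::real)"
    using power_mult[of "sqrt 2" 2 2] by simp
  then show "(LINT a|cgauss_vec d. (Re (adj_dot d a v)) ^ 4) = 3 / 4 * (vnorm d v) ^ 4"
    by (subst integral_Re_adj_dot[where f = "\<lambda>x. x ^ 4"]) (simp_all add: power_mult_distrib m4 power_divide)
qed

section \<open>Exponential and mixed moments\<close>

lemma has_integral_exp_std_normal:
  "has_bochner_integral std_normal_distribution (\<lambda>s. exp (s\<^sup>2 / 4)) (sqrt 2)"
proof -
  \<comment> \<open>Tilting the standard normal density by \<open>exp (s\<^sup>2 / 4)\<close>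
    doubles the variance and multiplies the total mass by \<open>sqrt 2\<close>.\<close>
  have eq: "std_normal_density s * exp (s\<^sup>2 / 4) = sqrt 2 * normal_density 0 (sqrt 2) s" for s
    by (simp add: normal_density_def real_sqrt_mult mult_exp_exp field_simps)
  have "has_bochner_integral lborel (\<lambda>s. sqrt 2 * normal_density 0 (sqrt 2) s) (sqrt 2 * 1)"
    using integral_normal_density[of "sqrt 2" 0] integrable_normal_density[of "sqrt 2" 0]
    by (intro has_bochner_integral_mult_right) (simp_all add: has_bochner_integral_iff)
  then have "has_bochner_integral lborel (\<lambda>s. std_normal_density s *\<^sub>R exp (s\<^sup>2 / 4)) (sqrt 2)"
    by (simp add: eq)
  then show ?thesis
    by (intro has_bochner_integral_density) auto
qed

lemma
  assumes "vnorm d v \<le> 1"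
  shows integrable_exp_Re_adj_dot: "integrable (cgauss_vec d) (\<lambda>a. exp ((Re (adj_dot d a v))\<^sup>2 / 2))"
    and integral_exp_Re_adj_dot: "(LINT a|cgauss_vec d. exp ((Re (adj_dot d a v))\<^sup>2 / 2)) \<le> 2"
proof -
  have *: "exp ((vnorm d v / sqrt 2 * s)\<^sup>2 / 2) \<le> exp (s\<^sup>2 / 4)" for s
  proof -
    have "(vnorm d v)\<^sup>2 * s\<^sup>2 \<le> 1 * s\<^sup>2"
      using assms by (intro mult_right_mono) (auto simp: power_le_one_iff)
    then show ?thesis by (simp add: power_mult_distrib power_divide)
  qed
  have i: "integrable std_normal_distribution (\<lambda>s. exp (s\<^sup>2 / 4))"
    and e: "(LINT s|std_normal_distribution. exp (s\<^sup>2 / 4)) = sqrt 2"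
    using has_integral_exp_std_normal by (simp_all add: has_bochner_integral_iff)
  have i2: "integrable std_normal_distribution (\<lambda>s. exp ((vnorm d v / sqrt 2 * s)\<^sup>2 / 2))"
    using * by (intro Bochner_Integration.integrable_bound[OF i]) auto
  show "integrable (cgauss_vec d) (\<lambda>a. exp ((Re (adj_dot d a v))\<^sup>2 / 2))"
    by (subst integrable_Re_adj_dot[where f = "\<lambda>x. exp (x\<^sup>2 / 2)"]) (use i2 in auto)
  have "(LINT a|cgauss_vec d. exp ((Re (adj_dot d a v))\<^sup>2 / 2))
      = (LINT s|std_normal_distribution. exp ((vnorm d v / sqrt 2 * s)\<^sup>2 / 2))"
    by (subst integral_Re_adj_dot[where f = "\<lambda>x. exp (x\<^sup>2 / 2)"]) auto
  also have "\<dots> \<le> (LINT s|std_normal_distribution. exp (s\<^sup>2 / 4))"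
    using * by (intro integral_mono i i2) auto
  also have "\<dots> = sqrt 2" by (rule e)
  also have "\<dots> \<le> 2" by (simp add: real_le_lsqrt)
  finally show "(LINT a|cgauss_vec d. exp ((Re (adj_dot d a v))\<^sup>2 / 2)) \<le> 2" .
qed

text \<open>Since \<open>- \<i> * v\<close> has the same norm as \<open>v\<close>, every moment
  bound for real parts passes to imaginary parts.\<close>

lemma Im_adj_dot: "Im (adj_dot d a v) = Re (adj_dot d a (\<lambda>k. - \<i> * v k))"
  by (simp only: adj_dot_scale) simp

text \<open>Real and imaginary part are combined without appeal to their independence:
  \<open>exp ((cmod w)\<^sup>2 / 4)\<close> is a product A B, and A B is at most (A^2 + B^2) / 2,
  where each square involves a single real projection.\<close>

lemma
  assumes "vnorm d v \<le> 1"
  shows integrable_exp_adj_dot: "integrable (cgauss_vec d) (\<lambda>a. exp ((cmod (adj_dot d a v))\<^sup>2 / 4))"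
    and integral_exp_adj_dot: "(LINT a|cgauss_vec d. exp ((cmod (adj_dot d a v))\<^sup>2 / 4)) \<le> 2"
proof -
  let ?v = "\<lambda>k. - \<i> * v k"
  let ?f = "\<lambda>a. (exp ((Re (adj_dot d a v))\<^sup>2 / 2) + exp ((Re (adj_dot d a ?v))\<^sup>2 / 2)) / 2"
  have v': "vnorm d ?v \<le> 1" using assms vnorm_scale[of d "- \<i>" v] by simp
  have *: "exp ((cmod (adj_dot d a v))\<^sup>2 / 4) \<le> ?f a" for a
  proof -
    define A B where "A = exp ((Re (adj_dot d a v))\<^sup>2 / 4)" and "B = exp ((Re (adj_dot d a ?v))\<^sup>2 / 4)"
    have "exp ((cmod (adj_dot d a v))\<^sup>2 / 4) = A * B"
      unfolding cmod_power2 A_def B_def Im_adj_dot by (simp add: add_divide_distrib exp_add)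
    moreover have "?f a = (A\<^sup>2 + B\<^sup>2) / 2"
      by (simp add: A_def B_def flip: exp_double)
    moreover have "0 \<le> (A - B)\<^sup>2" by simp
    ultimately show ?thesis by (simp add: power2_diff)
  qed
  have i: "integrable (cgauss_vec d) ?f"
    by (intro integrable_divide Bochner_Integration.integrable_add integrable_exp_Re_adj_dot assms v')
  show i2: "integrable (cgauss_vec d) (\<lambda>a. exp ((cmod (adj_dot d a v))\<^sup>2 / 4))"
    by (rule Bochner_Integration.integrable_bound[OF i]) (use * in auto)
  have "(LINT a|cgauss_vec d. exp ((cmod (adj_dot d a v))\<^sup>2 / 4)) \<le> (LINT a|cgauss_vec d. ?f a)"
    by (intro integral_mono i i2 *)
  also have "\<dots> \<le> 2"
    using integral_exp_Re_adj_dot[OF assms] integral_exp_Re_adj_dot[OF v']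
      integrable_exp_Re_adj_dot[OF assms] integrable_exp_Re_adj_dot[OF v']
    by simp
  finally show "(LINT a|cgauss_vec d. exp ((cmod (adj_dot d a v))\<^sup>2 / 4)) \<le> 2" .
qed

text \<open>One term of the exponential series is at most the whole series. The scale
  \<open>c\<close> stays free so that the exponential can be matched to an available moment.\<close>

lemma power_le_fact_exp:
  fixes x c :: real
  assumes "0 \<le> x" "0 < c"
  shows "x ^ n \<le> fact n * c ^ n * exp (x / c)"
proof -
  have "(x / c) ^ n / fact n \<le> exp (x / c)"
  proof -
    have "(\<Sum>k\<in>{n}. (x / c) ^ k / fact k) \<le> (\<Sum>k. (x / c) ^ k / fact k)"
      using assms summable_exp[of "x / c"] by (intro sum_le_suminf) (auto simp: field_simps)
    then show ?thesis
      by (simp add: exp_def divide_inverse mult.commute)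
  qed
  then show ?thesis
    using assms by (simp add: field_simps power_divide)
qed

lemma
  assumes "vnorm d v \<le> 1"
  shows integrable_adj_dot_power: "integrable (cgauss_vec d) (\<lambda>a. cmod (adj_dot d a v) ^ (2 * n))"
    and integral_adj_dot_power: "(LINT a|cgauss_vec d. cmod (adj_dot d a v) ^ (2 * n)) \<le> fact n * 4 ^ n * 2"
proof -
  have *: "cmod (adj_dot d a v) ^ (2 * n) \<le> fact n * 4 ^ n * exp ((cmod (adj_dot d a v))\<^sup>2 / 4)" for a
    using power_le_fact_exp[of "(cmod (adj_dot d a v))\<^sup>2" 4 n] by (simp add: power_mult)
  note i = integrable_mult_right[OF integrable_exp_adj_dot[OF assms], of "fact n * 4 ^ n"]
  show i2: "integrable (cgauss_vec d) (\<lambda>a. cmod (adj_dot d a v) ^ (2 * n))"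
    by (rule Bochner_Integration.integrable_bound[OF i]) (use * in auto)
  have "(LINT a|cgauss_vec d. cmod (adj_dot d a v) ^ (2 * n))
      \<le> (LINT a|cgauss_vec d. fact n * 4 ^ n * exp ((cmod (adj_dot d a v))\<^sup>2 / 4))"
    by (intro integral_mono i i2 *)
  also have "\<dots> \<le> fact n * 4 ^ n * 2"
    using integral_exp_adj_dot[OF assms] by simp
  finally show "(LINT a|cgauss_vec d. cmod (adj_dot d a v) ^ (2 * n)) \<le> fact n * 4 ^ n * 2" .
qed

lemma integral_adj_dot_2: "(LINT a|cgauss_vec d. (cmod (adj_dot d a v))\<^sup>2) = (vnorm d v)\<^sup>2"
proof -
  have "(LINT a|cgauss_vec d. (cmod (adj_dot d a v))\<^sup>2)
      = (LINT a|cgauss_vec d. (Re (adj_dot d a v))\<^sup>2 + (Re (adj_dot d a (\<lambda>k. - \<i> * v k)))\<^sup>2)"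
    unfolding cmod_power2 Im_adj_dot ..
  also have "\<dots> = (vnorm d v)\<^sup>2"
    by (subst Bochner_Integration.integral_add)
       (simp_all only: integrable_Re_adj_dot_power integral_Re_adj_dot_2 vnorm_scale, simp)
  finally show ?thesis .
qed

text \<open>The fourth power of the modulus is an average of fourth powers of real parts, in four directions.\<close>

lemma integral_adj_dot_4: "(LINT a|cgauss_vec d. cmod (adj_dot d a v) ^ 4) = 2 * vnorm d v ^ 4"
proof -
  let ?r = "\<lambda>c a. Re (adj_dot d a (\<lambda>k. c * v k))"
  have eq: "cmod (adj_dot d a v) ^ 4
     = 2 / 3 * (?r 1 a ^ 4 + ?r (- \<i>) a ^ 4 + (?r (1 - \<i>) a ^ 4 + ?r (1 + \<i>) a ^ 4) / 4)" for a
  proof -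
    have "(x\<^sup>2 + y\<^sup>2)\<^sup>2 = 2 / 3 * (x ^ 4 + y ^ 4 + ((x + y) ^ 4 + (x - y) ^ 4) / 4)" for x y :: real
      by (simp add: power2_eq_square power4_eq_xxxx field_simps)
    moreover have "cmod (adj_dot d a v) ^ 4 = ((cmod (adj_dot d a v))\<^sup>2)\<^sup>2" by simp
    ultimately show ?thesis
      unfolding cmod_power2 adj_dot_scale by simp
  qed
  have n2: "cmod (1 + \<i>) ^ 4 = 4" "cmod (1 - \<i>) ^ 4 = 4"
    by (simp_all add: cmod_def power4_eq_xxxx)
  have "(LINT a|cgauss_vec d. cmod (adj_dot d a v) ^ 4)
      = 2 / 3 * (3 / 4 * vnorm d v ^ 4 + 3 / 4 * vnorm d v ^ 4
          + (3 / 4 * (4 * vnorm d v ^ 4) + 3 / 4 * (4 * vnorm d v ^ 4)) / 4)"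
    unfolding eq
    by (simp only: Bochner_Integration.integral_add Bochner_Integration.integral_mult_right
        Bochner_Integration.integral_divide integrable_Re_adj_dot_power
        Bochner_Integration.integrable_add Bochner_Integration.integrable_divide
        integral_Re_adj_dot_4 vnorm_scale power_mult_distrib n2)
       simp
  then show ?thesis by simp
qed

text \<open>Polarisation of the cube: the four signed cubes of
  \<open>u \<plusminus> v \<plusminus> w\<close> add up to 24 times the product, and every cubic
  moment of a centred Gaussian projection vanishes.\<close>

lemma
  shows integrable_Re_adj_dot_triple:
    "integrable (cgauss_vec d) (\<lambda>a. Re (adj_dot d a u) * Re (adj_dot d a v) * Re (adj_dot d a w))"
    and integral_Re_adj_dot_triple:
    "(LINT a|cgauss_vec d. Re (adj_dot d a u) * Re (adj_dot d a v) * Re (adj_dot d a w)) = 0"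
proof -
  let ?r = "\<lambda>s t a. Re (adj_dot d a (\<lambda>k. u k + s * v k + t * w k))"
  have eq: "Re (adj_dot d a u) * Re (adj_dot d a v) * Re (adj_dot d a w)
     = (?r 1 1 a ^ 3 - ?r 1 (-1) a ^ 3 - ?r (-1) 1 a ^ 3 + ?r (-1) (-1) a ^ 3) / 24" for a
    unfolding adj_dot_add adj_dot_scale by simp algebra
  show "integrable (cgauss_vec d) (\<lambda>a. Re (adj_dot d a u) * Re (adj_dot d a v) * Re (adj_dot d a w))"
    unfolding eq by (intro integrable_divide Bochner_Integration.integrable_add
        Bochner_Integration.integrable_diff integrable_Re_adj_dot_power)
  show "(LINT a|cgauss_vec d. Re (adj_dot d a u) * Re (adj_dot d a v) * Re (adj_dot d a w)) = 0"
    unfolding eq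
    by (simp only: Bochner_Integration.integral_add Bochner_Integration.integral_diff
        Bochner_Integration.integral_divide integrable_Re_adj_dot_power
        Bochner_Integration.integrable_add Bochner_Integration.integrable_diff
        integral_Re_adj_dot_3) simp
qed

lemma sum4_power2_le: "((p::real) + q + r + s)\<^sup>2 \<le> 4 * (p\<^sup>2 + q\<^sup>2 + r\<^sup>2 + s\<^sup>2)"
proof -
  have "0 \<le> (p - q)\<^sup>2 + (p - r)\<^sup>2 + (p - s)\<^sup>2 + (q - r)\<^sup>2 + (q - s)\<^sup>2 + (r - s)\<^sup>2"
    by simp
  then show ?thesis by (simp add: power2_eq_square algebra_simps)
qed

lemma integrable_adj_dot_22:
  assumes "vnorm d v \<le> 1" "vnorm d z \<le> 1"
  shows "integrable (cgauss_vec d) (\<lambda>a. (cmod (adj_dot d a z))\<^sup>2 * (cmod (adj_dot d a v))\<^sup>2)"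
proof (rule Bochner_Integration.integrable_bound)
  show "integrable (cgauss_vec d) (\<lambda>a. cmod (adj_dot d a z) ^ 4 + cmod (adj_dot d a v) ^ 4)"
    using integrable_adj_dot_power[of d _ 2] assms by (intro Bochner_Integration.integrable_add) auto
  have "x\<^sup>2 * y\<^sup>2 \<le> x ^ 4 + y ^ 4" for x y :: real
  proof -
    have "0 \<le> (x\<^sup>2 - y\<^sup>2)\<^sup>2 + (x\<^sup>2)\<^sup>2 + (y\<^sup>2)\<^sup>2" by simp
    then show ?thesis by (simp add: power2_diff)
  qed
  then show "AE a in cgauss_vec d. norm ((cmod (adj_dot d a z))\<^sup>2 * (cmod (adj_dot d a v))\<^sup>2)
      \<le> norm (cmod (adj_dot d a z) ^ 4 + cmod (adj_dot d a v) ^ 4)"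
    by (intro AE_I2) (simp add: abs_mult)
qed measurable

text \<open>The exact mean is |z|^2 |v|^2 + |<z, v>|^2. For unit vectors this bound and the next one
  are the extremes, parallel and orthogonal, so the inner product never has to be computed.\<close>

lemma integral_adj_dot_22_le:
  assumes "vnorm d v \<le> 1" "vnorm d z \<le> 1"
  shows "(LINT a|cgauss_vec d. (cmod (adj_dot d a z))\<^sup>2 * (cmod (adj_dot d a v))\<^sup>2) \<le> 2"
proof -
  have i: "integrable (cgauss_vec d) (\<lambda>a. cmod (adj_dot d a z) ^ 4)"
      "integrable (cgauss_vec d) (\<lambda>a. cmod (adj_dot d a v) ^ 4)"
    using integrable_adj_dot_power[of d _ 2] assms by auto
  have *: "x\<^sup>2 * y\<^sup>2 \<le> (x ^ 4 + y ^ 4) / 2" for x y :: real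
  proof -
    have "0 \<le> (x\<^sup>2 - y\<^sup>2)\<^sup>2" by simp
    then show ?thesis by (simp add: power2_diff)
  qed
  have "(LINT a|cgauss_vec d. (cmod (adj_dot d a z))\<^sup>2 * (cmod (adj_dot d a v))\<^sup>2)
      \<le> (LINT a|cgauss_vec d. (cmod (adj_dot d a z) ^ 4 + cmod (adj_dot d a v) ^ 4) / 2)"
    using i by (intro integral_mono integrable_adj_dot_22 assms * integrable_divide) auto
  also have "\<dots> = vnorm d z ^ 4 + vnorm d v ^ 4"
    using i by (simp add: integral_adj_dot_4)
  also have "\<dots> \<le> 1 + 1"
    using assms by (intro add_mono) (auto simp: power_le_one_iff)
  finally show ?thesis by simp
qed

text \<open>Polarisation: average the fourth moments of \<open>v + c z\<close> over the fourth roots of unity \<open>c\<close>.\<close>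

lemma integral_adj_dot_22_ge:
  assumes "vnorm d v \<le> 1" "vnorm d z \<le> 1"
  shows "(vnorm d z)\<^sup>2 * (vnorm d v)\<^sup>2
    \<le> (LINT a|cgauss_vec d. (cmod (adj_dot d a z))\<^sup>2 * (cmod (adj_dot d a v))\<^sup>2)"
proof -
  let ?u = "\<lambda>c k. v k + c * z k"
  let ?I = "\<lambda>f. (LINT a|cgauss_vec d. f a)"
  have par: "(cmod (w + s))\<^sup>2 + (cmod (w + \<i> * s))\<^sup>2 + (cmod (w - s))\<^sup>2 + (cmod (w - \<i> * s))\<^sup>2
      = 4 * ((cmod w)\<^sup>2 + (cmod s)\<^sup>2)" for w s
    unfolding cmod_power2 by (simp add: power2_eq_square algebra_simps)
  have eq: "cmod (w + s) ^ 4 + cmod (w + \<i> * s) ^ 4 + cmod (w - s) ^ 4 + cmod (w - \<i> * s) ^ 4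
      = 4 * (cmod w ^ 4 + cmod s ^ 4 + 4 * ((cmod s)\<^sup>2 * (cmod w)\<^sup>2))" for w s
  proof -
    have "cmod u ^ 4 = ((cmod u)\<^sup>2)\<^sup>2" for u by simp
    then show ?thesis
      unfolding cmod_power2 by (simp add: power2_eq_square algebra_simps)
  qed
  have iz: "integrable (cgauss_vec d) (\<lambda>a. cmod (adj_dot d a z) ^ 4)"
    and iv: "integrable (cgauss_vec d) (\<lambda>a. cmod (adj_dot d a v) ^ 4)"
    using integrable_adj_dot_power[of d _ 2] assms by auto
  have b4: "cmod (w + s) ^ 4 \<le> 4 * (cmod w ^ 4 + cmod s ^ 4 + 4 * ((cmod s)\<^sup>2 * (cmod w)\<^sup>2))" for w s
    using eq[of w s] by (smt (verit) norm_ge_zero zero_le_power)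
  have iu: "integrable (cgauss_vec d) (\<lambda>a. cmod (adj_dot d a (?u c)) ^ 4)" if "cmod c = 1" for c
  proof (rule Bochner_Integration.integrable_bound)
    show "integrable (cgauss_vec d) (\<lambda>a. 4 * (cmod (adj_dot d a v) ^ 4 + cmod (adj_dot d a z) ^ 4
        + 4 * ((cmod (adj_dot d a z))\<^sup>2 * (cmod (adj_dot d a v))\<^sup>2)))"
      using iz iv integrable_adj_dot_22[OF assms] by simp
    show "AE a in cgauss_vec d. norm (cmod (adj_dot d a (?u c)) ^ 4)
        \<le> norm (4 * (cmod (adj_dot d a v) ^ 4 + cmod (adj_dot d a z) ^ 4
        + 4 * ((cmod (adj_dot d a z))\<^sup>2 * (cmod (adj_dot d a v))\<^sup>2)))"
      using b4[of "adj_dot d _ v" "c * adj_dot d _ z"] that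
      by (intro AE_I2) (simp add: adj_dot_add adj_dot_scale norm_mult)
  qed measurable
  have N: "(vnorm d (?u 1))\<^sup>2 + (vnorm d (?u \<i>))\<^sup>2 + (vnorm d (?u (- 1)))\<^sup>2 + (vnorm d (?u (- \<i>)))\<^sup>2
      = 4 * ((vnorm d v)\<^sup>2 + (vnorm d z)\<^sup>2)"
    using par by (simp add: vnorm_power2 sum_distrib_left flip: sum.distrib)
  \<comment> \<open>Only a lower bound is wanted, so Cauchy-Schwarz over the four roots of unity
    replaces the fourth powers of the norms of \<open>?u c\<close>; their squares sum to
    \<open>N\<close>, where the inner product of \<open>v\<close> and \<open>z\<close> has
    cancelled.\<close>
  have "16 * ((vnorm d v)\<^sup>2 + (vnorm d z)\<^sup>2)\<^sup>2
      \<le> 4 * (vnorm d (?u 1) ^ 4 + vnorm d (?u \<i>) ^ 4 + vnorm d (?u (- 1)) ^ 4 + vnorm d (?u (- \<i>)) ^ 4)"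
    using sum4_power2_le[of "(vnorm d (?u 1))\<^sup>2" "(vnorm d (?u \<i>))\<^sup>2" "(vnorm d (?u (- 1)))\<^sup>2" "(vnorm d (?u (- \<i>)))\<^sup>2"]
    unfolding N power_mult_distrib by simp
  also have "\<dots> = 2 * ?I (\<lambda>a. cmod (adj_dot d a (?u 1)) ^ 4 + cmod (adj_dot d a (?u \<i>)) ^ 4
      + cmod (adj_dot d a (?u (- 1))) ^ 4 + cmod (adj_dot d a (?u (- \<i>))) ^ 4)"
    using iu[of 1] iu[of "\<i>"] iu[of "- 1"] iu[of "- \<i>"]
    by (simp add: integral_adj_dot_4)
  also have "\<dots> = 2 * ?I (\<lambda>a. 4 * (cmod (adj_dot d a v) ^ 4 + cmod (adj_dot d a z) ^ 4
      + 4 * ((cmod (adj_dot d a z))\<^sup>2 * (cmod (adj_dot d a v))\<^sup>2)))"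
    unfolding eq[symmetric] by (simp only: adj_dot_add adj_dot_scale) simp
  also have "\<dots> = 8 * (2 * vnorm d v ^ 4 + 2 * vnorm d z ^ 4
      + 4 * ?I (\<lambda>a. (cmod (adj_dot d a z))\<^sup>2 * (cmod (adj_dot d a v))\<^sup>2))"
    using iz iv integrable_adj_dot_22[OF assms] by (simp add: integral_adj_dot_4)
  finally show ?thesis
    by (simp add: power2_sum mult_ac)
qed

section \<open>Nets and tail bounds\<close>

lemma vnorm_triangle: "vnorm d (\<lambda>k. v k + w k) \<le> vnorm d v + vnorm d w"
proof -
  have "vnorm d (\<lambda>k. v k + w k) \<le> L2_set (\<lambda>k. cmod (v k) + cmod (w k)) {..<d}"
    unfolding vnorm_def L2_set_def[symmetric]
    by (intro L2_set_mono norm_triangle_ineq) auto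
  also have "\<dots> \<le> vnorm d v + vnorm d w"
    unfolding vnorm_def L2_set_def[symmetric] by (rule L2_set_triangle_ineq)
  finally show ?thesis .
qed

lemma cmod_le_vnorm: "k < d \<Longrightarrow> cmod (v k) \<le> vnorm d v"
  unfolding vnorm_def L2_set_def[symmetric] by (rule member_le_L2_set) auto

lemma cmod_adj_dot_le: "cmod (adj_dot d a v) \<le> (\<Sum>k<d. cmod (a k)) * vnorm d v"
proof -
  have "cmod (adj_dot d a v) \<le> (\<Sum>k<d. cmod (a k) * cmod (v k))"
    unfolding adj_dot_def by (rule order.trans[OF norm_sum]) (simp add: norm_mult)
  also have "\<dots> \<le> (\<Sum>k<d. cmod (a k) * vnorm d v)"
    by (intro sum_mono mult_left_mono cmod_le_vnorm) auto
  finally show ?thesis by (simp add: sum_distrib_right)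
qed

lemma sum_half_powers_int: "(\<Sum>p\<in>{- int K..int K}. (1 / 2 :: real) ^ nat \<bar>p\<bar>) = 3 - 2 * (1 / 2) ^ K"
proof (induction K)
  case (Suc K)
  have "{- int (Suc K)..int (Suc K)} = insert (- int (Suc K)) (insert (int (Suc K)) {- int K..int K})"
    by auto
  then show ?case using Suc by (simp add: nat_add_distrib)
qed auto

text \<open>Counting lattice points in an \<open>\<ell>\<^sub>1\<close> ball by an exponential moment:
  each of them has weight at least \<open>2 ^ (- B)\<close>.\<close>

lemma card_lattice_le:
  assumes Q: "Q \<subseteq> PiE {..<d} (\<lambda>_. {- int K..int K} \<times> {- int K..int K})"
    and B: "\<And>q. q \<in> Q \<Longrightarrow> (\<Sum>k<d. nat \<bar>fst (q k)\<bar> + nat \<bar>snd (q k)\<bar>) \<le> B"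
  shows "real (card Q) \<le> 2 ^ B * 9 ^ d"
proof -
  let ?A = "{- int K..int K} \<times> {- int K..int K}"
  let ?w = "\<lambda>p :: int \<times> int. (1 / 2 :: real) ^ nat \<bar>fst p\<bar> * (1 / 2) ^ nat \<bar>snd p\<bar>"
  have fin: "finite (PiE {..<d} (\<lambda>_. ?A))"
    by (intro finite_PiE) auto
  have "real (card Q) * (1 / 2) ^ B = (\<Sum>q\<in>Q. (1 / 2) ^ B)" by simp
  also have "\<dots> \<le> (\<Sum>q\<in>Q. \<Prod>k<d. ?w (q k))"
  proof (rule sum_mono)
    fix q assume "q \<in> Q"
    have "(1 / 2 :: real) ^ B \<le> (1 / 2) ^ (\<Sum>k<d. nat \<bar>fst (q k)\<bar> + nat \<bar>snd (q k)\<bar>)"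
      by (rule power_decreasing) (use B[OF \<open>q \<in> Q\<close>] in auto)
    then show "(1 / 2) ^ B \<le> (\<Prod>k<d. ?w (q k))"
      by (simp add: power_sum power_add)
  qed
  also have "\<dots> \<le> (\<Sum>q\<in>PiE {..<d} (\<lambda>_. ?A). \<Prod>k<d. ?w (q k))"
    by (rule sum_mono2[OF fin Q]) (rule prod_nonneg, simp)
  also have "\<dots> = (\<Prod>k<d. \<Sum>p\<in>?A. ?w p)"
    by (rule prod_sum_PiE[symmetric]) auto
  also have "(\<Sum>p\<in>?A. ?w p) = (3 - 2 * (1 / 2) ^ K) * (3 - 2 * (1 / 2) ^ K)"
    unfolding sum_half_powers_int[symmetric] sum_product sum.cartesian_product
    by (simp only: case_prod_unfold)
  also have "(\<Prod>k<d. (3 - 2 * (1 / 2) ^ K) * (3 - 2 * (1 / 2 :: real) ^ K)) \<le> (\<Prod>k<d. 3 * 3)"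
  proof -
    have "(1 / 2 :: real) ^ K \<le> 1" by (rule power_le_one) auto
    then show ?thesis by (intro prod_mono conjI mult_mono mult_nonneg_nonneg) auto
  qed
  finally show ?thesis by (simp add: field_simps)
qed

text \<open>The net: round to the lattice of mesh \<open>\<delta> / sqrt (2 d)\<close>, and keep one point
  of \<open>S\<close> in each cell that meets \<open>S\<close>.\<close>

lemma exists_net:
  fixes \<delta> :: real
  assumes "\<delta> > 0"
  obtains A where "A \<ge> 0"
    and "\<And>d S. d \<ge> 1 \<Longrightarrow> S \<subseteq> {v. vnorm d v \<le> 1} \<Longrightarrow>
      \<exists>N. finite N \<and> N \<subseteq> S \<and> real (card N) \<le> exp (A * real d) \<and>
          (\<forall>v\<in>S. \<exists>v0\<in>N. vnorm d (\<lambda>k. v k - v0 k) \<le> \<delta>)"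
proof
  \<comment> \<open>The lattice points have an l1 norm of at most d L: a real coordinate t
    contributes at most t^2 + 2, there are 2 d of them, and the squares sum to at most 1 / h^2 = d
    (2 / \<delta>^2) because a cell of side h in 2 d real dimensions has diameter \<delta>.\<close>
  define L :: nat where "L = nat \<lceil>2 / \<delta>\<^sup>2 + 4\<rceil>"
  define A where "A = ln (2 ^ L * 9 :: real)"
  show "A \<ge> 0"
    using mult_mono[of 1 "2 ^ L" 1 "9 :: real"] unfolding A_def by (intro ln_ge_zero) simp
  fix d :: nat and S
  assume d: "d \<ge> 1" and S: "S \<subseteq> {v. vnorm d v \<le> 1}"
  define h where "h = \<delta> / sqrt (2 * real d)"
  have h: "h > 0" using assms d by (simp add: h_def)
  have h2: "2 * real d * h\<^sup>2 = \<delta>\<^sup>2"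
    using d by (simp add: h_def power_divide)
  define q where "q = (\<lambda>v :: nat \<Rightarrow> complex. \<lambda>k\<in>{..<d}. (\<lfloor>Re (v k) / h\<rfloor>, \<lfloor>Im (v k) / h\<rfloor>))"
  have near: "vnorm d (\<lambda>k. v k - w k) \<le> \<delta>" if "q v = q w" for v w
  proof -
    have *: "(cmod (v k - w k))\<^sup>2 \<le> 2 * h\<^sup>2" if "k < d" for k
    proof -
      have "(\<lfloor>Re (v k) / h\<rfloor>, \<lfloor>Im (v k) / h\<rfloor>) = (\<lfloor>Re (w k) / h\<rfloor>, \<lfloor>Im (w k) / h\<rfloor>)"
        using fun_cong[OF \<open>q v = q w\<close>, of k] that by (simp add: q_def)
      then have "\<bar>Re (v k) / h - Re (w k) / h\<bar> \<le> 1" "\<bar>Im (v k) / h - Im (w k) / h\<bar> \<le> 1"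
        by (simp_all, linarith+)
      then have "\<bar>Re (v k - w k)\<bar> \<le> h" "\<bar>Im (v k - w k)\<bar> \<le> h"
        using h by (simp_all add: abs_divide divide_le_eq flip: diff_divide_distrib)
      then have "(Re (v k - w k))\<^sup>2 \<le> h\<^sup>2" "(Im (v k - w k))\<^sup>2 \<le> h\<^sup>2"
        using h by (metis abs_le_square_iff abs_of_pos)+
      then show ?thesis unfolding cmod_power2 by linarith
    qed
    have "(vnorm d (\<lambda>k. v k - w k))\<^sup>2 \<le> (\<Sum>k<d. 2 * h\<^sup>2)"
      unfolding vnorm_power2 by (intro sum_mono *) auto
    also have "\<dots> = \<delta>\<^sup>2" using h2 by simp
    finally show ?thesis using assms by (simp add: power2_le_iff_abs_le)
  qed
  have size: "(\<Sum>k<d. nat \<bar>fst (q v k)\<bar> + nat \<bar>snd (q v k)\<bar>) \<le> d * L" if "v \<in> S" for v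
  proof -
    have fl: "real_of_int \<bar>\<lfloor>t\<rfloor>\<bar> \<le> t\<^sup>2 + 2" for t :: real
    proof -
      have "\<bar>real_of_int \<lfloor>t\<rfloor>\<bar> \<le> \<bar>t\<bar> + 1" by linarith
      moreover have "0 \<le> (\<bar>t\<bar> - 1)\<^sup>2" by simp
      ultimately show ?thesis by (simp add: power2_diff)
    qed
    have "(\<Sum>k<d. real_of_int \<bar>fst (q v k)\<bar> + real_of_int \<bar>snd (q v k)\<bar>)
        \<le> (\<Sum>k<d. ((Re (v k) / h)\<^sup>2 + 2) + ((Im (v k) / h)\<^sup>2 + 2))"
      by (intro sum_mono add_mono) (simp_all only: q_def restrict_apply' fst_conv snd_conv fl)
    also have "\<dots> = (vnorm d v)\<^sup>2 / h\<^sup>2 + 4 * real d"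
      by (simp add: vnorm_power2 cmod_power2 sum.distrib power_divide sum_divide_distrib add_divide_distrib)
    also have "\<dots> \<le> 1 / h\<^sup>2 + 4 * real d"
      using S that h by (intro add_mono divide_right_mono) (auto simp: power_le_one_iff)
    also have "1 / h\<^sup>2 = real d * (2 / \<delta>\<^sup>2)"
      using h2 h assms d by (simp add: field_simps)
    also have "real d * (2 / \<delta>\<^sup>2) + 4 * real d = real d * (2 / \<delta>\<^sup>2 + 4)"
      by (simp add: ring_distribs)
    also have "\<dots> \<le> real d * real L"
      unfolding L_def by (intro mult_left_mono of_nat_ceiling) auto
    finally have "real (\<Sum>k<d. nat \<bar>fst (q v k)\<bar> + nat \<bar>snd (q v k)\<bar>) \<le> real (d * L)"
      by simp
    then show ?thesis by (simp only: of_nat_le_iff)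
  qed
  have range: "q ` S \<subseteq> PiE {..<d} (\<lambda>_. {- int (d * L)..int (d * L)} \<times> {- int (d * L)..int (d * L)})"
  proof
    fix r assume "r \<in> q ` S"
    then obtain v where v: "v \<in> S" "r = q v" by auto
    have "nat \<bar>fst (q v k)\<bar> + nat \<bar>snd (q v k)\<bar> \<le> d * L" if "k < d" for k
      using member_le_sum[of k "{..<d}" "\<lambda>k. nat \<bar>fst (q v k)\<bar> + nat \<bar>snd (q v k)\<bar>"] size[OF v(1)] that
      by simp
    then have "\<bar>fst (q v k)\<bar> \<le> int (d * L) \<and> \<bar>snd (q v k)\<bar> \<le> int (d * L)" if "k < d" for k
      using that by (smt (verit) nat_le_iff add_leD1 add_leD2)
    then have "q v k \<in> {- int (d * L)..int (d * L)} \<times> {- int (d * L)..int (d * L)}" if "k < d" for k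
      using that by (auto simp: mem_Times_iff abs_le_iff minus_le_iff simp del: of_nat_mult)
    moreover have "q v k = undefined" if "k \<notin> {..<d}" for k
      using that by (simp add: q_def)
    ultimately show "r \<in> PiE {..<d} (\<lambda>_. {- int (d * L)..int (d * L)} \<times> {- int (d * L)..int (d * L)})"
      unfolding v(2) by (intro PiE_I) auto
  qed
  have fin: "finite (q ` S)"
    by (rule finite_subset[OF range]) (intro finite_PiE; simp)
  have card: "real (card (q ` S)) \<le> 2 ^ (d * L) * 9 ^ d"
    by (rule card_lattice_le[OF range]) (use size in auto)
  define rep where "rep = (\<lambda>r. SOME v. v \<in> S \<and> q v = r)"
  have rep: "rep r \<in> S \<and> q (rep r) = r" if "r \<in> q ` S" for r
  proof -
    have "\<exists>v. v \<in> S \<and> q v = r" using that by auto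
    then show ?thesis unfolding rep_def by (rule someI_ex)
  qed
  show "\<exists>N. finite N \<and> N \<subseteq> S \<and> real (card N) \<le> exp (A * real d) \<and>
          (\<forall>v\<in>S. \<exists>v0\<in>N. vnorm d (\<lambda>k. v k - v0 k) \<le> \<delta>)"
  proof (intro exI conjI ballI)
    show "finite (rep ` q ` S)" using fin by simp
    show "rep ` q ` S \<subseteq> S" using rep by auto
    have "real (card (rep ` q ` S)) \<le> real (card (q ` S))"
      using card_image_le[OF fin] by simp
    also note card
    also have "2 ^ (d * L) * 9 ^ d = exp (A * real d)"
    proof -
      have "exp (A * real d) = exp A ^ d"
        by (subst mult.commute) (rule exp_of_nat_mult)
      also have "\<dots> = (2 ^ L * 9) ^ d" by (simp add: A_def)
      finally show ?thesis by (simp add: power_mult_distrib power_mult mult.commute)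
    qed
    finally show "real (card (rep ` q ` S)) \<le> exp (A * real d)" .
    fix v assume "v \<in> S"
    then show "\<exists>v0\<in>rep ` q ` S. vnorm d (\<lambda>k. v k - v0 k) \<le> \<delta>"
      using rep[of "q v"] by (auto intro!: near bexI[of _ "rep (q v)"])
  qed
qed

text \<open>The square root of the form is a seminorm \<open>p\<close>. With S its supremum over the
  unit sphere, comparison with the net gives S \<le> sqrt s + \<delta> S. The loss tends to 1 with
  \<delta>, which keeps a sharp constant in the upper bound.\<close>

lemma weighted_form_le_of_net:
  fixes \<omega> :: "nat \<Rightarrow> real"
  assumes \<omega>: "\<And>j. j < m \<Longrightarrow> 0 \<le> \<omega> j" and \<delta>: "\<delta> < 1" and s: "0 \<le> s"
    and net: "\<And>v. vnorm d v = 1 \<Longrightarrow> \<exists>v0\<in>N. vnorm d (\<lambda>k. v k - v0 k) \<le> \<delta>"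
    and N: "\<And>v. v \<in> N \<Longrightarrow> (\<Sum>j<m. \<omega> j * (cmod (adj_dot d (a j) v))\<^sup>2) \<le> s"
    and v: "vnorm d v = 1"
  shows "(\<Sum>j<m. \<omega> j * (cmod (adj_dot d (a j) v))\<^sup>2) \<le> s / (1 - \<delta>)\<^sup>2"
proof -
  define p where "p = (\<lambda>v. L2_set (\<lambda>j. sqrt (\<omega> j) * cmod (adj_dot d (a j) v)) {..<m})"
  have p2: "(p v)\<^sup>2 = (\<Sum>j<m. \<omega> j * (cmod (adj_dot d (a j) v))\<^sup>2)" for v
    unfolding p_def L2_set_def using \<omega>
    by (subst real_sqrt_pow2) (auto intro!: sum_nonneg simp: power_mult_distrib)
  have p0: "0 \<le> p v" for v by (simp add: p_def)
  have pscale: "p (\<lambda>k. of_real c * v k) = c * p v" if "0 \<le> c" for c v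
    unfolding p_def using that by (simp add: adj_dot_scale norm_mult L2_set_right_distrib mult_ac)
  have padd: "p (\<lambda>k. v k + w k) \<le> p v + p w" for v w
  proof -
    have "p (\<lambda>k. v k + w k) \<le> L2_set (\<lambda>j. sqrt (\<omega> j) * cmod (adj_dot d (a j) v)
        + sqrt (\<omega> j) * cmod (adj_dot d (a j) w)) {..<m}"
      unfolding p_def adj_dot_add using \<omega>
      by (intro L2_set_mono) (auto simp: norm_triangle_ineq mult_left_mono simp flip: ring_distribs)
    also have "\<dots> \<le> p v + p w" unfolding p_def by (rule L2_set_triangle_ineq)
    finally show ?thesis .
  qed
  define S where "S = (SUP v\<in>{v. vnorm d v = 1}. p v)"
  \<comment> \<open>Finiteness of the supremum, by a crude bound depending on \<open>a\<close>, is
    what permits moving the term \<delta> S to the other side.\<close>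
  have bdd: "bdd_above (p ` {v. vnorm d v = 1})"
  proof (rule bdd_aboveI2)
    fix v assume "v \<in> {v. vnorm d v = 1}"
    then show "p v \<le> L2_set (\<lambda>j. sqrt (\<omega> j) * (\<Sum>k<d. cmod (a j k))) {..<m}"
      unfolding p_def using cmod_adj_dot_le[of d _ v] \<omega>
      by (intro L2_set_mono mult_left_mono) auto
  qed
  have le_S: "p u \<le> S" if "vnorm d u = 1" for u
    unfolding S_def by (rule cSUP_upper[OF _ bdd]) (use that in auto)
  have le_S': "p u \<le> S * vnorm d u" for u
  proof (cases "vnorm d u = 0")
    case True
    then have "adj_dot d (a j) u = 0" for j
      using cmod_adj_dot_le[of d "a j" u] by simp
    then show ?thesis by (simp add: p_def True L2_set_constant)
  next
    case False
    then have pos: "vnorm d u > 0" using vnorm_nonneg[of d u] by linarith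
    let ?u = "\<lambda>k. complex_of_real (1 / vnorm d u) * u k"
    have "p u = vnorm d u * p ?u"
      using pscale[of "1 / vnorm d u" u] pos by simp
    also have "\<dots> \<le> vnorm d u * S"
      using pos by (intro mult_left_mono le_S) (auto simp only: vnorm_scale norm_of_real, simp)
    finally show ?thesis by (simp add: mult.commute)
  qed
  have S0: "0 \<le> S" using le_S[OF v] p0[of v] by linarith
  have "S \<le> sqrt s + \<delta> * S"
    unfolding S_def
  proof (rule cSUP_least)
    show "{v. vnorm d v = 1} \<noteq> {}" using v by auto
    fix u assume "u \<in> {v. vnorm d v = 1}"
    then obtain v0 where v0: "v0 \<in> N" "vnorm d (\<lambda>k. u k - v0 k) \<le> \<delta>"
      using net by auto
    have "p u \<le> p v0 + p (\<lambda>k. u k - v0 k)"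
      using padd[of v0 "\<lambda>k. u k - v0 k"] by simp
    also have "p v0 \<le> sqrt s"
      using N[OF v0(1)] p2[of v0] by (simp add: real_le_rsqrt)
    also have "p (\<lambda>k. u k - v0 k) \<le> S * \<delta>"
      using le_S'[of "\<lambda>k. u k - v0 k"] v0(2) S0 by (meson mult_left_mono order.trans)
    finally show "p u \<le> sqrt s + \<delta> * (SUP v\<in>{v. vnorm d v = 1}. p v)"
      by (simp add: S_def mult.commute)
  qed
  then have "S \<le> sqrt s / (1 - \<delta>)"
    using \<delta> by (simp add: field_simps)
  then have "p v \<le> sqrt s / (1 - \<delta>)" using le_S[OF v] by linarith
  then have "(p v)\<^sup>2 \<le> (sqrt s / (1 - \<delta>))\<^sup>2" using p0 by (intro power_mono) auto
  then show ?thesis using s by (simp add: p2 power_divide)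
qed

section \<open>Chernoff bounds and exceptional sets\<close>

lemma chernoff_bound:
  fixes f :: "nat \<Rightarrow> (nat \<Rightarrow> complex) \<Rightarrow> real" and c :: "nat \<Rightarrow> real"
  assumes f: "\<And>j. j < m \<Longrightarrow> integrable (cgauss_vec d) (\<lambda>a. exp (f j a))"
    and c: "\<And>j. j < m \<Longrightarrow> (LINT a|cgauss_vec d. exp (f j a)) \<le> exp (c j)"
  shows "measure (gauss_vectors m d) {a \<in> space (gauss_vectors m d). s \<le> (\<Sum>j<m. f j (a j))}
    \<le> exp ((\<Sum>j<m. c j) - s)"
proof -
  interpret c: prob_space "cgauss_vec d" by (rule prob_space_cgauss_vec)
  interpret p: product_sigma_finite "\<lambda>_::nat. cgauss_vec d" ..
  let ?M = "gauss_vectors m d"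
  have i: "integrable ?M (\<lambda>a. \<Prod>j<m. exp (f j (a j)))"
    unfolding gauss_vectors_eq by (rule p.product_integrable_prod) (use f in auto)
  have "measure ?M {a \<in> space ?M. s \<le> (\<Sum>j<m. f j (a j))}
      = measure ?M {a \<in> space ?M. exp s \<le> (\<Prod>j<m. exp (f j (a j)))}"
    by (simp flip: exp_sum)
  also have "\<dots> \<le> (LINT a|?M. (\<Prod>j<m. exp (f j (a j)))) / exp s"
    by (rule integral_Markov_inequality_measure[OF i, of "{}"]) (auto intro!: prod_nonneg)
  also have "(LINT a|?M. (\<Prod>j<m. exp (f j (a j)))) = (\<Prod>j<m. LINT a|cgauss_vec d. exp (f j a))"
    unfolding gauss_vectors_eq by (rule p.product_integral_prod) (use f in auto)
  also have "\<dots> \<le> (\<Prod>j<m. exp (c j))"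
    by (rule prod_mono) (use c in auto)
  also have "(\<Prod>j<m. exp (c j)) / exp s = exp ((\<Sum>j<m. c j) - s)"
    by (simp add: exp_diff exp_sum)
  finally show ?thesis by (simp add: divide_right_mono)
qed

text \<open>The exceptional set is a measurable superset of the failures, so \<open>P\<close> itself
  may quantify over uncountably many vectors without being known to be measurable.\<close>

definition holds_except :: "'a measure \<Rightarrow> real \<Rightarrow> ('a \<Rightarrow> bool) \<Rightarrow> bool" where
  "holds_except M p P \<longleftrightarrow> (\<exists>B\<in>sets M. measure M B \<le> p \<and> (\<forall>a\<in>space M - B. P a))"

lemma holds_exceptI:
  assumes "{a \<in> space M. \<not> P a} \<in> sets M" "measure M {a \<in> space M. \<not> P a} \<le> p"
  shows "holds_except M p P"
  using assms unfolding holds_except_def by (intro bexI[of _ "{a \<in> space M. \<not> P a}"]) auto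

lemma holds_except_mono:
  assumes "holds_except M p P" "p \<le> q" "\<And>a. a \<in> space M \<Longrightarrow> P a \<Longrightarrow> Q a"
  shows "holds_except M q Q"
  using assms unfolding holds_except_def by (meson DiffD1 order.trans)

lemma holds_except_conj:
  assumes "holds_except M p P" "holds_except M q Q"
  shows "holds_except M (p + q) (\<lambda>a. P a \<and> Q a)"
proof -
  obtain A B where "A \<in> sets M" "measure M A \<le> p" "\<forall>a\<in>space M - A. P a"
    "B \<in> sets M" "measure M B \<le> q" "\<forall>a\<in>space M - B. Q a"
    using assms unfolding holds_except_def by blast
  then show ?thesis
    unfolding holds_except_def
    by (intro bexI[of _ "A \<union> B"]) (auto intro: order.trans[OF measure_Un_le])
qed

lemma holds_except_ball:
  assumes "finite N" "\<And>i. i \<in> N \<Longrightarrow> holds_except M p (P i)"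
  shows "holds_except M (real (card N) * p) (\<lambda>a. \<forall>i\<in>N. P i a)"
proof -
  obtain B where B: "\<And>i. i \<in> N \<Longrightarrow> B i \<in> sets M" "\<And>i. i \<in> N \<Longrightarrow> measure M (B i) \<le> p"
    "\<And>i. i \<in> N \<Longrightarrow> \<forall>a\<in>space M - B i. P i a"
    using assms(2) unfolding holds_except_def by metis
  have "measure M (\<Union>i\<in>N. B i) \<le> (\<Sum>i\<in>N. measure M (B i))"
    using assms(1) B(1) by (rule measure_UNION_le)
  also have "\<dots> \<le> real (card N) * p"
    using B(2) by (rule sum_bounded_above)
  finally show ?thesis
    unfolding holds_except_def using B assms(1)
    by (intro bexI[of _ "\<Union>i\<in>N. B i"]) auto
qed

lemma measurable_adj_dot_component:
  "j < m \<Longrightarrow> (\<lambda>a. adj_dot d (a j) v) \<in> borel_measurable (gauss_vectors m d)"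
  by (rule measurable_compose[OF measurable_gauss_vectors_component measurable_adj_dot])

lemma holds_except_chernoff:
  fixes f :: "nat \<Rightarrow> (nat \<Rightarrow> complex) \<Rightarrow> real" and c :: "nat \<Rightarrow> real"
  assumes meas: "\<And>j. j < m \<Longrightarrow> f j \<in> borel_measurable (cgauss_vec d)"
    and f: "\<And>j. j < m \<Longrightarrow> integrable (cgauss_vec d) (\<lambda>a. exp (f j a))"
    and c: "\<And>j. j < m \<Longrightarrow> (LINT a|cgauss_vec d. exp (f j a)) \<le> exp (c j)"
    and p: "exp ((\<Sum>j<m. c j) - s) \<le> p"
  shows "holds_except (gauss_vectors m d) p (\<lambda>a. (\<Sum>j<m. f j (a j)) < s)"
proof (rule holds_exceptI)
  have [measurable]: "(\<lambda>a. f j (a j)) \<in> borel_measurable (gauss_vectors m d)" if "j < m" for j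
    using that by (intro measurable_compose[OF measurable_gauss_vectors_component meas])
  have "(\<lambda>a. \<Sum>j<m. f j (a j)) \<in> borel_measurable (gauss_vectors m d)"
    by (rule borel_measurable_sum) auto
  then show "{a \<in> space (gauss_vectors m d). \<not> (\<Sum>j<m. f j (a j)) < s} \<in> sets (gauss_vectors m d)"
    by measurable
  have "{a \<in> space (gauss_vectors m d). \<not> (\<Sum>j<m. f j (a j)) < s}
      = {a \<in> space (gauss_vectors m d). s \<le> (\<Sum>j<m. f j (a j))}" by auto
  then show "measure (gauss_vectors m d) {a \<in> space (gauss_vectors m d). \<not> (\<Sum>j<m. f j (a j)) < s} \<le> p"
    using chernoff_bound[of m d f c s, OF f c] p by simp
qed

section \<open>Upper bounds for sample covariances\<close>

text \<open>A crude bound, used later to control Lipschitz errors. The moment bound 2 at parameter 1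
  / 4 gives \<open>8 * real m\<close> on the net, since m ln 2 - 2 m \<le> - m; a net with \<delta>
  = 1 / 2 costs a further factor 4.\<close>

lemma holds_except_sample_covariance:
  obtains A where "A \<ge> 0"
    and "\<And>m d. d \<ge> 1 \<Longrightarrow> holds_except (gauss_vectors m d) (exp (A * real d - real m))
      (\<lambda>a. \<forall>v. vnorm d v = 1 \<longrightarrow> (\<Sum>j<m. (cmod (adj_dot d (a j) v))\<^sup>2) \<le> 32 * real m)"
proof -
  obtain A where A: "A \<ge> 0" and net: "\<And>d S. d \<ge> 1 \<Longrightarrow> S \<subseteq> {v. vnorm d v \<le> 1} \<Longrightarrow>
      \<exists>N. finite N \<and> N \<subseteq> S \<and> real (card N) \<le> exp (A * real d) \<and>
          (\<forall>v\<in>S. \<exists>v0\<in>N. vnorm d (\<lambda>k. v k - v0 k) \<le> 1 / 2)"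
    by (rule exists_net[of "1 / 2"]; simp; blast)
  have "holds_except (gauss_vectors m d) (exp (A * real d - real m))
      (\<lambda>a. \<forall>v. vnorm d v = 1 \<longrightarrow> (\<Sum>j<m. (cmod (adj_dot d (a j) v))\<^sup>2) \<le> 32 * real m)"
    if d: "d \<ge> 1" for m d
  proof -
    have "{v. vnorm d v = 1} \<subseteq> {v. vnorm d v \<le> 1}" by auto
    from net[OF d this] obtain N where N: "finite N" "N \<subseteq> {v. vnorm d v = 1}"
      "real (card N) \<le> exp (A * real d)"
      "\<forall>v\<in>{v. vnorm d v = 1}. \<exists>v0\<in>N. vnorm d (\<lambda>k. v k - v0 k) \<le> 1 / 2"
      by (elim exE conjE)
    have "holds_except (gauss_vectors m d) (exp (- real m))
        (\<lambda>a. (\<Sum>j<m. (cmod (adj_dot d (a j) v))\<^sup>2 / 4) < 2 * real m)" if "vnorm d v = 1" for v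
    proof (rule holds_except_chernoff[where f = "\<lambda>_ a. (cmod (adj_dot d a v))\<^sup>2 / 4" and c = "\<lambda>_. ln 2"])
      show "integrable (cgauss_vec d) (\<lambda>a. exp ((cmod (adj_dot d a v))\<^sup>2 / 4))"
        "(LINT a|cgauss_vec d. exp ((cmod (adj_dot d a v))\<^sup>2 / 4)) \<le> exp (ln 2)"
        using integrable_exp_adj_dot[of d v] integral_exp_adj_dot[of d v] that by auto
      have "real m * ln 2 \<le> real m * 1"
        using ln_le_minus_one[of 2] by (intro mult_left_mono) auto
      then show "exp ((\<Sum>j<m. ln 2) - 2 * real m) \<le> exp (- real m)" by simp
    qed simp
    then have "holds_except (gauss_vectors m d) (real (card N) * exp (- real m))
        (\<lambda>a. \<forall>v\<in>N. (\<Sum>j<m. (cmod (adj_dot d (a j) v))\<^sup>2 / 4) < 2 * real m)"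
      using N(2) by (intro holds_except_ball N(1)) auto
    then show ?thesis
    proof (rule holds_except_mono)
      show "real (card N) * exp (- real m) \<le> exp (A * real d - real m)"
        using N(3) by (simp add: exp_diff exp_minus divide_inverse)
      fix a assume a: "\<forall>v\<in>N. (\<Sum>j<m. (cmod (adj_dot d (a j) v))\<^sup>2 / 4) < 2 * real m"
      have "(\<Sum>j<m. 1 * (cmod (adj_dot d (a j) v))\<^sup>2) \<le> 8 * real m / (1 - 1 / 2)\<^sup>2"
        if "vnorm d v = 1" for v
      proof (rule weighted_form_le_of_net[of m "\<lambda>_. 1" "1 / 2" "8 * real m" d N a v])
        fix v assume "v \<in> N"
        then show "(\<Sum>j<m. 1 * (cmod (adj_dot d (a j) v))\<^sup>2) \<le> 8 * real m"
          using a by (auto simp flip: sum_divide_distrib)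
      qed (use N(4) that in auto)
      then show "\<forall>v. vnorm d v = 1 \<longrightarrow> (\<Sum>j<m. (cmod (adj_dot d (a j) v))\<^sup>2) \<le> 32 * real m"
        by (simp add: power2_eq_square)
    qed
  qed
  with A that show ?thesis by blast
qed

text \<open>The level 8 log m makes the failure probability of one sample at most 2 / m^2, so that
  the union over m samples still leaves 2 / m.\<close>

lemma holds_except_max_adj_dot:
  assumes x: "vnorm d x = 1" and m: "m \<ge> 1"
  shows "holds_except (gauss_vectors m d) (2 / real m)
    (\<lambda>a. \<forall>j\<in>{..<m}. (cmod (adj_dot d (a j) x))\<^sup>2 \<le> 8 * ln (real m))"
proof (rule holds_except_mono)
  have "holds_except (gauss_vectors m d) (2 / (real m)\<^sup>2)
      (\<lambda>a. (cmod (adj_dot d (a i) x))\<^sup>2 \<le> 8 * ln (real m))" if "i < m" for i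
  proof (rule holds_except_mono)
    \<comment> \<open>A tail bound for one sample is obtained from the product Chernoff bound by
      setting all other summands to 0.\<close>
    show "holds_except (gauss_vectors m d) (2 / (real m)\<^sup>2)
        (\<lambda>a. (\<Sum>j<m. (\<lambda>a. if j = i then (cmod (adj_dot d a x))\<^sup>2 / 4 else 0) (a j)) < 2 * ln (real m))"
    proof (rule holds_except_chernoff[where c = "\<lambda>j. if j = i then ln 2 else 0"])
      interpret c: prob_space "cgauss_vec d" by (rule prob_space_cgauss_vec)
      fix j assume "j < m"
      show "(\<lambda>a. if j = i then (cmod (adj_dot d a x))\<^sup>2 / 4 else 0) \<in> borel_measurable (cgauss_vec d)"
        by simp
      show "integrable (cgauss_vec d) (\<lambda>a. exp (if j = i then (cmod (adj_dot d a x))\<^sup>2 / 4 else 0))"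
        using integrable_exp_adj_dot[of d x] x by (cases "j = i") auto
      show "(LINT a|cgauss_vec d. exp (if j = i then (cmod (adj_dot d a x))\<^sup>2 / 4 else 0))
          \<le> exp (if j = i then ln 2 else 0)"
        using integral_exp_adj_dot[of d x] x by (cases "j = i") (auto simp: c.prob_space)
    next
      have "exp (2 * ln (real m)) = (real m)\<^sup>2"
        using m by (simp add: exp_double)
      then show "exp ((\<Sum>j<m. if j = i then ln 2 else 0) - 2 * ln (real m)) \<le> 2 / (real m)\<^sup>2"
        using \<open>i < m\<close> by (simp add: exp_diff)
    qed
  qed (use \<open>i < m\<close> in auto)
  then show "holds_except (gauss_vectors m d) (real (card {..<m}) * (2 / (real m)\<^sup>2))
    (\<lambda>a. \<forall>j\<in>{..<m}. (cmod (adj_dot d (a j) x))\<^sup>2 \<le> 8 * ln (real m))"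
    by (intro holds_except_ball) auto
qed (simp_all add: power2_eq_square)

lemma
  shows integrable_Re_adj_dot_norm2:
    "integrable (cgauss_vec d) (\<lambda>a. Re (adj_dot d a u) * (cmod (adj_dot d a v))\<^sup>2)"
    and integral_Re_adj_dot_norm2:
    "(LINT a|cgauss_vec d. Re (adj_dot d a u) * (cmod (adj_dot d a v))\<^sup>2) = 0"
proof -
  let ?v = "\<lambda>k. - \<i> * v k"
  have eq: "Re (adj_dot d a u) * (cmod (adj_dot d a v))\<^sup>2
      = Re (adj_dot d a u) * Re (adj_dot d a v) * Re (adj_dot d a v)
      + Re (adj_dot d a u) * Re (adj_dot d a ?v) * Re (adj_dot d a ?v)" for a
    unfolding cmod_power2 Im_adj_dot by (simp add: power2_eq_square algebra_simps)
  show "integrable (cgauss_vec d) (\<lambda>a. Re (adj_dot d a u) * (cmod (adj_dot d a v))\<^sup>2)"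
    unfolding eq by (intro Bochner_Integration.integrable_add integrable_Re_adj_dot_triple)
  show "(LINT a|cgauss_vec d. Re (adj_dot d a u) * (cmod (adj_dot d a v))\<^sup>2) = 0"
    unfolding eq
    by (simp only: Bochner_Integration.integral_add integrable_Re_adj_dot_triple integral_Re_adj_dot_triple)
qed

text \<open>In the expansion of the square the part linear in \<open>\<beta>\<close> is cubic in the
  Gaussian vector, hence of mean zero; the remaining two parts have means at most 2 and
  \<open>(cmod \<beta>)\<^sup>2\<close>.\<close>

lemma
  assumes x: "vnorm d x \<le> 1" and v: "vnorm d v \<le> 1"
  shows integrable_shifted: "integrable (cgauss_vec d)
      (\<lambda>a. (cmod (adj_dot d a x + \<beta>))\<^sup>2 * (cmod (adj_dot d a v))\<^sup>2)"
    and integral_shifted_le: "(LINT a|cgauss_vec d. (cmod (adj_dot d a x + \<beta>))\<^sup>2 * (cmod (adj_dot d a v))\<^sup>2)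
      \<le> 2 + (cmod \<beta>)\<^sup>2"
proof -
  let ?x = "\<lambda>k. cnj \<beta> * x k"
  have eq: "(cmod (adj_dot d a x + \<beta>))\<^sup>2 * (cmod (adj_dot d a v))\<^sup>2
      = (cmod (adj_dot d a x))\<^sup>2 * (cmod (adj_dot d a v))\<^sup>2
        + 2 * (Re (adj_dot d a ?x) * (cmod (adj_dot d a v))\<^sup>2)
        + (cmod \<beta>)\<^sup>2 * (cmod (adj_dot d a v))\<^sup>2" for a
    unfolding cmod_power2 adj_dot_scale by (simp add: power2_eq_square algebra_simps)
  have iv: "integrable (cgauss_vec d) (\<lambda>a. (cmod (adj_dot d a v))\<^sup>2)"
    using integrable_adj_dot_power[OF v, of 1] by simp
  show "integrable (cgauss_vec d) (\<lambda>a. (cmod (adj_dot d a x + \<beta>))\<^sup>2 * (cmod (adj_dot d a v))\<^sup>2)"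
    unfolding eq by (intro Bochner_Integration.integrable_add integrable_mult_right
        integrable_adj_dot_22 integrable_Re_adj_dot_norm2 iv x v)
  have "(LINT a|cgauss_vec d. (cmod (adj_dot d a x + \<beta>))\<^sup>2 * (cmod (adj_dot d a v))\<^sup>2)
      = (LINT a|cgauss_vec d. (cmod (adj_dot d a x))\<^sup>2 * (cmod (adj_dot d a v))\<^sup>2)
        + (cmod \<beta>)\<^sup>2 * (vnorm d v)\<^sup>2"
    unfolding eq
    by (simp only: Bochner_Integration.integral_add Bochner_Integration.integral_mult_right_zero
        integrable_adj_dot_22[OF v x] integrable_Re_adj_dot_norm2 iv
        Bochner_Integration.integrable_add integrable_mult_right integral_Re_adj_dot_norm2
        integral_adj_dot_2)
  also have "\<dots> \<le> 2 + (cmod \<beta>)\<^sup>2 * 1"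
    using v by (intro add_mono integral_adj_dot_22_le mult_left_mono x) (auto simp: power_le_one_iff)
  finally show "(LINT a|cgauss_vec d. (cmod (adj_dot d a x + \<beta>))\<^sup>2 * (cmod (adj_dot d a v))\<^sup>2)
      \<le> 2 + (cmod \<beta>)\<^sup>2" by simp
qed

section \<open>Moment generating function of the truncated weights\<close>

lemma exp_le_quadratic:
  fixes s :: real
  assumes "0 \<le> s"
  shows "exp s \<le> 1 + s + s\<^sup>2 * exp s"
proof -
  have "(1 - s) * exp s \<le> exp (- s) * exp s"
    using exp_ge_add_one_self[of "- s"] by (intro mult_right_mono) auto
  \<comment> \<open>This inequality is inserted into itself. The factor \<open>exp s\<close> must
    remain in the remainder because \<open>s\<close> will be unbounded.\<close>
  then have *: "exp s \<le> 1 + s * exp s" by (simp add: exp_minus algebra_simps)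
  have "s * exp s \<le> s * (1 + s * exp s)"
    using assms * by (intro mult_left_mono)
  with * show ?thesis by (simp add: power2_eq_square algebra_simps)
qed

text \<open>The product 24 * 8 ^ 4 comes from q^4 \<le> 4! 8^4 exp (q / 8). The factor 32 is 8 from
  squaring the weight, times 4 from two exponential moments of at most 2 each.\<close>

definition mgf_const :: real where "mgf_const = 32 * 24 * 8 ^ 4"

text \<open>Meant for p = |a^* x|^2, q = |a^* v|^2 and B = |b|^4. The product of p^2 with a function
  of q is split by the arithmetic-geometric mean, so that only exponential moments of single
  projections occur, both at the admissible parameter 1 / 4.\<close>

lemma mgf_remainder_bound:
  fixes p q B :: real
  assumes "0 \<le> p" "0 \<le> q" "0 \<le> B"
  shows "8 * (p\<^sup>2 + B) * q\<^sup>2 * exp (q / 16) \<le> mgf_const / 4 * (1 + B) * (exp (p / 4) + exp (q / 4))"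
proof -
  let ?P = "exp (p / 4)" and ?Q = "exp (q / 4)"
  have p4: "p ^ 4 \<le> 24 * 4 ^ 4 * ?P"
    using power_le_fact_exp[of p 4 4] assms by (simp add: fact_numeral)
  have q4: "q ^ 4 * exp (q / 16) ^ 2 \<le> 24 * 8 ^ 4 * ?Q"
  proof -
    have "q ^ 4 * exp (q / 16) ^ 2 \<le> 24 * 8 ^ 4 * exp (q / 8) * exp (q / 16) ^ 2"
      using power_le_fact_exp[of q 8 4] assms by (intro mult_right_mono) (auto simp: fact_numeral)
    also have "\<dots> = 24 * 8 ^ 4 * ?Q"
      by (simp add: mult_exp_exp flip: exp_double)
    finally show ?thesis .
  qed
  have q2: "q\<^sup>2 * exp (q / 16) \<le> 128 * ?Q"
  proof -
    have "q\<^sup>2 * exp (q / 16) \<le> 128 * exp (q / 8) * exp (q / 16)"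
      using power_le_fact_exp[of q 8 2] assms by (intro mult_right_mono) (auto simp: fact_numeral)
    also have "\<dots> \<le> 128 * ?Q"
      using assms by (simp add: mult_exp_exp)
    finally show ?thesis .
  qed
  have "p\<^sup>2 * (q\<^sup>2 * exp (q / 16)) \<le> ((p\<^sup>2)\<^sup>2 + (q\<^sup>2 * exp (q / 16))\<^sup>2) / 2"
    using zero_le_power2[of "p\<^sup>2 - q\<^sup>2 * exp (q / 16)"] unfolding power2_diff by simp
  also have "\<dots> = (p ^ 4 + q ^ 4 * exp (q / 16) ^ 2) / 2"
    by (simp add: power_mult_distrib)
  also have "\<dots> \<le> 24 * 8 ^ 4 * (?P + ?Q)"
    using p4 q4 by (simp add: field_simps) (smt (verit) exp_gt_zero)
  finally have 1: "p\<^sup>2 * (q\<^sup>2 * exp (q / 16)) \<le> 24 * 8 ^ 4 * (?P + ?Q)" .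
  have 2: "B * (q\<^sup>2 * exp (q / 16)) \<le> B * (24 * 8 ^ 4 * (?P + ?Q))"
  proof (rule mult_left_mono)
    note q2
    also have "128 * ?Q \<le> 24 * 8 ^ 4 * ?Q" by simp
    also have "\<dots> \<le> 24 * 8 ^ 4 * (?P + ?Q)" by (intro mult_left_mono) auto
    finally show "q\<^sup>2 * exp (q / 16) \<le> 24 * 8 ^ 4 * (?P + ?Q)" .
  qed (use assms in auto)
  have "8 * (p\<^sup>2 + B) * q\<^sup>2 * exp (q / 16) = 8 * (p\<^sup>2 * (q\<^sup>2 * exp (q / 16)) + B * (q\<^sup>2 * exp (q / 16)))"
    by (simp add: algebra_simps)
  also have "\<dots> \<le> 8 * (24 * 8 ^ 4 * (?P + ?Q) + B * (24 * 8 ^ 4 * (?P + ?Q)))"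
    by (rule mult_left_mono[OF add_mono[OF 1 2]]) simp
  also have "\<dots> = mgf_const / 4 * (1 + B) * (?P + ?Q)"
    by (simp add: mgf_const_def algebra_simps)
  finally show ?thesis .
qed

lemma cmod_add_power2_le: "(cmod (s + t))\<^sup>2 \<le> 2 * (cmod s)\<^sup>2 + 2 * (cmod t)\<^sup>2"
proof -
  have "(cmod (s + t))\<^sup>2 \<le> (cmod s + cmod t)\<^sup>2"
    by (intro power_mono norm_triangle_ineq) auto
  also have "\<dots> \<le> 2 * (cmod s)\<^sup>2 + 2 * (cmod t)\<^sup>2"
    using zero_le_power2[of "cmod s - cmod t"] unfolding power2_diff power2_sum by simp
  finally show ?thesis .
qed

text \<open>The cut-off looks only at the sample itself, so the truncated terms stay independent.
  The value outside is 0, so the truncated weight never exceeds the true one and agrees with it on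
  the event of \<open>holds_except_max_adj_dot\<close>.\<close>

definition trunc_meas :: "real \<Rightarrow> complex \<Rightarrow> complex \<Rightarrow> real" where
  "trunc_meas T s \<beta> = (if (cmod s)\<^sup>2 \<le> T then (cmod (s + \<beta>))\<^sup>2 else 0)"

lemma trunc_meas_nonneg: "0 \<le> trunc_meas T s \<beta>"
  by (simp add: trunc_meas_def)

text \<open>By \<open>small\<close> the exponent is at most |a^* v|^2 / 16, which keeps the
  remainder of \<open>exp_le_quadratic\<close> integrable. The linear term is bounded by the mean of
  the untruncated product, so no truncation bias has to be estimated.\<close>

lemma
  fixes T l :: real and \<beta> :: complex
  assumes x: "vnorm d x \<le> 1" and v: "vnorm d v \<le> 1" and l: "0 \<le> l" and T: "0 \<le> T"
    and small: "l * (2 * T + 2 * (cmod \<beta>)\<^sup>2) \<le> 1 / 16"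
  defines "f \<equiv> \<lambda>a. l * (trunc_meas T (adj_dot d a x) \<beta> * (cmod (adj_dot d a v))\<^sup>2)"
  shows measurable_trunc_meas: "f \<in> borel_measurable (cgauss_vec d)"
    and integrable_exp_trunc_meas: "integrable (cgauss_vec d) (\<lambda>a. exp (f a))"
    and integral_exp_trunc_meas: "(LINT a|cgauss_vec d. exp (f a))
      \<le> exp (l * (2 + (cmod \<beta>)\<^sup>2) + l\<^sup>2 * mgf_const * (1 + cmod \<beta> ^ 4))"
proof -
  interpret c: prob_space "cgauss_vec d" by (rule prob_space_cgauss_vec)
  let ?p = "\<lambda>a. (cmod (adj_dot d a x))\<^sup>2" and ?q = "\<lambda>a. (cmod (adj_dot d a v))\<^sup>2"
  let ?y = "\<lambda>a. (cmod (adj_dot d a x + \<beta>))\<^sup>2"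
  let ?B = "cmod \<beta> ^ 4"
  let ?F = "\<lambda>a. 1 + l * (?y a * ?q a)
      + l\<^sup>2 * (mgf_const / 4 * (1 + ?B)) * (exp (?p a / 4) + exp (?q a / 4))"
  show [measurable]: "f \<in> borel_measurable (cgauss_vec d)"
    unfolding f_def trunc_meas_def by measurable
  have le: "exp (f a) \<le> ?F a" for a
  proof -
    have f0: "0 \<le> f a" unfolding f_def using l by (simp add: trunc_meas_nonneg)
    have ty: "trunc_meas T (adj_dot d a x) \<beta> \<le> ?y a" by (simp add: trunc_meas_def)
    have f1: "f a \<le> l * (?y a * ?q a)"
      unfolding f_def using l ty by (intro mult_left_mono mult_right_mono) auto
    have "trunc_meas T (adj_dot d a x) \<beta> \<le> 2 * T + 2 * (cmod \<beta>)\<^sup>2"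
      using cmod_add_power2_le[of "adj_dot d a x" \<beta>] T by (auto simp: trunc_meas_def)
    then have "l * trunc_meas T (adj_dot d a x) \<beta> \<le> 1 / 16"
      using small l by (meson mult_left_mono order.trans)
    then have f2: "f a \<le> ?q a / 16"
      unfolding f_def using mult_right_mono[of "l * trunc_meas T (adj_dot d a x) \<beta>" "1 / 16" "?q a"]
      by (simp add: mult.assoc)
    have y2: "(?y a)\<^sup>2 \<le> 8 * ((?p a)\<^sup>2 + ?B)"
    proof -
      have "(?y a)\<^sup>2 \<le> (2 * ?p a + 2 * (cmod \<beta>)\<^sup>2)\<^sup>2"
        by (intro power_mono cmod_add_power2_le) auto
      also have "\<dots> \<le> 8 * ((?p a)\<^sup>2 + ((cmod \<beta>)\<^sup>2)\<^sup>2)"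
        using zero_le_power2[of "?p a - (cmod \<beta>)\<^sup>2"] unfolding power2_diff power2_sum
        by (simp add: power_mult_distrib)
      finally show ?thesis by simp
    qed
    have "(f a)\<^sup>2 * exp (f a) \<le> (l * (?y a * ?q a))\<^sup>2 * exp (?q a / 16)"
      using f0 f1 f2 by (intro mult_mono power_mono) auto
    also have "\<dots> = l\<^sup>2 * ((?y a)\<^sup>2 * ((?q a)\<^sup>2 * exp (?q a / 16)))"
      by (simp add: power_mult_distrib mult_ac)
    also have "\<dots> \<le> l\<^sup>2 * (8 * ((?p a)\<^sup>2 + ?B) * ((?q a)\<^sup>2 * exp (?q a / 16)))"
      using y2 by (intro mult_left_mono mult_right_mono) auto
    also have "\<dots> \<le> l\<^sup>2 * (mgf_const / 4 * (1 + ?B) * (exp (?p a / 4) + exp (?q a / 4)))"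
      using mgf_remainder_bound[of "?p a" "?q a" ?B] by (intro mult_left_mono) (auto simp: mult.assoc)
    finally show ?thesis
      using exp_le_quadratic[OF f0] f1 by (simp add: mult.assoc)
  qed
  have iF: "integrable (cgauss_vec d) ?F"
    by (intro Bochner_Integration.integrable_add integrable_mult_right integrable_shifted
        integrable_exp_adj_dot x v) auto
  show i: "integrable (cgauss_vec d) (\<lambda>a. exp (f a))"
    by (rule Bochner_Integration.integrable_bound[OF iF])
       (use le in \<open>auto intro: order.trans[OF _ abs_ge_self]\<close>)
  have "(LINT a|cgauss_vec d. exp (f a)) \<le> (LINT a|cgauss_vec d. ?F a)"
    by (intro integral_mono i iF le)
  also have "\<dots> = 1 + l * (LINT a|cgauss_vec d. ?y a * ?q a)
      + l\<^sup>2 * (mgf_const / 4 * (1 + ?B)) * ((LINT a|cgauss_vec d. exp (?p a / 4)) + (LINT a|cgauss_vec d. exp (?q a / 4)))"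
    using integrable_shifted[OF x v, of \<beta>] integrable_exp_adj_dot[OF x] integrable_exp_adj_dot[OF v]
    by (simp add: c.prob_space)
  also have "\<dots> \<le> 1 + l * (2 + (cmod \<beta>)\<^sup>2) + l\<^sup>2 * (mgf_const / 4 * (1 + ?B)) * (2 + 2)"
    using l by (intro add_mono mult_left_mono integral_shifted_le integral_exp_adj_dot x v mult_nonneg_nonneg)
       (auto simp: mgf_const_def)
  also have "\<dots> = 1 + (l * (2 + (cmod \<beta>)\<^sup>2) + l\<^sup>2 * mgf_const * (1 + ?B))"
    by simp
  also have "\<dots> \<le> exp (l * (2 + (cmod \<beta>)\<^sup>2) + l\<^sup>2 * mgf_const * (1 + ?B))"
    by (rule exp_ge_add_one_self)
  finally show "(LINT a|cgauss_vec d. exp (f a))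
      \<le> exp (l * (2 + (cmod \<beta>)\<^sup>2) + l\<^sup>2 * mgf_const * (1 + ?B))" .
qed

lemma power2_le_one_plus_power4: "(x::real)\<^sup>2 \<le> 1 + x ^ 4"
proof -
  have "0 \<le> (x\<^sup>2 - 1)\<^sup>2 + (x\<^sup>2)\<^sup>2 + 1" by simp
  then show ?thesis by (simp add: power2_diff)
qed

lemma ge_one_ln: "(m::nat) \<ge> 3 \<Longrightarrow> 1 \<le> ln (real m)"
  using exp_le by (subst ln_ge_iff) auto

text \<open>The tilt is c1 / log m, as large as weights of order log m allow; the deviation of the
  mean then has exponent of order m / log m, against a net of size exp (A d).\<close>

lemma holds_except_trunc_covariance:
  fixes K1 K2 \<epsilon> :: real
  assumes K1: "K1 > 0" and \<epsilon>: "\<epsilon> > 0"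
  obtains A c where "A \<ge> 0" "c > 0"
    and "\<And>m d x b. d \<ge> 1 \<Longrightarrow> m \<ge> 3 \<Longrightarrow> vnorm d x = 1 \<Longrightarrow>
      (\<Sum>j<m. cmod (b j) ^ 4) \<le> K1 * real m \<Longrightarrow>
      (\<And>j. j < m \<Longrightarrow> cmod (b j) \<le> K2 * sqrt (ln (real m))) \<Longrightarrow>
      holds_except (gauss_vectors m d) (exp (A * real d - c * real m / ln (real m)))
      (\<lambda>a. \<forall>v. vnorm d v = 1 \<longrightarrow>
        (\<Sum>j<m. trunc_meas (8 * ln (real m)) (adj_dot d (a j) x) (b j) * (cmod (adj_dot d (a j) v))\<^sup>2)
          \<le> 2 * real m + (\<Sum>j<m. (cmod (b j))\<^sup>2) + \<epsilon> * real m)"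
proof -
  \<comment> \<open>Half of \<open>\<epsilon>\<close> pays for the deviation on the net, half for
    leaving the net. The level on the net is at most (3 + K1 + e) m, so a relative loss
    \<open>\<eta>\<close> costs at most e m, and \<open>\<delta>\<close> satisfies 1 - 2 \<delta> =
    1 / (1 + \<eta>).\<close>
  define e where "e = \<epsilon> / 2"
  define \<eta> where "\<eta> = e / (3 + K1 + e)"
  define \<delta> where "\<delta> = \<eta> / (2 * (1 + \<eta>))"
  \<comment> \<open>The first entry yields the hypothesis \<open>small\<close> of the moment
    generating function bound; the second makes its quadratic term at most half of the gain l e
    m.\<close>
  define c1 where "c1 = min (1 / (32 * (8 + K2\<^sup>2))) (e / (2 * mgf_const * (1 + K1)))"
  have e: "e > 0" using \<epsilon> by (simp add: e_def)
  have \<eta>: "\<eta> > 0" using e K1 by (simp add: \<eta>_def)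
  have \<delta>: "\<delta> > 0" "\<delta> < 1" using \<eta> by (auto simp: \<delta>_def field_simps)
  have \<delta>': "1 / (1 - \<delta>)\<^sup>2 \<le> 1 + \<eta>"
  proof -
    have "1 / (1 + \<eta>) = 1 - 2 * \<delta>" using \<eta> by (simp add: \<delta>_def field_simps)
    also have "\<dots> \<le> (1 - \<delta>)\<^sup>2" by (simp add: power2_diff)
    finally show ?thesis using \<eta> \<delta> by (simp add: field_simps)
  qed
  have mc: "mgf_const > 0" by (simp add: mgf_const_def)
  have K2': "0 < 8 + K2\<^sup>2" by (simp add: add_pos_nonneg)
  have c1: "c1 > 0" "c1 * (32 * (8 + K2\<^sup>2)) \<le> 1" "c1 * (2 * mgf_const * (1 + K1)) \<le> e"
  proof -
    show "c1 > 0" unfolding c1_def using e mc K1 K2' by simp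
    have "c1 \<le> 1 / (32 * (8 + K2\<^sup>2))" "c1 \<le> e / (2 * mgf_const * (1 + K1))"
      by (simp_all add: c1_def)
    then show "c1 * (32 * (8 + K2\<^sup>2)) \<le> 1" "c1 * (2 * mgf_const * (1 + K1)) \<le> e"
      using mc K1 K2' by (simp_all add: pos_le_divide_eq)
  qed
  obtain A where A: "A \<ge> 0" and net: "\<And>d S. d \<ge> 1 \<Longrightarrow> S \<subseteq> {v. vnorm d v \<le> 1} \<Longrightarrow>
      \<exists>N. finite N \<and> N \<subseteq> S \<and> real (card N) \<le> exp (A * real d) \<and>
          (\<forall>v\<in>S. \<exists>v0\<in>N. vnorm d (\<lambda>k. v k - v0 k) \<le> \<delta>)"
    by (rule exists_net[OF \<delta>(1)]; blast)
  have main: "holds_except (gauss_vectors m d) (exp (A * real d - c1 * e / 2 * real m / ln (real m)))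
      (\<lambda>a. \<forall>v. vnorm d v = 1 \<longrightarrow>
        (\<Sum>j<m. trunc_meas (8 * ln (real m)) (adj_dot d (a j) x) (b j) * (cmod (adj_dot d (a j) v))\<^sup>2)
          \<le> 2 * real m + (\<Sum>j<m. (cmod (b j))\<^sup>2) + \<epsilon> * real m)"
    if d: "d \<ge> 1" and m: "m \<ge> 3" and x: "vnorm d x = 1"
      and b4: "(\<Sum>j<m. cmod (b j) ^ 4) \<le> K1 * real m"
      and bmax: "\<And>j. j < m \<Longrightarrow> cmod (b j) \<le> K2 * sqrt (ln (real m))"
    for m d :: nat and x b :: "nat \<Rightarrow> complex"
  proof -
    have ln1: "1 \<le> ln (real m)" by (rule ge_one_ln[OF m])
    \<comment> \<open>\<open>T\<close> is the level respected by all samples in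
      \<open>holds_except_max_adj_dot\<close>, and \<open>l\<close> is the Chernoff
      parameter.\<close>
    define T l where "T = 8 * ln (real m)" and "l = c1 / ln (real m)"
    define b2 where "b2 = (\<Sum>j<m. (cmod (b j))\<^sup>2)"
    define s where "s = 2 * real m + b2 + e * real m"
    have l: "l > 0" "l \<le> c1" using c1 ln1 by (auto simp: l_def divide_le_eq)
    have small: "l * (2 * T + 2 * (cmod (b j))\<^sup>2) \<le> 1 / 16" if "j < m" for j
    proof -
      have "(cmod (b j))\<^sup>2 \<le> (K2 * sqrt (ln (real m)))\<^sup>2"
        using bmax[OF that] by (intro power_mono) auto
      also have "\<dots> = K2\<^sup>2 * ln (real m)" using ln1 by (simp add: power_mult_distrib)
      finally have "l * (2 * T + 2 * (cmod (b j))\<^sup>2) \<le> l * (2 * T + 2 * (K2\<^sup>2 * ln (real m)))"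
        using l by (intro mult_left_mono) auto
      also have "\<dots> = c1 * (32 * (8 + K2\<^sup>2)) / 16"
        using ln1 by (simp add: l_def T_def field_simps)
      finally show ?thesis using c1(2) by simp
    qed
    have b2: "0 \<le> b2" "b2 \<le> (1 + K1) * real m"
    proof -
      show "0 \<le> b2" unfolding b2_def by (intro sum_nonneg) auto
      have "b2 \<le> (\<Sum>j<m. 1 + cmod (b j) ^ 4)"
        unfolding b2_def by (intro sum_mono power2_le_one_plus_power4)
      then show "b2 \<le> (1 + K1) * real m" using b4 by (simp add: sum.distrib algebra_simps)
    qed
    have "{v. vnorm d v = 1} \<subseteq> {v. vnorm d v \<le> 1}" by auto
    from net[OF d this] obtain N where N: "finite N" "N \<subseteq> {v. vnorm d v = 1}"
      "real (card N) \<le> exp (A * real d)"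
      "\<forall>v\<in>{v. vnorm d v = 1}. \<exists>v0\<in>N. vnorm d (\<lambda>k. v k - v0 k) \<le> \<delta>"
      by (elim exE conjE)
    let ?p = "exp (- (c1 * e / 2 * real m / ln (real m)))"
    let ?f = "\<lambda>v j a. l * (trunc_meas T (adj_dot d a x) (b j) * (cmod (adj_dot d a v))\<^sup>2)"
    have "holds_except (gauss_vectors m d) ?p (\<lambda>a. (\<Sum>j<m. ?f v j (a j)) < l * s)" if v: "vnorm d v = 1" for v
    proof (rule holds_except_chernoff[where
          c = "\<lambda>j. l * (2 + (cmod (b j))\<^sup>2) + l\<^sup>2 * mgf_const * (1 + cmod (b j) ^ 4)"])
      fix j assume j: "j < m"
      have T0: "0 \<le> T" using ln1 by (simp add: T_def)
      have le: "vnorm d x \<le> 1" "vnorm d v \<le> 1" "0 \<le> l" using x v l by auto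
      show "?f v j \<in> borel_measurable (cgauss_vec d)"
        by (rule measurable_trunc_meas[OF le T0 small[OF j]])
      show "integrable (cgauss_vec d) (\<lambda>a. exp (?f v j a))"
        by (rule integrable_exp_trunc_meas[OF le T0 small[OF j]])
      show "(LINT a|cgauss_vec d. exp (?f v j a))
          \<le> exp (l * (2 + (cmod (b j))\<^sup>2) + l\<^sup>2 * mgf_const * (1 + cmod (b j) ^ 4))"
        by (rule integral_exp_trunc_meas[OF le T0 small[OF j]])
    next
      have "(\<Sum>j<m. l * (2 + (cmod (b j))\<^sup>2) + l\<^sup>2 * mgf_const * (1 + cmod (b j) ^ 4))
          = l * (2 * real m + b2) + l\<^sup>2 * mgf_const * (real m + (\<Sum>j<m. cmod (b j) ^ 4))"
        by (simp add: sum.distrib b2_def flip: sum_distrib_left)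
      also have "\<dots> \<le> l * (2 * real m + b2) + l\<^sup>2 * mgf_const * (real m + K1 * real m)"
        using b4 mc by (intro add_left_mono mult_left_mono) auto
      also have "\<dots> = l * (2 * real m + b2) + l * real m / 2 * (l * (2 * mgf_const * (1 + K1)))"
        by (simp add: power2_eq_square algebra_simps)
      also have "l * (2 * mgf_const * (1 + K1)) \<le> c1 * (2 * mgf_const * (1 + K1))"
        using l mc K1 by (intro mult_right_mono) auto
      also note c1(3)
      also have "l * (2 * real m + b2) + l * real m / 2 * e = l * s - c1 * e / 2 * real m / ln (real m)"
        by (simp add: s_def l_def ring_distribs mult_ac)
      finally show "exp ((\<Sum>j<m. l * (2 + (cmod (b j))\<^sup>2) + l\<^sup>2 * mgf_const * (1 + cmod (b j) ^ 4)) - l * s) \<le> ?p"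
        using l by (simp add: mult_left_mono)
    qed
    then have "holds_except (gauss_vectors m d) (real (card N) * ?p)
        (\<lambda>a. \<forall>v\<in>N. (\<Sum>j<m. ?f v j (a j)) < l * s)"
      using N(2) by (intro holds_except_ball N(1)) auto
    then show ?thesis
    proof (rule holds_except_mono)
      show "real (card N) * ?p \<le> exp (A * real d - c1 * e / 2 * real m / ln (real m))"
        using mult_right_mono[OF N(3), of ?p] by (simp only: mult_exp_exp diff_conv_add_uminus exp_ge_zero)
      fix a assume a: "\<forall>v\<in>N. (\<Sum>j<m. ?f v j (a j)) < l * s"
      have s0: "0 \<le> s" using b2 e by (simp add: s_def)
      have fin: "(\<Sum>j<m. trunc_meas T (adj_dot d (a j) x) (b j) * (cmod (adj_dot d (a j) v))\<^sup>2)
          \<le> 2 * real m + b2 + \<epsilon> * real m" if "vnorm d v = 1" for v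
      proof -
        have "(\<Sum>j<m. trunc_meas T (adj_dot d (a j) x) (b j) * (cmod (adj_dot d (a j) v))\<^sup>2)
            \<le> s / (1 - \<delta>)\<^sup>2"
        proof (rule weighted_form_le_of_net[of m _ \<delta> s d N a v])
          fix v assume "v \<in> N"
          then have "l * (\<Sum>j<m. trunc_meas T (adj_dot d (a j) x) (b j) * (cmod (adj_dot d (a j) v))\<^sup>2) < l * s"
            using a by (simp add: sum_distrib_left)
          then show "(\<Sum>j<m. trunc_meas T (adj_dot d (a j) x) (b j) * (cmod (adj_dot d (a j) v))\<^sup>2) \<le> s"
            using l by simp
        qed (use N(4) that \<delta> s0 in \<open>auto simp: trunc_meas_nonneg\<close>)
        also have "\<dots> = s * (1 / (1 - \<delta>)\<^sup>2)" by simp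
        also have "\<dots> \<le> s * (1 + \<eta>)"
          using \<delta>' s0 by (rule mult_left_mono)
        also have "\<dots> = s + \<eta> * s" by (simp add: algebra_simps)
        also have "\<eta> * s \<le> \<eta> * ((3 + K1 + e) * real m)"
        proof (rule mult_left_mono)
          have "s \<le> 2 * real m + (1 + K1) * real m + e * real m" using b2 by (simp add: s_def)
          also have "\<dots> = (3 + K1 + e) * real m" by (simp add: ring_distribs)
          finally show "s \<le> (3 + K1 + e) * real m" .
        qed (use \<eta> in simp)
        also have "\<dots> = e * real m"
          using K1 e by (simp add: \<eta>_def)
        finally show ?thesis by (simp add: s_def e_def)
      qed
      then show "\<forall>v. vnorm d v = 1 \<longrightarrow>
        (\<Sum>j<m. trunc_meas (8 * ln (real m)) (adj_dot d (a j) x) (b j) * (cmod (adj_dot d (a j) v))\<^sup>2)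
          \<le> 2 * real m + (\<Sum>j<m. (cmod (b j))\<^sup>2) + \<epsilon> * real m"
        by (simp add: T_def b2_def)
    qed
  qed
  show thesis
    by (rule that[OF A _ main]) (use c1 e in auto)
qed

section \<open>The lower bound for the quartic part\<close>

text \<open>The nonnegative, y-free part of one Hessian summand, at s = u (cnj w). Being homogeneous
  of degree 2 under real scaling, it handles clipping, normalisation of \<open>v\<close> and
  rescaling of \<open>z\<close> alike.\<close>

definition hess_form :: "complex \<Rightarrow> real" where
  "hess_form s = 2 * (cmod s)\<^sup>2 + 4 * (Re s)\<^sup>2"

text \<open>Radial projection onto the disc of radius R. It multiplies by a real number in [0, 1],
  so \<open>hess_form\<close> of a clipped product is a rescaled \<open>hess_form\<close>.\<close>

definition clip :: "real \<Rightarrow> complex \<Rightarrow> complex" where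
  "clip R u = complex_of_real (R / max R (cmod u)) * u"

lemma hess_form_nonneg: "0 \<le> hess_form s"
  by (simp add: hess_form_def)

lemma hess_form_le: "hess_form s \<le> 6 * (cmod s)\<^sup>2"
  unfolding hess_form_def cmod_power2 by simp

lemma hess_form_scale: "hess_form (complex_of_real c * s) = c\<^sup>2 * hess_form s"
  by (simp add: hess_form_def norm_mult power_mult_distrib algebra_simps)

lemma abs_power2_diff_le:
  fixes x y B :: real
  assumes "\<bar>x\<bar> \<le> B" "\<bar>y\<bar> \<le> B"
  shows "\<bar>x\<^sup>2 - y\<^sup>2\<bar> \<le> 2 * B * \<bar>x - y\<bar>"
proof -
  have "\<bar>x\<^sup>2 - y\<^sup>2\<bar> = \<bar>x + y\<bar> * \<bar>x - y\<bar>"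
    by (simp add: power2_eq_square algebra_simps flip: abs_mult)
  also have "\<dots> \<le> 2 * B * \<bar>x - y\<bar>"
    using assms by (intro mult_right_mono) auto
  finally show ?thesis .
qed

lemma hess_form_lipschitz:
  assumes "cmod s \<le> B" "cmod t \<le> B"
  shows "\<bar>hess_form s - hess_form t\<bar> \<le> 12 * B * cmod (s - t)"
proof -
  have B: "0 \<le> B" using assms(1) norm_ge_zero[of s] by linarith
  have "\<bar>(cmod s)\<^sup>2 - (cmod t)\<^sup>2\<bar> \<le> 2 * B * \<bar>cmod s - cmod t\<bar>"
    using assms by (intro abs_power2_diff_le) auto
  also have "\<dots> \<le> 2 * B * cmod (s - t)"
    using B by (intro mult_left_mono norm_triangle_ineq3) auto
  finally have 1: "\<bar>(cmod s)\<^sup>2 - (cmod t)\<^sup>2\<bar> \<le> 2 * B * cmod (s - t)" .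
  have "\<bar>(Re s)\<^sup>2 - (Re t)\<^sup>2\<bar> \<le> 2 * B * \<bar>Re s - Re t\<bar>"
    using assms abs_Re_le_cmod[of s] abs_Re_le_cmod[of t] by (intro abs_power2_diff_le) linarith+
  also have "\<dots> \<le> 2 * B * cmod (s - t)"
    using B abs_Re_le_cmod[of "s - t"] by (intro mult_left_mono) auto
  finally have 2: "\<bar>(Re s)\<^sup>2 - (Re t)\<^sup>2\<bar> \<le> 2 * B * cmod (s - t)" .
  show ?thesis using 1 2 unfolding hess_form_def by linarith
qed

lemma norm_clip_le: "R > 0 \<Longrightarrow> cmod (clip R u) \<le> R"
proof -
  assume R: "R > 0"
  have "R * cmod u \<le> R * max R (cmod u)" using R by (intro mult_left_mono) auto
  then show ?thesis
    using R by (simp add: clip_def norm_mult norm_divide divide_le_eq max_def)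
qed

lemma clip_lipschitz:
  assumes R: "R > 0"
  shows "cmod (clip R u - clip R v) \<le> 2 * cmod (u - v)"
proof -
  define r s where "r = max R (cmod u)" and "s = max R (cmod v)"
  have r: "r > 0" "R \<le> r" and s: "s > 0" "cmod v \<le> s" using R by (auto simp: r_def s_def)
  have rs: "\<bar>s - r\<bar> \<le> cmod (u - v)"
    using norm_triangle_ineq3[of u v] unfolding r_def s_def by linarith
  have "clip R u - clip R v = complex_of_real (R / r) * (u - v) + complex_of_real (R / r - R / s) * v"
    unfolding clip_def r_def[symmetric] s_def[symmetric] of_real_diff by (simp only: algebra_simps)
  then have "cmod (clip R u - clip R v) \<le> \<bar>R / r\<bar> * cmod (u - v) + \<bar>R / r - R / s\<bar> * cmod v"
    by (metis norm_triangle_ineq norm_mult norm_of_real)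
  also have "\<bar>R / r\<bar> * cmod (u - v) \<le> 1 * cmod (u - v)"
    using r R by (intro mult_right_mono) auto
  also have "\<bar>R / r - R / s\<bar> * cmod v = (R / r) * (cmod v / s) * \<bar>s - r\<bar>"
  proof -
    have "R / r - R / s = R * (s - r) / (r * s)"
      using r s by (simp add: field_simps)
    then show ?thesis using r s R by (simp add: abs_mult)
  qed
  also have "\<dots> \<le> 1 * 1 * \<bar>s - r\<bar>"
    using r s R by (intro mult_right_mono mult_mono) auto
  finally show ?thesis using rs by simp
qed

lemma borel_measurable_clip [measurable (raw)]:
  assumes [measurable]: "f \<in> borel_measurable M"
  shows "(\<lambda>x. clip R (f x)) \<in> borel_measurable M"
  unfolding clip_def by measurable

lemma borel_measurable_hess_form [measurable (raw)]:
  assumes [measurable]: "f \<in> borel_measurable M"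
  shows "(\<lambda>x. hess_form (f x)) \<in> borel_measurable M"
  unfolding hess_form_def by measurable

text \<open>Clipping multiplies the product by a real factor in [0, 1], whence the first inequality.
  If anything is clipped, then |u|^2 + |w|^2 \<ge> R^2, and this quotient inserts the factor 1 / R^2
  into the trivial bound 6 |u|^2 |w|^2 for the loss.\<close>

lemma
  assumes R: "R > 0"
  shows hess_form_clip_le: "hess_form (clip R u * cnj (clip R w)) \<le> hess_form (u * cnj w)"
    and hess_form_clip_ge: "hess_form (u * cnj w)
      - 6 / R\<^sup>2 * ((cmod u) ^ 4 * (cmod w)\<^sup>2 + (cmod u)\<^sup>2 * (cmod w) ^ 4)
      \<le> hess_form (clip R u * cnj (clip R w))"
proof -
  define \<rho> where "\<rho> = R / max R (cmod u) * (R / max R (cmod w))"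
  have \<rho>: "0 \<le> \<rho>" "\<rho> \<le> 1"
    unfolding \<rho>_def using R by (auto intro!: mult_le_one simp del: times_divide_eq_right times_divide_eq_left)
  have eq: "hess_form (clip R u * cnj (clip R w)) = \<rho>\<^sup>2 * hess_form (u * cnj w)"
  proof -
    have "clip R u * cnj (clip R w) = complex_of_real \<rho> * (u * cnj w)"
      by (simp add: clip_def \<rho>_def)
    then show ?thesis by (simp only: hess_form_scale)
  qed
  show "hess_form (clip R u * cnj (clip R w)) \<le> hess_form (u * cnj w)"
    unfolding eq using \<rho> by (simp add: mult_left_le_one_le hess_form_nonneg power_le_one_iff)
  show "hess_form (u * cnj w) - 6 / R\<^sup>2 * ((cmod u) ^ 4 * (cmod w)\<^sup>2 + (cmod u)\<^sup>2 * (cmod w) ^ 4)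
      \<le> hess_form (clip R u * cnj (clip R w))"
  proof (cases "cmod u \<le> R \<and> cmod w \<le> R")
    case True
    then have "\<rho> = 1" using R by (simp add: \<rho>_def max_absorb1)
    moreover have "0 \<le> 6 / R\<^sup>2 * ((cmod u) ^ 4 * (cmod w)\<^sup>2 + (cmod u)\<^sup>2 * (cmod w) ^ 4)" by simp
    ultimately show ?thesis unfolding eq by simp
  next
    case False
    then have "R\<^sup>2 \<le> (cmod u)\<^sup>2 + (cmod w)\<^sup>2"
      using R power_mono[of R "cmod u" 2] power_mono[of R "cmod w" 2]
      by (smt (verit) zero_le_power2)
    then have "6 * ((cmod u)\<^sup>2 * (cmod w)\<^sup>2) * R\<^sup>2
        \<le> 6 * ((cmod u)\<^sup>2 * (cmod w)\<^sup>2) * ((cmod u)\<^sup>2 + (cmod w)\<^sup>2)"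
      by (intro mult_left_mono) auto
    also have "\<dots> = 6 * ((cmod u) ^ 4 * (cmod w)\<^sup>2 + (cmod u)\<^sup>2 * (cmod w) ^ 4)"
      by (simp add: power2_eq_square power4_eq_xxxx algebra_simps)
    finally have "6 * ((cmod u)\<^sup>2 * (cmod w)\<^sup>2)
        \<le> 6 / R\<^sup>2 * ((cmod u) ^ 4 * (cmod w)\<^sup>2 + (cmod u)\<^sup>2 * (cmod w) ^ 4)"
      using R by (simp add: field_simps)
    moreover have "hess_form (u * cnj w) \<le> 6 * ((cmod u)\<^sup>2 * (cmod w)\<^sup>2)"
      using hess_form_le[of "u * cnj w"] by (simp add: norm_mult power_mult_distrib)
    ultimately show ?thesis
      using hess_form_nonneg[of "clip R u * cnj (clip R w)"] by linarith
  qed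
qed

text \<open>It is 6 * 30000: the loss carries the factor 6 / R^2, and the moments in
  \<open>tail_bound\<close> add up to 27648 plus at most nine times the fourth power of the
  shift.\<close>

definition clip_const :: real where "clip_const = 180000"

text \<open>Meant for p = |a^* z|^2, q = |a^* v|^2, s = |\<beta>|^2 and A = |a^* z + \<beta>|^2.
  Mixed products are traded for pure powers of one projection, whose moments are bounded
  already.\<close>

lemma tail_bound:
  fixes p q s A :: real
  assumes "0 \<le> p" "0 \<le> q" "0 \<le> s" "0 \<le> A" "A \<le> 2 * p + 2 * s"
  shows "A\<^sup>2 * q + A * q\<^sup>2 \<le> 10 * (p ^ 3 + q ^ 3) + q ^ 4 + 8 * s\<^sup>2 * q + s\<^sup>2"
proof -
  have cubic: "x\<^sup>2 * y \<le> x ^ 3 + y ^ 3" if "0 \<le> x" "0 \<le> y" for x y :: real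
  proof (cases "x \<le> y")
    case True
    then have "x\<^sup>2 * y \<le> y\<^sup>2 * y" using that by (intro mult_right_mono power_mono) auto
    then show ?thesis using that by (simp add: power3_eq_cube power2_eq_square add_increasing)
  next
    case False
    then have "x\<^sup>2 * y \<le> x\<^sup>2 * x" using that by (intro mult_left_mono) auto
    then show ?thesis using that by (simp add: power3_eq_cube power2_eq_square add_increasing2)
  qed
  have "A\<^sup>2 \<le> (2 * p + 2 * s)\<^sup>2" using assms by (intro power_mono) auto
  also have "\<dots> \<le> 8 * (p\<^sup>2 + s\<^sup>2)"
    using zero_le_power2[of "p - s"] unfolding power2_diff power2_sum by (simp add: power_mult_distrib)
  finally have "A\<^sup>2 * q \<le> 8 * (p\<^sup>2 + s\<^sup>2) * q" using assms by (intro mult_right_mono) auto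
  also have "\<dots> \<le> 8 * (p ^ 3 + q ^ 3) + 8 * s\<^sup>2 * q"
    using cubic[of p q] assms by (simp add: algebra_simps)
  finally have 1: "A\<^sup>2 * q \<le> 8 * (p ^ 3 + q ^ 3) + 8 * s\<^sup>2 * q" .
  have "A * q\<^sup>2 \<le> (2 * p + 2 * s) * q\<^sup>2" using assms by (intro mult_right_mono) auto
  also have "\<dots> = 2 * (q\<^sup>2 * p) + 2 * s * q\<^sup>2" by (simp add: algebra_simps)
  also have "\<dots> \<le> 2 * (p ^ 3 + q ^ 3) + (s\<^sup>2 + q ^ 4)"
    using cubic[of q p] assms zero_le_power2[of "s - q\<^sup>2"] unfolding power2_diff by simp
  finally show ?thesis using 1 by simp
qed

text \<open>The terms of the expansion of \<open>hess_form ((\<alpha> + \<beta>) * cnj w)\<close> that are linear in \<open>\<beta>\<close>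
  have vanishing mean, being cubic in the Gaussian vector.\<close>

lemma integral_clip_ge:
  assumes v: "vnorm d v = 1" and z: "vnorm d z \<le> 1" and R: "R > 0"
  shows "2 * (vnorm d z)\<^sup>2 + 4 * (cmod \<beta>)\<^sup>2 - clip_const * (1 + cmod \<beta> ^ 4) / R\<^sup>2
    \<le> (LINT a|cgauss_vec d. hess_form (clip R (adj_dot d a z + \<beta>) * cnj (clip R (adj_dot d a v))))"
proof -
  interpret c: prob_space "cgauss_vec d" by (rule prob_space_cgauss_vec)
  have v': "vnorm d v \<le> 1" using v by simp
  let ?al = "\<lambda>a. adj_dot d a z" and ?w = "\<lambda>a. adj_dot d a v"
  let ?r = "\<lambda>c y a. Re (adj_dot d a (\<lambda>k. c * y k))"
  let ?main = "\<lambda>a. 2 * ((cmod (?al a))\<^sup>2 * (cmod (?w a))\<^sup>2) + 2 * (cmod \<beta>)\<^sup>2 * (cmod (?w a))\<^sup>2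
      + 4 * (?r (cnj \<beta>) v a)\<^sup>2"
  let ?cross = "\<lambda>a. 4 * (?r (cnj \<beta>) z a * (cmod (?w a))\<^sup>2)
      + 8 * (?r 1 z a * ?r 1 v a * ?r (cnj \<beta>) v a + ?r (- \<i>) z a * ?r (- \<i>) v a * ?r (cnj \<beta>) v a)"
  let ?tail = "\<lambda>a. 6 / R\<^sup>2 * (10 * (cmod (?al a) ^ (2 * 3) + cmod (?w a) ^ (2 * 3)) + cmod (?w a) ^ (2 * 4)
      + 8 * (cmod \<beta> ^ 4) * (cmod (?w a))\<^sup>2 + cmod \<beta> ^ 4)"
  let ?X = "\<lambda>a. hess_form (clip R (?al a + \<beta>) * cnj (clip R (?w a)))"
  have le: "?main a + ?cross a - ?tail a \<le> ?X a" for a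
  proof -
    have "hess_form ((?al a + \<beta>) * cnj (?w a))
        = hess_form (?al a * cnj (?w a)) + 2 * (cmod \<beta>)\<^sup>2 * (cmod (?w a))\<^sup>2
          + 4 * (?r (cnj \<beta>) v a)\<^sup>2 + ?cross a"
      unfolding hess_form_def cmod_power2 adj_dot_scale
      by (simp add: power2_eq_square algebra_simps)
    \<comment> \<open>The real-part square of the pure Gaussian term is discarded, which leaves the
      coefficient 2 of the squared norm of \<open>z\<close>.\<close>
    moreover have "2 * ((cmod (?al a))\<^sup>2 * (cmod (?w a))\<^sup>2) \<le> hess_form (?al a * cnj (?w a))"
      by (simp add: hess_form_def norm_mult power_mult_distrib)
    ultimately have 1: "?main a + ?cross a \<le> hess_form ((?al a + \<beta>) * cnj (?w a))" by simp
    have "((cmod (?al a + \<beta>))\<^sup>2)\<^sup>2 * (cmod (?w a))\<^sup>2 + (cmod (?al a + \<beta>))\<^sup>2 * ((cmod (?w a))\<^sup>2)\<^sup>2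
        \<le> 10 * (((cmod (?al a))\<^sup>2) ^ 3 + ((cmod (?w a))\<^sup>2) ^ 3) + ((cmod (?w a))\<^sup>2) ^ 4
          + 8 * ((cmod \<beta>)\<^sup>2)\<^sup>2 * (cmod (?w a))\<^sup>2 + ((cmod \<beta>)\<^sup>2)\<^sup>2"
      by (intro tail_bound cmod_add_power2_le) auto
    then have "cmod (?al a + \<beta>) ^ 4 * (cmod (?w a))\<^sup>2 + (cmod (?al a + \<beta>))\<^sup>2 * cmod (?w a) ^ 4
        \<le> 10 * (cmod (?al a) ^ (2 * 3) + cmod (?w a) ^ (2 * 3)) + cmod (?w a) ^ (2 * 4)
          + 8 * (cmod \<beta> ^ 4) * (cmod (?w a))\<^sup>2 + cmod \<beta> ^ 4"
      by (simp flip: power_mult)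
    then have "6 / R\<^sup>2 * (cmod (?al a + \<beta>) ^ 4 * (cmod (?w a))\<^sup>2 + (cmod (?al a + \<beta>))\<^sup>2 * cmod (?w a) ^ 4)
        \<le> ?tail a"
      by (intro mult_left_mono) auto
    with 1 hess_form_clip_ge[OF R, of "?al a + \<beta>" "?w a"] show ?thesis by linarith
  qed
  have iw: "integrable (cgauss_vec d) (\<lambda>a. (cmod (?w a))\<^sup>2)"
    using integrable_adj_dot_power[OF v', of 1] by simp
  note ints = integrable_adj_dot_22[OF v' z] iw integrable_Re_adj_dot_power
    integrable_Re_adj_dot_norm2 integrable_Re_adj_dot_triple
    integrable_adj_dot_power[OF v'] integrable_adj_dot_power[OF z]
  have imain: "integrable (cgauss_vec d) ?main"
    by (intro Bochner_Integration.integrable_add integrable_mult_right ints)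
  have icross: "integrable (cgauss_vec d) ?cross"
    by (intro Bochner_Integration.integrable_add integrable_mult_right ints)
  have itail: "integrable (cgauss_vec d) ?tail"
    by (intro Bochner_Integration.integrable_add integrable_mult_right ints) simp
  have iX: "integrable (cgauss_vec d) ?X"
  proof (rule c.integrable_const_bound[where B = "6 * (R * R)\<^sup>2"])
    have "?X a \<le> 6 * (R * R)\<^sup>2" for a
    proof -
      have "?X a \<le> 6 * (cmod (clip R (?al a + \<beta>) * cnj (clip R (?w a))))\<^sup>2"
        by (rule hess_form_le)
      also have "\<dots> \<le> 6 * (R * R)\<^sup>2"
        unfolding norm_mult complex_mod_cnj using R
        by (intro mult_left_mono power_mono mult_mono norm_clip_le) auto
      finally show ?thesis .
    qed
    then show "AE a in cgauss_vec d. norm (?X a) \<le> 6 * (R * R)\<^sup>2"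
      by (simp add: hess_form_nonneg)
  qed measurable
  \<comment> \<open>The shift enters twice: 2 |\<beta>|^2 from the modulus, and another 2
    |\<beta>|^2 because the real projection along \<open>cnj \<beta> * v\<close> has second moment
    |\<beta>|^2 / 2.\<close>
  have Emain: "2 * (vnorm d z)\<^sup>2 + 4 * (cmod \<beta>)\<^sup>2 \<le> (LINT a|cgauss_vec d. ?main a)"
  proof -
    have "(LINT a|cgauss_vec d. ?main a)
        = 2 * (LINT a|cgauss_vec d. (cmod (?al a))\<^sup>2 * (cmod (?w a))\<^sup>2)
          + 2 * (cmod \<beta>)\<^sup>2 * (vnorm d v)\<^sup>2 + 4 * ((cmod \<beta>)\<^sup>2 * (vnorm d v)\<^sup>2 / 2)"
      by (simp only: Bochner_Integration.integral_add Bochner_Integration.integral_mult_right_zero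
          Bochner_Integration.integrable_add integrable_mult_right ints
          integral_adj_dot_2 integral_Re_adj_dot_2 vnorm_scale complex_mod_cnj power_mult_distrib)
    then show ?thesis
      using integral_adj_dot_22_ge[OF v' z] by (simp add: v)
  qed
  have Ecross: "(LINT a|cgauss_vec d. ?cross a) = 0"
    by (simp only: Bochner_Integration.integral_add Bochner_Integration.integral_mult_right_zero
        Bochner_Integration.integrable_add integrable_mult_right ints
        integral_Re_adj_dot_norm2 integral_Re_adj_dot_triple)
       simp
  have Etail: "(LINT a|cgauss_vec d. ?tail a) \<le> clip_const * (1 + cmod \<beta> ^ 4) / R\<^sup>2"
  proof -
    have "(LINT a|cgauss_vec d. ?tail a)
        = 6 / R\<^sup>2 * (10 * ((LINT a|cgauss_vec d. cmod (?al a) ^ (2 * 3))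
              + (LINT a|cgauss_vec d. cmod (?w a) ^ (2 * 3)))
          + (LINT a|cgauss_vec d. cmod (?w a) ^ (2 * 4))
          + 8 * (cmod \<beta> ^ 4) * (vnorm d v)\<^sup>2 + cmod \<beta> ^ 4)"
      by (simp only: Bochner_Integration.integral_add Bochner_Integration.integral_mult_right_zero
          Bochner_Integration.integrable_add integrable_mult_right ints c.integrable_const
          integral_adj_dot_2 lebesgue_integral_const c.prob_space) simp
    also have "\<dots> \<le> 6 / R\<^sup>2 * (10 * (fact 3 * 4 ^ 3 * 2 + fact 3 * 4 ^ 3 * 2) + fact 4 * 4 ^ 4 * 2
          + 8 * (cmod \<beta> ^ 4) * 1 + cmod \<beta> ^ 4)"
      by (intro mult_left_mono add_mono integral_adj_dot_power v' z) (auto simp: v)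
    also have "\<dots> \<le> 6 / R\<^sup>2 * (30000 * (1 + cmod \<beta> ^ 4))"
      by (intro mult_left_mono) (auto simp: fact_numeral)
    finally show ?thesis by (simp add: clip_const_def)
  qed
  have "(LINT a|cgauss_vec d. ?main a + ?cross a - ?tail a)
      = (LINT a|cgauss_vec d. ?main a) + (LINT a|cgauss_vec d. ?cross a) - (LINT a|cgauss_vec d. ?tail a)"
    by (simp only: Bochner_Integration.integral_add Bochner_Integration.integral_diff
        Bochner_Integration.integrable_add imain icross itail)
  moreover have "(LINT a|cgauss_vec d. ?main a + ?cross a - ?tail a) \<le> (LINT a|cgauss_vec d. ?X a)"
    by (intro integral_mono iX le Bochner_Integration.integrable_diff
        Bochner_Integration.integrable_add imain icross itail)
  ultimately show ?thesis
    using Emain Ecross Etail by linarith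
qed

text \<open>Because (1 + x) (1 - x + x^2) = 1 + x^3 \<ge> 1.\<close>

lemma exp_minus_le_quadratic:
  fixes x :: real
  assumes "0 \<le> x"
  shows "exp (- x) \<le> 1 - x + x\<^sup>2"
proof -
  have "(1 + x) * exp (- x) \<le> exp x * exp (- x)"
    by (intro mult_right_mono exp_ge_add_one_self) auto
  also have "\<dots> = 1" by (simp add: mult_exp_exp)
  also have "1 \<le> (1 + x) * (1 - x + x\<^sup>2)"
    using assms by (simp add: power2_eq_square algebra_simps)
  finally show ?thesis using assms by simp
qed

lemma clip_hess_form_le:
  assumes R: "R > 0"
  shows "hess_form (clip R u * cnj (clip R w)) \<le> 6 * R ^ 4"
proof -
  have "hess_form (clip R u * cnj (clip R w)) \<le> 6 * (cmod (clip R u * cnj (clip R w)))\<^sup>2"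
    by (rule hess_form_le)
  also have "\<dots> \<le> 6 * (R * R)\<^sup>2"
    unfolding norm_mult complex_mod_cnj using R
    by (intro mult_left_mono power_mono mult_mono norm_clip_le) auto
  finally show ?thesis by (simp add: power2_eq_square power4_eq_xxxx mult.assoc)
qed

text \<open>The estimate at a single point of the net. The shifts \<beta> are arbitrary so that the
  scaled offsets t b can be inserted.\<close>

lemma holds_except_clip_lower:
  fixes K \<epsilon> :: real
  assumes K: "K \<ge> 0" and \<epsilon>: "\<epsilon> > 0"
  obtains R c where "R > 0" "c > 0"
    and "\<And>m d v z \<beta>. vnorm d v = 1 \<Longrightarrow> vnorm d z \<le> 1 \<Longrightarrow> (\<Sum>j<m. cmod (\<beta> j) ^ 4) \<le> K * real m \<Longrightarrow>
      holds_except (gauss_vectors m d) (exp (- c * real m))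
        (\<lambda>a. 2 * real m * (vnorm d z)\<^sup>2 + 4 * (\<Sum>j<m. (cmod (\<beta> j))\<^sup>2) - \<epsilon> * real m
          \<le> (\<Sum>j<m. hess_form (clip R (adj_dot d (a j) z + \<beta> j) * cnj (clip R (adj_dot d (a j) v)))))"
proof -
  \<comment> \<open>This radius makes the mean lost by clipping at most
    \<open>\<epsilon> / 2\<close> per sample.\<close>
  define R where "R = sqrt (2 * clip_const * (1 + K) / \<epsilon>)"
  have R: "R > 0" using K \<epsilon> by (simp add: R_def clip_const_def)
  have R2: "clip_const * (1 + K) / R\<^sup>2 = \<epsilon> / 2"
    using K \<epsilon> by (simp add: R_def clip_const_def field_simps)
  \<comment> \<open>The clipped terms are at most 6 R^4, so the quadratic remainder is 36 l^2 R^8 =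
    l \<epsilon> / 4; half of the remaining slack l \<epsilon> / 2 survives as decay.\<close>
  define l where "l = \<epsilon> / (144 * R ^ 8)"
  have l: "l > 0" using R \<epsilon> by (simp add: l_def)
  have lR: "36 * l * R ^ 8 = \<epsilon> / 4" using R by (simp add: l_def)
  have main: "holds_except (gauss_vectors m d) (exp (- (l * \<epsilon> / 4) * real m))
        (\<lambda>a. 2 * real m * (vnorm d z)\<^sup>2 + 4 * (\<Sum>j<m. (cmod (\<beta> j))\<^sup>2) - \<epsilon> * real m
          \<le> (\<Sum>j<m. hess_form (clip R (adj_dot d (a j) z + \<beta> j) * cnj (clip R (adj_dot d (a j) v)))))"
    if v: "vnorm d v = 1" and z: "vnorm d z \<le> 1" and b4: "(\<Sum>j<m. cmod (\<beta> j) ^ 4) \<le> K * real m"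
    for m d v z and \<beta> :: "nat \<Rightarrow> complex"
  proof -
    interpret c: prob_space "cgauss_vec d" by (rule prob_space_cgauss_vec)
    let ?X = "\<lambda>j a. hess_form (clip R (adj_dot d a z + \<beta> j) * cnj (clip R (adj_dot d a v)))"
    let ?mu = "\<lambda>j. 2 * (vnorm d z)\<^sup>2 + 4 * (cmod (\<beta> j))\<^sup>2 - clip_const * (1 + cmod (\<beta> j) ^ 4) / R\<^sup>2"
    let ?L = "2 * real m * (vnorm d z)\<^sup>2 + 4 * (\<Sum>j<m. (cmod (\<beta> j))\<^sup>2) - \<epsilon> * real m"
    have bound: "0 \<le> ?X j a" "?X j a \<le> 6 * R ^ 4" for j a
      using clip_hess_form_le[OF R] by (auto simp: hess_form_nonneg)
    have "holds_except (gauss_vectors m d) (exp (- (l * \<epsilon> / 4) * real m))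
        (\<lambda>a. (\<Sum>j<m. (\<lambda>a. - l * ?X j a) (a j)) < - l * ?L)"
    proof (rule holds_except_chernoff[where c = "\<lambda>j. - l * ?mu j + 36 * l\<^sup>2 * R ^ 8"])
      fix j assume "j < m"
      have iX: "integrable (cgauss_vec d) (?X j)"
        using bound by (intro c.integrable_const_bound[where B = "6 * R ^ 4"] AE_I2) auto
      show "(\<lambda>a. - l * ?X j a) \<in> borel_measurable (cgauss_vec d)" by measurable
      show ie: "integrable (cgauss_vec d) (\<lambda>a. exp (- l * ?X j a))"
        using bound l by (intro c.integrable_const_bound[where B = 1] AE_I2) auto
      have "exp (- l * ?X j a) \<le> 1 - l * ?X j a + 36 * l\<^sup>2 * R ^ 8" for a
      proof -
        have "exp (- l * ?X j a) \<le> 1 - l * ?X j a + (l * ?X j a)\<^sup>2"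
          using exp_minus_le_quadratic[of "l * ?X j a"] bound l by simp
        also have "(l * ?X j a)\<^sup>2 \<le> (l * (6 * R ^ 4))\<^sup>2"
          using bound l by (intro power_mono mult_left_mono) auto
        also have "(l * (6 * R ^ 4))\<^sup>2 = 36 * l\<^sup>2 * R ^ 8"
          by (simp add: power_mult_distrib flip: power_mult)
        finally show ?thesis by simp
      qed
      then have "(LINT a|cgauss_vec d. exp (- l * ?X j a))
          \<le> (LINT a|cgauss_vec d. 1 - l * ?X j a + 36 * l\<^sup>2 * R ^ 8)"
        using iX ie by (intro integral_mono) auto
      also have "\<dots> = 1 - l * (LINT a|cgauss_vec d. ?X j a) + 36 * l\<^sup>2 * R ^ 8"
        using iX by (simp add: c.prob_space)
      also have "\<dots> \<le> 1 + (- l * ?mu j + 36 * l\<^sup>2 * R ^ 8)"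
        using mult_left_mono[OF integral_clip_ge[OF v z R, of "\<beta> j"], of l] l by simp
      also have "\<dots> \<le> exp (- l * ?mu j + 36 * l\<^sup>2 * R ^ 8)"
        by (rule exp_ge_add_one_self)
      finally show "(LINT a|cgauss_vec d. exp (- l * ?X j a)) \<le> exp (- l * ?mu j + 36 * l\<^sup>2 * R ^ 8)" .
    next
      have "(\<Sum>j<m. ?mu j) = 2 * real m * (vnorm d z)\<^sup>2 + 4 * (\<Sum>j<m. (cmod (\<beta> j))\<^sup>2)
          - clip_const * (real m + (\<Sum>j<m. cmod (\<beta> j) ^ 4)) / R\<^sup>2"
      proof -
        have "(\<Sum>j<m. clip_const * (1 + cmod (\<beta> j) ^ 4) / R\<^sup>2)
            = clip_const * (real m + (\<Sum>j<m. cmod (\<beta> j) ^ 4)) / R\<^sup>2"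
          by (simp add: sum.distrib flip: sum_distrib_left sum_divide_distrib)
        then show ?thesis
          by (simp add: sum.distrib sum_subtractf flip: sum_distrib_left)
      qed
      moreover have "clip_const * (real m + (\<Sum>j<m. cmod (\<beta> j) ^ 4)) / R\<^sup>2
          \<le> clip_const * (real m + K * real m) / R\<^sup>2"
        using b4 by (intro divide_right_mono mult_left_mono add_left_mono) (auto simp: clip_const_def)
      moreover have "clip_const * (real m + K * real m) / R\<^sup>2 = \<epsilon> / 2 * real m"
        unfolding R2[symmetric] by (simp add: algebra_simps)
      ultimately have "?L + \<epsilon> / 2 * real m \<le> (\<Sum>j<m. ?mu j)" by simp
      from mult_left_mono[OF this, of l]
      have "- l * (\<Sum>j<m. ?mu j) - (- l * ?L) \<le> - (l * \<epsilon> / 2) * real m"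
        using l by (simp add: algebra_simps)
      moreover have "(\<Sum>j<m. - l * ?mu j + 36 * l\<^sup>2 * R ^ 8)
          = - l * (\<Sum>j<m. ?mu j) + l * (36 * l * R ^ 8) * real m"
        by (subst sum.distrib, subst sum_distrib_left[symmetric]) (simp add: power2_eq_square algebra_simps)
      ultimately have "(\<Sum>j<m. - l * ?mu j + 36 * l\<^sup>2 * R ^ 8) - (- l * ?L) \<le> - (l * \<epsilon> / 4) * real m"
        unfolding lR by (simp add: algebra_simps)
      then show "exp ((\<Sum>j<m. - l * ?mu j + 36 * l\<^sup>2 * R ^ 8) - (- l * ?L)) \<le> exp (- (l * \<epsilon> / 4) * real m)"
        by simp
    qed
    then show ?thesis
    proof (rule holds_except_mono)
      fix a assume "(\<Sum>j<m. (\<lambda>a. - l * ?X j a) (a j)) < - l * ?L"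
      then have "- l * (\<Sum>j<m. ?X j (a j)) < - l * ?L"
        by (simp add: sum_distrib_left)
      then show "?L \<le> (\<Sum>j<m. ?X j (a j))"
        using l by simp
    qed simp
  qed
  show thesis
    by (rule that[OF R _ main]) (use l \<epsilon> in auto)
qed

section \<open>From the net to all directions and points\<close>

lemma sum_cmod_adj_dot_le:
  assumes "\<And>v. vnorm d v = 1 \<Longrightarrow> (\<Sum>j<m. (cmod (adj_dot d (a j) v))\<^sup>2) \<le> 32 * real m"
  shows "(\<Sum>j<m. cmod (adj_dot d (a j) v)) \<le> 6 * real m * vnorm d v"
proof (cases "vnorm d v = 0")
  case True
  then have "adj_dot d (a j) v = 0" for j
    using cmod_adj_dot_le[of d "a j" v] by simp
  then show ?thesis by (simp add: True)
next
  case False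
  then have pos: "vnorm d v > 0" using vnorm_nonneg[of d v] by linarith
  let ?c = "complex_of_real (1 / vnorm d v)"
  let ?v = "\<lambda>k. ?c * v k"
  have 1: "vnorm d ?v = 1"
    using pos by (simp only: vnorm_scale norm_of_real) simp
  \<comment> \<open>Cauchy-Schwarz against the constant vector: the covariance bound becomes a bound
    on the mean modulus, which is the form a Lipschitz estimate needs.\<close>
  have "(\<Sum>j<m. cmod (adj_dot d (a j) ?v))\<^sup>2 \<le> (L2_set (\<lambda>_. 1) {..<m} * L2_set (\<lambda>j. cmod (adj_dot d (a j) ?v)) {..<m})\<^sup>2"
    using L2_set_mult_ineq[of "\<lambda>_. 1" "\<lambda>j. cmod (adj_dot d (a j) ?v)" "{..<m}"]
    by (intro power_mono sum_nonneg) auto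
  also have "\<dots> = real m * (\<Sum>j<m. (cmod (adj_dot d (a j) ?v))\<^sup>2)"
    by (simp add: power_mult_distrib L2_set_def sum_nonneg)
  also have "\<dots> \<le> real m * (32 * real m)"
    by (intro mult_left_mono assms 1) auto
  \<comment> \<open>The constant 6 only rounds up the square root of 32.\<close>
  also have "\<dots> \<le> (6 * real m)\<^sup>2"
    by (simp add: power2_eq_square)
  finally have "(\<Sum>j<m. cmod (adj_dot d (a j) ?v)) \<le> 6 * real m"
    by (rule power2_le_imp_le) auto
  from mult_left_mono[OF this, of "vnorm d v"]
  have "vnorm d v * (\<Sum>j<m. cmod (adj_dot d (a j) ?v)) \<le> vnorm d v * (6 * real m)"
    using pos by simp
  moreover have "vnorm d v * (\<Sum>j<m. cmod (adj_dot d (a j) ?v)) = (\<Sum>j<m. cmod (adj_dot d (a j) v))"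
    using pos unfolding adj_dot_scale norm_mult norm_of_real sum_distrib_left[symmetric] by simp
  ultimately show ?thesis by (simp only: mult_ac)
qed

text \<open>Products of clipped values have modulus at most R^2, where \<open>hess_form\<close> has
  Lipschitz constant 12 R^2; the product rule with the constant 2 of \<open>clip\<close> contributes
  2 R.\<close>

lemma clip_hess_form_diff:
  assumes R: "R > 0"
  shows "\<bar>hess_form (clip R u * cnj (clip R w)) - hess_form (clip R u' * cnj (clip R w'))\<bar>
    \<le> 24 * R ^ 3 * (cmod (u - u') + cmod (w - w'))"
proof -
  let ?s = "clip R u * cnj (clip R w)" and ?t = "clip R u' * cnj (clip R w')"
  have B: "cmod (clip R p * cnj (clip R q)) \<le> R\<^sup>2" for p q
    unfolding norm_mult complex_mod_cnj power2_eq_square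
    using R by (intro mult_mono norm_clip_le) auto
  have "?s - ?t = (clip R u - clip R u') * cnj (clip R w) + clip R u' * cnj (clip R w - clip R w')"
    by (simp add: algebra_simps)
  then have "cmod (?s - ?t) \<le> cmod (clip R u - clip R u') * cmod (clip R w)
      + cmod (clip R u') * cmod (clip R w - clip R w')"
    by (metis norm_triangle_ineq norm_mult complex_mod_cnj)
  also have "\<dots> \<le> 2 * cmod (u - u') * R + R * (2 * cmod (w - w'))"
    using R by (intro add_mono mult_mono clip_lipschitz norm_clip_le) auto
  finally have *: "cmod (?s - ?t) \<le> 2 * R * (cmod (u - u') + cmod (w - w'))"
    by (simp add: algebra_simps)
  have "\<bar>hess_form ?s - hess_form ?t\<bar> \<le> 12 * R\<^sup>2 * cmod (?s - ?t)"
    by (rule hess_form_lipschitz[OF B B])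
  also have "\<dots> \<le> 12 * R\<^sup>2 * (2 * R * (cmod (u - u') + cmod (w - w')))"
    using * by (intro mult_left_mono) auto
  finally show ?thesis by (simp add: power2_eq_square power3_eq_cube mult_ac)
qed

lemma vnorm_diff_le: "\<bar>vnorm d v - vnorm d w\<bar> \<le> vnorm d (\<lambda>k. v k - w k)"
proof -
  have "vnorm d v \<le> vnorm d w + vnorm d (\<lambda>k. v k - w k)"
    using vnorm_triangle[of d w "\<lambda>k. v k - w k"] by simp
  moreover have "vnorm d w \<le> vnorm d v + vnorm d (\<lambda>k. - 1 * (v k - w k))"
    using vnorm_triangle[of d v "\<lambda>k. - 1 * (v k - w k)"] by simp
  then have "vnorm d w \<le> vnorm d v + vnorm d (\<lambda>k. v k - w k)"
    by (simp only: vnorm_scale) simp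
  ultimately show ?thesis by linarith
qed

text \<open>The auxiliary parameter \<open>t\<close> makes the estimate homogeneous in \<open>(z, t)\<close>, so that
  unbounded \<open>z\<close> reduce to the unit ball.\<close>

lemma holds_except_uniform_lower:
  fixes K \<epsilon> :: real
  assumes K: "K \<ge> 0" and \<epsilon>: "\<epsilon> > 0"
  obtains C A c where "C > 0" "A \<ge> 0" "c > 0"
    and "\<And>m d b. d \<ge> 1 \<Longrightarrow> (\<Sum>j<m. cmod (b j) ^ 4) \<le> K * real m \<Longrightarrow>
      holds_except (gauss_vectors m d) (C * exp (A * real d - c * real m))
        (\<lambda>a. \<forall>v z t. vnorm d v = 1 \<longrightarrow> vnorm d z \<le> 1 \<longrightarrow> 0 \<le> t \<longrightarrow> t \<le> 1 \<longrightarrow>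
          2 * real m * (vnorm d z)\<^sup>2 + 4 * t\<^sup>2 * (\<Sum>j<m. (cmod (b j))\<^sup>2) - \<epsilon> * real m
          \<le> (\<Sum>j<m. hess_form ((adj_dot d (a j) z + complex_of_real t * b j) * cnj (adj_dot d (a j) v))))"
proof -
  obtain R c where R: "R > 0" and c: "c > 0" and
    lower: "\<And>m d v z \<beta>. vnorm d v = 1 \<Longrightarrow> vnorm d z \<le> 1 \<Longrightarrow> (\<Sum>j<m. cmod (\<beta> j) ^ 4) \<le> K * real m \<Longrightarrow>
      holds_except (gauss_vectors m d) (exp (- c * real m))
        (\<lambda>a. 2 * real m * (vnorm d z)\<^sup>2 + 4 * (\<Sum>j<m. (cmod (\<beta> j))\<^sup>2) - \<epsilon> / 2 * real m
          \<le> (\<Sum>j<m. hess_form (clip R (adj_dot d (a j) z + \<beta> j) * cnj (clip R (adj_dot d (a j) v)))))"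
    by (rule holds_except_clip_lower[OF K half_gt_zero[OF \<epsilon>]]; blast)
  \<comment> \<open>Total change per sample and unit of \<delta>. On the right, 13 + K is 6 for
    \<open>z\<close>, 6 for \<open>v\<close> and 1 + K for the shift of \<open>t\<close>; on the
    left, 12 + 8 K is 4 from the squared norm of \<open>z\<close> and 8 (1 + K) from
    \<open>t\<^sup>2\<close>. The choice of \<open>n\<close> keeps it within
    \<open>\<epsilon> / 2\<close>.\<close>
  define D where "D = 24 * R ^ 3 * (13 + K) + (12 + 8 * K)"
  define n where "n = nat \<lceil>2 * D / \<epsilon>\<rceil> + 1"
  define \<delta> where "\<delta> = 1 / real n"
  have D: "D > 0" using R K by (simp add: D_def add_pos_pos)
  have n: "n \<ge> 1" "real n > 0" by (simp_all add: n_def)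
  have \<delta>: "\<delta> > 0" using n by (simp add: \<delta>_def)
  have D\<delta>: "D * \<delta> \<le> \<epsilon> / 2"
  proof -
    have "2 * D / \<epsilon> \<le> real n" unfolding n_def by linarith
    then show ?thesis using \<epsilon> n by (simp add: \<delta>_def field_simps)
  qed
  obtain A where A: "A \<ge> 0" and net: "\<And>d S. d \<ge> 1 \<Longrightarrow> S \<subseteq> {v. vnorm d v \<le> 1} \<Longrightarrow>
      \<exists>N. finite N \<and> N \<subseteq> S \<and> real (card N) \<le> exp (A * real d) \<and>
          (\<forall>v\<in>S. \<exists>v0\<in>N. vnorm d (\<lambda>k. v k - v0 k) \<le> \<delta>)"
    by (rule exists_net[OF \<delta>]; blast)
  obtain A0 where A0: "A0 \<ge> 0"
    and cov: "\<And>m d. d \<ge> 1 \<Longrightarrow> holds_except (gauss_vectors m d) (exp (A0 * real d - real m))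
      (\<lambda>a. \<forall>v. vnorm d v = 1 \<longrightarrow> (\<Sum>j<m. (cmod (adj_dot d (a j) v))\<^sup>2) \<le> 32 * real m)"
    by (rule holds_except_sample_covariance; blast)
  define A' c' where "A' = 2 * A + A0" and "c' = min c 1"
  have main: "holds_except (gauss_vectors m d) (real (n + 2) * exp (A' * real d - c' * real m))
        (\<lambda>a. \<forall>v z t. vnorm d v = 1 \<longrightarrow> vnorm d z \<le> 1 \<longrightarrow> 0 \<le> t \<longrightarrow> t \<le> 1 \<longrightarrow>
          2 * real m * (vnorm d z)\<^sup>2 + 4 * t\<^sup>2 * (\<Sum>j<m. (cmod (b j))\<^sup>2) - \<epsilon> * real m
          \<le> (\<Sum>j<m. hess_form ((adj_dot d (a j) z + complex_of_real t * b j) * cnj (adj_dot d (a j) v))))"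
    if d: "d \<ge> 1" and b4: "(\<Sum>j<m. cmod (b j) ^ 4) \<le> K * real m" for m d b
  proof -
    let ?M = "gauss_vectors m d"
    define b2 where "b2 = (\<Sum>j<m. (cmod (b j))\<^sup>2)"
    have b2: "0 \<le> b2" "b2 \<le> (1 + K) * real m"
    proof -
      show "0 \<le> b2" unfolding b2_def by (intro sum_nonneg) auto
      have "b2 \<le> (\<Sum>j<m. 1 + cmod (b j) ^ 4)"
        unfolding b2_def by (intro sum_mono power2_le_one_plus_power4)
      then show "b2 \<le> (1 + K) * real m" using b4 by (simp add: sum.distrib algebra_simps)
    qed
    have b1: "(\<Sum>j<m. cmod (b j)) \<le> (1 + K) * real m"
    proof -
      have "x \<le> 1 + x ^ 4" if "0 \<le> x" for x :: real
      proof (cases "x \<le> 1")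
        case True
        then show ?thesis by (simp add: add_increasing2)
      next
        case False
        then have "x ^ 1 \<le> x ^ 4" by (intro power_increasing) auto
        then show ?thesis by simp
      qed
      then have "(\<Sum>j<m. cmod (b j)) \<le> (\<Sum>j<m. 1 + cmod (b j) ^ 4)"
        by (intro sum_mono) auto
      then show ?thesis using b4 by (simp add: sum.distrib algebra_simps)
    qed
    have "{v. vnorm d v = 1} \<subseteq> {v. vnorm d v \<le> 1}" by auto
    from net[OF d this] obtain N where N: "finite N" "N \<subseteq> {v. vnorm d v = 1}"
      "real (card N) \<le> exp (A * real d)"
      "\<forall>v\<in>{v. vnorm d v = 1}. \<exists>v0\<in>N. vnorm d (\<lambda>k. v k - v0 k) \<le> \<delta>"
      by (elim exE conjE)
    from net[OF d order.refl] obtain Z where Z: "finite Z" "Z \<subseteq> {z. vnorm d z \<le> 1}"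
      "real (card Z) \<le> exp (A * real d)"
      "\<forall>z\<in>{z. vnorm d z \<le> 1}. \<exists>z0\<in>Z. vnorm d (\<lambda>k. z k - z0 k) \<le> \<delta>"
      by (elim exE conjE)
    \<comment> \<open>An equidistant grid of n + 1 values with step \<open>\<delta>\<close>.
      Together with the covariance event it accounts for the constant n + 2 in front of the
      exponential.\<close>
    let ?T = "(\<lambda>i. real i / real n) ` {..n}"
    let ?X = "\<lambda>v z t a j. hess_form (clip R (adj_dot d (a j) z + complex_of_real t * b j)
        * cnj (clip R (adj_dot d (a j) v)))"
    have pt: "holds_except ?M (exp (- c * real m))
        (\<lambda>a. 2 * real m * (vnorm d z)\<^sup>2 + 4 * t\<^sup>2 * b2 - \<epsilon> / 2 * real m \<le> (\<Sum>j<m. ?X v z t a j))"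
      if "vnorm d v = 1" "vnorm d z \<le> 1" "0 \<le> t" "t \<le> 1" for v z t
    proof -
      have "(\<Sum>j<m. cmod (complex_of_real t * b j) ^ 4) \<le> (\<Sum>j<m. cmod (b j) ^ 4)"
        using that by (intro sum_mono power_mono) (auto simp: norm_mult mult_left_le_one_le)
      then have "(\<Sum>j<m. cmod (complex_of_real t * b j) ^ 4) \<le> K * real m" using b4 by linarith
      from lower[OF that(1,2) this] show ?thesis
        by (simp add: b2_def norm_mult power_mult_distrib sum_distrib_left mult.assoc)
    qed
    have pt_net: "holds_except ?M (real (card (N \<times> Z \<times> ?T)) * exp (- c * real m))
        (\<lambda>a. \<forall>(v, z, t) \<in> N \<times> Z \<times> ?T.
          2 * real m * (vnorm d z)\<^sup>2 + 4 * t\<^sup>2 * b2 - \<epsilon> / 2 * real m \<le> (\<Sum>j<m. ?X v z t a j))"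
    proof (rule holds_except_ball)
      show "finite (N \<times> Z \<times> ?T)" using N(1) Z(1) by simp
      fix i assume i: "i \<in> N \<times> Z \<times> ?T"
      obtain v z t where vzt: "i = (v, z, t)" by (cases i)
      have "vnorm d v = 1" "vnorm d z \<le> 1" "0 \<le> t" "t \<le> 1"
        using i N(2) Z(2) n unfolding vzt by auto
      from pt[OF this] show "holds_except ?M (exp (- c * real m)) (\<lambda>a. case i of (v, z, t) \<Rightarrow>
          2 * real m * (vnorm d z)\<^sup>2 + 4 * t\<^sup>2 * b2 - \<epsilon> / 2 * real m \<le> (\<Sum>j<m. ?X v z t a j))"
        by (simp add: vzt)
    qed
    have prob: "exp (A0 * real d - real m) + real (card (N \<times> Z \<times> ?T)) * exp (- c * real m)
        \<le> real (n + 2) * exp (A' * real d - c' * real m)"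
    proof -
      have "card ?T \<le> n + 1" using card_image_le[of "{..n}" "\<lambda>i. real i / real n"] by simp
      then have "real (card (N \<times> Z \<times> ?T)) \<le> exp (A * real d) * (exp (A * real d) * real (n + 1))"
        unfolding card_cartesian_product of_nat_mult
        using N(3) Z(3) by (intro mult_mono) auto
      then have "real (card (N \<times> Z \<times> ?T)) * exp (- c * real m)
          \<le> exp (A * real d) * (exp (A * real d) * real (n + 1)) * exp (- c * real m)"
        by (rule mult_right_mono) simp
      also have "\<dots> = real (n + 1) * exp (2 * A * real d - c * real m)"
        by (simp add: mult_exp_exp mult_ac flip: exp_add)
      also have "\<dots> \<le> real (n + 1) * exp (A' * real d - c' * real m)"
        using A0 c unfolding A'_def c'_def
        by (intro mult_left_mono exp_le_cancel_iff[THEN iffD2] diff_mono mult_right_mono) auto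
      finally have "real (card (N \<times> Z \<times> ?T)) * exp (- c * real m) \<le> real (n + 1) * exp (A' * real d - c' * real m)" .
      moreover have "exp (A0 * real d - real m) \<le> exp (A' * real d - c' * real m)"
      proof -
        have "A0 * real d \<le> A' * real d" "c' * real m \<le> 1 * real m"
          using A unfolding A'_def c'_def by (intro mult_right_mono; simp)+
        then show ?thesis by simp
      qed
      ultimately have "exp (A0 * real d - real m) + real (card (N \<times> Z \<times> ?T)) * exp (- c * real m)
          \<le> exp (A' * real d - c' * real m) + real (n + 1) * exp (A' * real d - c' * real m)"
        by (intro add_mono)
      also have "\<dots> = real (n + 2) * exp (A' * real d - c' * real m)"
        by (simp add: algebra_simps)
      finally show ?thesis .
    qed
    show ?thesis
    proof (rule holds_except_mono[OF holds_except_conj[OF cov[OF d] pt_net] prob], clarify)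
      fix a v z and t :: real
      assume cov: "\<forall>v. vnorm d v = 1 \<longrightarrow> (\<Sum>j<m. (cmod (adj_dot d (a j) v))\<^sup>2) \<le> 32 * real m"
        and nets: "\<forall>(v, z, t) \<in> N \<times> Z \<times> ?T.
          2 * real m * (vnorm d z)\<^sup>2 + 4 * t\<^sup>2 * b2 - \<epsilon> / 2 * real m \<le> (\<Sum>j<m. ?X v z t a j)"
        and v: "vnorm d v = 1" and z: "vnorm d z \<le> 1" and t: "0 \<le> t" "t \<le> 1"
      obtain v0 where v0: "v0 \<in> N" "vnorm d (\<lambda>k. v k - v0 k) \<le> \<delta>" using N(4) v by auto
      obtain z0 where z0: "z0 \<in> Z" "vnorm d (\<lambda>k. z k - z0 k) \<le> \<delta>" using Z(4) z by auto
      define i where "i = nat \<lfloor>t * real n\<rfloor>"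
      define t0 where "t0 = real i / real n"
      have i: "real i \<le> t * real n" "t * real n \<le> real i + 1"
      proof -
        have "0 \<le> t * real n" using t by simp
        then show "real i \<le> t * real n" "t * real n \<le> real i + 1"
          unfolding i_def by linarith+
      qed
      have "t * real n \<le> real n" using t n by (simp add: mult_le_cancel_right1)
      then have "i \<le> n" using i by linarith
      then have t0: "t0 \<in> ?T" by (auto simp: t0_def)
      have "t \<le> (real i + 1) / real n" using i n by (simp add: pos_le_divide_eq)
      then have t0': "0 \<le> t0" "t0 \<le> t" "t - t0 \<le> \<delta>"
        using i n by (auto simp: t0_def \<delta>_def pos_divide_le_eq add_divide_distrib)
      have nz0: "vnorm d z0 \<le> 1" using z0 Z(2) by auto
      \<comment> \<open>Summing the moduli of the changes over the samples lets the covariance event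
        enter; the largest single change would not be bounded by a constant.\<close>
      have lip: "(\<Sum>j<m. \<bar>?X v z t a j - ?X v0 z0 t0 a j\<bar>) \<le> 24 * R ^ 3 * (\<delta> * ((13 + K) * real m))"
      proof -
        have "(\<Sum>j<m. \<bar>?X v z t a j - ?X v0 z0 t0 a j\<bar>)
            \<le> (\<Sum>j<m. 24 * R ^ 3 * (cmod (adj_dot d (a j) (\<lambda>k. z k - z0 k)) + \<delta> * cmod (b j)
                + cmod (adj_dot d (a j) (\<lambda>k. v k - v0 k))))"
        proof (rule sum_mono)
          fix j
          have "cmod (adj_dot d (a j) z + complex_of_real t * b j - (adj_dot d (a j) z0 + complex_of_real t0 * b j))
              = cmod (adj_dot d (a j) (\<lambda>k. z k - z0 k) + complex_of_real (t - t0) * b j)"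
            unfolding adj_dot_diff by (simp add: algebra_simps)
          also have "\<dots> \<le> cmod (adj_dot d (a j) (\<lambda>k. z k - z0 k)) + cmod (complex_of_real (t - t0) * b j)"
            by (rule norm_triangle_ineq)
          also have "cmod (complex_of_real (t - t0) * b j) \<le> \<delta> * cmod (b j)"
            using t0' unfolding norm_mult norm_of_real by (intro mult_right_mono) auto
          finally have "cmod (adj_dot d (a j) z + complex_of_real t * b j - (adj_dot d (a j) z0 + complex_of_real t0 * b j))
              \<le> cmod (adj_dot d (a j) (\<lambda>k. z k - z0 k)) + \<delta> * cmod (b j)" by simp
          then have "24 * R ^ 3 * (cmod (adj_dot d (a j) z + complex_of_real t * b j - (adj_dot d (a j) z0 + complex_of_real t0 * b j))
              + cmod (adj_dot d (a j) v - adj_dot d (a j) v0))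
            \<le> 24 * R ^ 3 * (cmod (adj_dot d (a j) (\<lambda>k. z k - z0 k)) + \<delta> * cmod (b j)
                + cmod (adj_dot d (a j) (\<lambda>k. v k - v0 k)))"
            using R unfolding adj_dot_diff by (intro mult_left_mono add_mono) auto
          with clip_hess_form_diff[OF R] show "\<bar>?X v z t a j - ?X v0 z0 t0 a j\<bar>
              \<le> 24 * R ^ 3 * (cmod (adj_dot d (a j) (\<lambda>k. z k - z0 k)) + \<delta> * cmod (b j)
                + cmod (adj_dot d (a j) (\<lambda>k. v k - v0 k)))"
            by (rule order.trans)
        qed
        also have "\<dots> = 24 * R ^ 3 * ((\<Sum>j<m. cmod (adj_dot d (a j) (\<lambda>k. z k - z0 k)))
            + \<delta> * (\<Sum>j<m. cmod (b j)) + (\<Sum>j<m. cmod (adj_dot d (a j) (\<lambda>k. v k - v0 k))))"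
          by (simp add: sum.distrib flip: sum_distrib_left)
        also have "\<dots> \<le> 24 * R ^ 3 * (6 * real m * \<delta> + \<delta> * ((1 + K) * real m) + 6 * real m * \<delta>)"
        proof (intro mult_left_mono add_mono b1)
          have *: "(\<Sum>j<m. cmod (adj_dot d (a j) h)) \<le> 6 * real m * \<delta>" if "vnorm d h \<le> \<delta>" for h
            using sum_cmod_adj_dot_le[where d = d and m = m and a = a and v = h] cov mult_left_mono[OF that, of "6 * real m"] by auto
          show "(\<Sum>j<m. cmod (adj_dot d (a j) (\<lambda>k. z k - z0 k))) \<le> 6 * real m * \<delta>"
            "(\<Sum>j<m. cmod (adj_dot d (a j) (\<lambda>k. v k - v0 k))) \<le> 6 * real m * \<delta>"
            by (rule *, fact)+
        qed (use R \<delta> in auto)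
        also have "\<dots> = 24 * R ^ 3 * (\<delta> * ((13 + K) * real m))"
          by (simp add: algebra_simps)
        finally show ?thesis .
      qed
      have close: "2 * real m * (vnorm d z)\<^sup>2 + 4 * t\<^sup>2 * b2
          \<le> 2 * real m * (vnorm d z0)\<^sup>2 + 4 * t0\<^sup>2 * b2 + \<delta> * ((12 + 8 * K) * real m)"
      proof -
        have "\<bar>(vnorm d z)\<^sup>2 - (vnorm d z0)\<^sup>2\<bar> \<le> 2 * 1 * \<bar>vnorm d z - vnorm d z0\<bar>"
          using z nz0 by (intro abs_power2_diff_le) auto
        also have "\<dots> \<le> 2 * 1 * \<delta>"
          using vnorm_diff_le[of d z z0] z0(2) by simp
        finally have "2 * real m * ((vnorm d z)\<^sup>2 - (vnorm d z0)\<^sup>2) \<le> 2 * real m * (2 * \<delta>)"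
          by (intro mult_left_mono) auto
        moreover have "\<bar>t\<^sup>2 - t0\<^sup>2\<bar> \<le> 2 * 1 * \<bar>t - t0\<bar>"
          using t t0' by (intro abs_power2_diff_le) auto
        then have "t\<^sup>2 - t0\<^sup>2 \<le> 2 * \<delta>" using t0' by simp
        then have "4 * b2 * (t\<^sup>2 - t0\<^sup>2) \<le> 4 * b2 * (2 * \<delta>)"
          using b2 by (intro mult_left_mono) auto
        moreover have "b2 * (8 * \<delta>) \<le> (1 + K) * real m * (8 * \<delta>)"
          using b2 \<delta> by (intro mult_right_mono) auto
        ultimately show ?thesis by (simp add: algebra_simps)
      qed
      have "2 * real m * (vnorm d z0)\<^sup>2 + 4 * t0\<^sup>2 * b2 - \<epsilon> / 2 * real m \<le> (\<Sum>j<m. ?X v0 z0 t0 a j)"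
        using nets v0(1) z0(1) t0 by blast
      also have "\<dots> \<le> (\<Sum>j<m. ?X v z t a j) + (\<Sum>j<m. \<bar>?X v z t a j - ?X v0 z0 t0 a j\<bar>)"
        unfolding sum.distrib[symmetric] by (intro sum_mono) linarith
      \<comment> \<open>Clipping is removed only after the Lipschitz step, and it can only have
        decreased the sum.\<close>
      also have "(\<Sum>j<m. ?X v z t a j) \<le> (\<Sum>j<m. hess_form ((adj_dot d (a j) z + complex_of_real t * b j) * cnj (adj_dot d (a j) v)))"
        by (intro sum_mono hess_form_clip_le R)
      finally have "2 * real m * (vnorm d z)\<^sup>2 + 4 * t\<^sup>2 * b2 - \<epsilon> / 2 * real m
          \<le> (\<Sum>j<m. hess_form ((adj_dot d (a j) z + complex_of_real t * b j) * cnj (adj_dot d (a j) v)))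
            + 24 * R ^ 3 * (\<delta> * ((13 + K) * real m)) + \<delta> * ((12 + 8 * K) * real m)"
        using lip close by linarith
      also have "24 * R ^ 3 * (\<delta> * ((13 + K) * real m)) = 24 * R ^ 3 * (13 + K) * \<delta> * real m" by simp
      also have "\<delta> * ((12 + 8 * K) * real m) = (12 + 8 * K) * \<delta> * real m" by simp
      finally have "2 * real m * (vnorm d z)\<^sup>2 + 4 * t\<^sup>2 * b2 - \<epsilon> / 2 * real m
          \<le> (\<Sum>j<m. hess_form ((adj_dot d (a j) z + complex_of_real t * b j) * cnj (adj_dot d (a j) v)))
            + D * \<delta> * real m"
        by (simp add: D_def algebra_simps)
      moreover have "D * \<delta> * real m \<le> \<epsilon> / 2 * real m"
        using D\<delta> by (intro mult_right_mono) auto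
      ultimately show "2 * real m * (vnorm d z)\<^sup>2 + 4 * t\<^sup>2 * (\<Sum>j<m. (cmod (b j))\<^sup>2) - \<epsilon> * real m
          \<le> (\<Sum>j<m. hess_form ((adj_dot d (a j) z + complex_of_real t * b j) * cnj (adj_dot d (a j) v)))"
        by (simp add: b2_def)
    qed
  qed
  show thesis
    by (rule that[OF _ _ _ main]) (use A A0 c in \<open>auto simp: A'_def c'_def\<close>)
qed

section \<open>The Hessian form\<close>

lemma sum_split_lessThan:
  fixes f :: "nat \<Rightarrow> 'a :: comm_monoid_add"
  shows "(\<Sum>i<d + n. f i) = (\<Sum>i<d. f i) + (\<Sum>i<n. f (d + i))"
  by (induction n) (auto simp: add.assoc)

text \<open>Each block is a scalar times an outer product of \<open>a\<close> or its conjugate, so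
  its double sum factors into two copies of \<open>w\<close> or \<open>cnj w\<close>.\<close>

lemma block_form:
  fixes a v :: "nat \<Rightarrow> complex" and \<alpha> u :: complex and d :: nat
  defines "w \<equiv> adj_dot d a v"
  shows "(\<Sum>i<2 * d. \<Sum>k<2 * d. cnj (stack_conj d v i) *
      (if i < d \<and> k < d then \<alpha> * a i * cnj (a k)
       else if i < d \<and> d \<le> k then u\<^sup>2 * a i * a (k - d)
       else if d \<le> i \<and> k < d then (cnj u)\<^sup>2 * cnj (a (i - d)) * cnj (a k)
       else \<alpha> * cnj (a (i - d)) * a (k - d)) * stack_conj d v k)
    = 2 * \<alpha> * (w * cnj w) + u\<^sup>2 * (cnj w)\<^sup>2 + (cnj u)\<^sup>2 * w\<^sup>2"
    (is "?L = _")
proof -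
  have w: "w = (\<Sum>k<d. cnj (a k) * v k)" and cw: "cnj w = (\<Sum>k<d. a k * cnj (v k))"
    by (simp_all add: w_def adj_dot_def)
  have *: "(\<Sum>i<d. \<Sum>k<d. f i * (c * g i * h k) * e k) = c * ((\<Sum>i<d. g i * f i) * (\<Sum>k<d. h k * e k))"
    for c :: complex and f g h e
    unfolding sum_product unfolding sum_distrib_left
    by (intro sum.cong refl) (simp add: mult_ac)
  have "?L = (\<Sum>i<d. \<Sum>k<d. cnj (v i) * (\<alpha> * a i * cnj (a k)) * v k)
      + (\<Sum>i<d. \<Sum>k<d. cnj (v i) * (u\<^sup>2 * a i * a k) * cnj (v k))
      + ((\<Sum>i<d. \<Sum>k<d. v i * ((cnj u)\<^sup>2 * cnj (a i) * cnj (a k)) * v k)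
      + (\<Sum>i<d. \<Sum>k<d. v i * (\<alpha> * cnj (a i) * a k) * cnj (v k)))"
    unfolding mult_2 sum_split_lessThan sum.distrib by (simp add: stack_conj_def)
  also have "\<dots> = 2 * \<alpha> * (w * cnj w) + u\<^sup>2 * (cnj w)\<^sup>2 + (cnj u)\<^sup>2 * w\<^sup>2"
    unfolding * w[symmetric] cw[symmetric] by (simp add: power2_eq_square)
  finally show ?thesis .
qed

definition hess_sum ::
  "nat \<Rightarrow> nat \<Rightarrow> (nat \<Rightarrow> complex) \<Rightarrow> (nat \<Rightarrow> complex) \<Rightarrow> (nat \<Rightarrow> nat \<Rightarrow> complex) \<Rightarrow>
    (nat \<Rightarrow> complex) \<Rightarrow> (nat \<Rightarrow> complex) \<Rightarrow> real" where
  "hess_sum m d x b a v z =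
     (\<Sum>j<m. hess_form ((adj_dot d (a j) z + b j) * cnj (adj_dot d (a j) v))
        - 2 * ((cmod (adj_dot d (a j) x + b j))\<^sup>2 * (cmod (adj_dot d (a j) v))\<^sup>2))"

lemma Re_quad_form_hessian:
  "Re (quad_form (2 * d)
        (wirtinger_hessian m d a b (\<lambda>j. (cmod (adj_dot d (a j) x + b j))\<^sup>2) z) (stack_conj d v))
   = hess_sum m d x b a v z / real m"
proof -
  let ?y = "\<lambda>j. (cmod (adj_dot d (a j) x + b j))\<^sup>2"
  let ?u = "\<lambda>j. adj_dot d (a j) z + b j" and ?w = "\<lambda>j. adj_dot d (a j) v"
  let ?al = "\<lambda>j. complex_of_real (2 * (cmod (?u j))\<^sup>2 - ?y j)"
  let ?e = "\<lambda>j i k. (if i < d \<and> k < d then ?al j * a j i * cnj (a j k)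
         else if i < d \<and> d \<le> k then (?u j)\<^sup>2 * a j i * a j (k - d)
         else if d \<le> i \<and> k < d then (cnj (?u j))\<^sup>2 * cnj (a j (i - d)) * cnj (a j k)
         else ?al j * cnj (a j (i - d)) * a j (k - d))"
  have "quad_form (2 * d) (wirtinger_hessian m d a b ?y z) (stack_conj d v)
      = (\<Sum>i<2 * d. \<Sum>k<2 * d. \<Sum>j<m. (1 / of_nat m) * (cnj (stack_conj d v i) * ?e j i k * stack_conj d v k))"
    unfolding quad_form_def wirtinger_hessian_def Let_def sum_distrib_left sum_distrib_right
    by (intro sum.cong refl) (simp only: mult_ac)
  also have "\<dots> = (\<Sum>j<m. \<Sum>i<2 * d. \<Sum>k<2 * d. (1 / of_nat m) * (cnj (stack_conj d v i) * ?e j i k * stack_conj d v k))"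
    by (subst sum.swap[where B = "{..<m}"], subst sum.swap[where B = "{..<m}"]) (rule refl)
  also have "\<dots> = (1 / of_nat m) * (\<Sum>j<m. \<Sum>i<2 * d. \<Sum>k<2 * d. cnj (stack_conj d v i) * ?e j i k * stack_conj d v k)"
    by (simp only: sum_distrib_left)
  also have "\<dots> = (1 / of_nat m) * (\<Sum>j<m. 2 * ?al j * (?w j * cnj (?w j)) + (?u j)\<^sup>2 * (cnj (?w j))\<^sup>2
      + (cnj (?u j))\<^sup>2 * (?w j)\<^sup>2)"
    by (simp only: block_form)
  finally have "Re (quad_form (2 * d) (wirtinger_hessian m d a b ?y z) (stack_conj d v))
      = Re (complex_of_real (1 / real m) * (\<Sum>j<m. 2 * ?al j * (?w j * cnj (?w j)) + (?u j)\<^sup>2 * (cnj (?w j))\<^sup>2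
      + (cnj (?u j))\<^sup>2 * (?w j)\<^sup>2))"
    by simp
  also have "\<dots> = (1 / real m) * (\<Sum>j<m. Re (2 * ?al j * (?w j * cnj (?w j)) + (?u j)\<^sup>2 * (cnj (?w j))\<^sup>2
      + (cnj (?u j))\<^sup>2 * (?w j)\<^sup>2))"
    by (simp only: Re_complex_of_real Im_complex_of_real times_complex.simps Re_sum)
  also have "\<dots> = (1 / real m) * (\<Sum>j<m. hess_form (?u j * cnj (?w j)) - 2 * (?y j * (cmod (?w j))\<^sup>2))"
  proof -
    \<comment> \<open>With s = u (cnj w), the two off-diagonal blocks give 2 Re (s^2) = 4 (Re s)^2 -
      2 |s|^2; added to the diagonal 4 |s|^2 this is \<open>hess_form s\<close>.\<close>
    have "Re (2 * complex_of_real (2 * (cmod u)\<^sup>2 - y) * (w * cnj w) + u\<^sup>2 * (cnj w)\<^sup>2 + (cnj u)\<^sup>2 * w\<^sup>2)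
        = hess_form (u * cnj w) - 2 * (y * (cmod w)\<^sup>2)" for u w y
      unfolding hess_form_def cmod_power2 by (simp add: power2_eq_square algebra_simps)
    then show ?thesis by (simp only:)
  qed
  finally show ?thesis by (simp add: hess_sum_def)
qed

lemma hess_sum_scale_direction:
  "hess_sum m d x b a (\<lambda>k. complex_of_real c * v k) z = c\<^sup>2 * hess_sum m d x b a v z"
proof -
  have "hess_form ((s + b) * cnj (complex_of_real c * w)) = c\<^sup>2 * hess_form ((s + b) * cnj w)" for s b w
    using hess_form_scale[of c "(s + b) * cnj w"] by (simp add: mult_ac)
  then show ?thesis
    unfolding hess_sum_def sum_distrib_left adj_dot_scale
    by (intro sum.cong refl) (simp add: norm_mult power_mult_distrib right_diff_distrib)
qed

text \<open>Homogeneity in \<open>x\<close>, \<open>b\<close> and \<open>z\<close> jointly. It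
  reduces the theorem to \<open>vnorm d x = 1\<close>, because \<open>z\<close> ranges over all
  vectors.\<close>

lemma hess_sum_rescale:
  "hess_sum m d (\<lambda>k. complex_of_real r * x k) (\<lambda>j. complex_of_real r * b j) a v (\<lambda>k. complex_of_real r * z k)
     = r\<^sup>2 * hess_sum m d x b a v z"
proof -
  have *: "complex_of_real r * s + complex_of_real r * t = complex_of_real r * (s + t)" for s t
    by (simp add: algebra_simps)
  show ?thesis
    unfolding hess_sum_def sum_distrib_left adj_dot_scale * mult.assoc hess_form_scale
    by (intro sum.cong refl) (simp add: norm_mult power_mult_distrib right_diff_distrib)
qed

section \<open>Measurability of the event\<close>

lemma countable_dense_vectors:
  obtains h :: "nat \<Rightarrow> nat \<Rightarrow> complex"
  where "\<And>v. \<exists>f. \<forall>k<d. (\<lambda>n. h (f n) k) \<longlonglongrightarrow> v k"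
proof -
  define Q where "Q = (\<lambda>(p, q). Complex p q) ` (\<rat> \<times> \<rat>)"
  have Q: "countable Q" unfolding Q_def by (intro countable_image countable_SIGMA countable_rat)
  have dense: "\<exists>q\<in>Q. cmod (q - c) < e" if "e > 0" for c e
  proof -
    have "Re c < Re c + e / 2" "Im c < Im c + e / 2" using that by simp_all
    then obtain p q where p: "p \<in> \<rat>" "Re c < p" "p < Re c + e / 2"
      and q: "q \<in> \<rat>" "Im c < q" "q < Im c + e / 2"
      using Rats_dense_in_real by metis
    have "cmod (Complex p q - c) \<le> \<bar>Re (Complex p q - c)\<bar> + \<bar>Im (Complex p q - c)\<bar>"
      by (rule cmod_le)
    also have "\<dots> < e" using p q by simp
    finally show ?thesis using p q unfolding Q_def by (intro bexI[of _ "Complex p q"]) auto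
  qed
  let ?D = "PiE {..<d} (\<lambda>_. Q)"
  have "Complex 0 0 \<in> Q" unfolding Q_def by auto
  then have "?D \<noteq> {}" by (auto simp: PiE_eq_empty_iff)
  moreover have "countable ?D"
    by (intro countable_PiE Q) auto
  ultimately have D: "\<And>u. u \<in> ?D \<Longrightarrow> \<exists>i. u = from_nat_into ?D i"
    by (metis from_nat_into_surj)
  show thesis
  proof (rule that)
    fix v :: "nat \<Rightarrow> complex"
    have "\<forall>n k. \<exists>q. q \<in> Q \<and> cmod (q - v k) < 1 / real (Suc n)"
      using dense by (metis divide_pos_pos of_nat_0_less_iff zero_less_Suc zero_less_one)
    then obtain g where g: "\<And>n k. g n k \<in> Q" "\<And>n k. cmod (g n k - v k) < 1 / real (Suc n)"
      by metis
    have "(\<lambda>n. g n k) \<longlonglongrightarrow> v k" for k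
    proof -
      have "(\<lambda>n. g n k - v k) \<longlonglongrightarrow> 0"
        by (rule Lim_null_comparison[OF _ LIMSEQ_inverse_real_of_nat])
           (use g(2) in \<open>auto intro!: always_eventually less_imp_le simp: inverse_eq_divide\<close>)
      then show ?thesis by (rule LIM_zero_cancel)
    qed
    moreover have "\<forall>n. \<exists>i. restrict (g n) {..<d} = from_nat_into ?D i"
      using g(1) by (intro allI D) auto
    then obtain f where "\<And>n. restrict (g n) {..<d} = from_nat_into ?D (f n)"
      by metis
    then have "\<And>n k. k < d \<Longrightarrow> from_nat_into ?D (f n) k = g n k"
      by (metis lessThan_iff restrict_apply')
    ultimately show "\<exists>f. \<forall>k<d. (\<lambda>n. from_nat_into ?D (f n) k) \<longlonglongrightarrow> v k"
      by (intro exI[of _ f]) simp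
  qed
qed

lemma vnorm_normalize:
  assumes "vnorm d v \<noteq> 0"
  shows "vnorm d (\<lambda>k. complex_of_real (1 / vnorm d v) * v k) = 1"
  using assms unfolding vnorm_scale norm_of_real by simp

lemma adj_dot_eq_0: "vnorm d v = 0 \<Longrightarrow> adj_dot d a v = 0"
  using cmod_adj_dot_le[of d a v] by simp

text \<open>Homogenising in \<open>v\<close> removes the constraint \<open>vnorm d v = 1\<close>; by continuity the
  quantifiers then range over a countable dense set.\<close>

lemma sets_hess_sum_ge:
  "{a \<in> space (gauss_vectors m d). \<forall>v z. vnorm d v = 1 \<longrightarrow> \<kappa> \<le> hess_sum m d x b a v z} \<in> sets (gauss_vectors m d)"
proof -
  let ?M = "gauss_vectors m d"
  obtain h :: "nat \<Rightarrow> nat \<Rightarrow> complex"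
    where h: "\<And>v. \<exists>f. \<forall>k<d. (\<lambda>n. h (f n) k) \<longlonglongrightarrow> v k"
    by (rule countable_dense_vectors[of d]; blast)
  have meas: "(\<lambda>a. hess_sum m d x b a v z) \<in> borel_measurable ?M" for v z
  proof -
    have [measurable]: "(\<lambda>a. adj_dot d (a j) u) \<in> borel_measurable ?M" if "j < m" for j u
      by (rule measurable_adj_dot_component[OF that])
    show ?thesis
      unfolding hess_sum_def by (intro borel_measurable_sum) measurable
  qed
  have "{a \<in> space ?M. \<forall>v z. vnorm d v = 1 \<longrightarrow> \<kappa> \<le> hess_sum m d x b a v z}
      = {a \<in> space ?M. \<forall>i l. \<kappa> * (vnorm d (h i))\<^sup>2 \<le> hess_sum m d x b a (h i) (h l)}"
  proof (intro Collect_cong conj_cong refl iffI ballI allI impI)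
    fix a i l
    define v z where "v = h i" and "z = h l"
    assume H: "\<forall>v z. vnorm d v = 1 \<longrightarrow> \<kappa> \<le> hess_sum m d x b a v z"
    have "\<kappa> * (vnorm d v)\<^sup>2 \<le> hess_sum m d x b a v z"
    proof (cases "vnorm d v = 0")
      case True
      then show ?thesis by (simp add: hess_sum_def adj_dot_eq_0 hess_form_def)
    next
      case False
      have "\<kappa> \<le> hess_sum m d x b a (\<lambda>k. complex_of_real (1 / vnorm d v) * v k) z"
        using H vnorm_normalize[OF False] by blast
      then have "\<kappa> \<le> (1 / vnorm d v)\<^sup>2 * hess_sum m d x b a v z"
        by (simp only: hess_sum_scale_direction)
      then show ?thesis using False by (simp add: power_divide field_simps)
    qed
    then show "\<kappa> * (vnorm d (h i))\<^sup>2 \<le> hess_sum m d x b a (h i) (h l)"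
      by (simp add: v_def z_def)
  next
    fix a v z
    assume H: "\<forall>i l. \<kappa> * (vnorm d (h i))\<^sup>2 \<le> hess_sum m d x b a (h i) (h l)" and v: "vnorm d v = 1"
    obtain f where f: "\<And>k. k < d \<Longrightarrow> (\<lambda>n. h (f n) k) \<longlonglongrightarrow> v k" using h[of v] by auto
    obtain g where g: "\<And>k. k < d \<Longrightarrow> (\<lambda>n. h (g n) k) \<longlonglongrightarrow> z k" using h[of z] by auto
    have "(\<lambda>n. hess_sum m d x b a (h (f n)) (h (g n))) \<longlonglongrightarrow> hess_sum m d x b a v z"
      unfolding hess_sum_def hess_form_def adj_dot_def
      by (intro tendsto_intros) (use f g in auto)
    moreover have "(\<lambda>n. \<kappa> * (\<Sum>k<d. (cmod (h (f n) k))\<^sup>2)) \<longlonglongrightarrow> \<kappa> * (\<Sum>k<d. (cmod (v k))\<^sup>2)"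
      by (intro tendsto_intros) (use f in auto)
    ultimately have "\<kappa> * (\<Sum>k<d. (cmod (v k))\<^sup>2) \<le> hess_sum m d x b a v z"
      using H by (intro LIMSEQ_le) (auto simp: vnorm_power2)
    then show "\<kappa> \<le> hess_sum m d x b a v z"
      using v vnorm_power2[of d v] by simp
  qed
  also have "\<dots> \<in> sets ?M"
  proof (intro sets.sets_Collect_countable_All)
    fix i l
    have [measurable]: "(\<lambda>a. hess_sum m d x b a (h i) (h l)) \<in> borel_measurable ?M" by (rule meas)
    show "{a \<in> space ?M. \<kappa> * (vnorm d (h i))\<^sup>2 \<le> hess_sum m d x b a (h i) (h l)} \<in> sets ?M"
      by measurable
  qed
  finally show ?thesis .
qed

section \<open>Combining the two bounds\<close>

lemma holds_except_hess_sum: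
  fixes c0 K1 K2 :: real
  assumes c0: "c0 > 0" and K1: "K1 > 0"
  obtains C A c where "C > 0" "A \<ge> 0" "c > 0"
    and "\<And>m d x b. d \<ge> 1 \<Longrightarrow> m \<ge> 3 \<Longrightarrow> vnorm d x = 1 \<Longrightarrow> c0\<^sup>2 * real m \<le> (\<Sum>j<m. (cmod (b j))\<^sup>2) \<Longrightarrow>
      (\<Sum>j<m. cmod (b j) ^ 4) \<le> K1 * real m \<Longrightarrow>
      (\<And>j. j < m \<Longrightarrow> cmod (b j) \<le> K2 * sqrt (ln (real m))) \<Longrightarrow>
      holds_except (gauss_vectors m d) (C * exp (A * real d - c * real m / ln (real m)) + 2 / real m)
      (\<lambda>a. \<forall>v z. vnorm d v = 1 \<longrightarrow> (1.96 * c0\<^sup>2 - 4.4) * real m \<le> hess_sum m d x b a v z)"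
proof -
  \<comment> \<open>Both bounds are taken with error 1 / 10. The weighted covariance is counted
    twice, so the total constant is 2 (2 + 1 / 10) + 1 / 10 = 4.3, below 4.4.\<close>
  obtain A1 c1 where A1: "A1 \<ge> 0" "c1 > 0" and
    up: "\<And>m d x b. d \<ge> 1 \<Longrightarrow> m \<ge> 3 \<Longrightarrow> vnorm d x = 1 \<Longrightarrow>
      (\<Sum>j<m. cmod (b j) ^ 4) \<le> K1 * real m \<Longrightarrow>
      (\<And>j. j < m \<Longrightarrow> cmod (b j) \<le> K2 * sqrt (ln (real m))) \<Longrightarrow>
      holds_except (gauss_vectors m d) (exp (A1 * real d - c1 * real m / ln (real m)))
      (\<lambda>a. \<forall>v. vnorm d v = 1 \<longrightarrow>
        (\<Sum>j<m. trunc_meas (8 * ln (real m)) (adj_dot d (a j) x) (b j) * (cmod (adj_dot d (a j) v))\<^sup>2)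
          \<le> 2 * real m + (\<Sum>j<m. (cmod (b j))\<^sup>2) + 1 / 10 * real m)"
    by (rule holds_except_trunc_covariance[where \<epsilon> = "1 / 10" and ?K1.0 = K1 and ?K2.0 = K2]; (use K1 in simp)?; blast)
  obtain C2 A2 c2 where A2: "C2 > 0" "A2 \<ge> 0" "c2 > 0" and
    low: "\<And>m d b. d \<ge> 1 \<Longrightarrow> (\<Sum>j<m. cmod (b j) ^ 4) \<le> K1 * real m \<Longrightarrow>
      holds_except (gauss_vectors m d) (C2 * exp (A2 * real d - c2 * real m))
        (\<lambda>a. \<forall>v z t. vnorm d v = 1 \<longrightarrow> vnorm d z \<le> 1 \<longrightarrow> 0 \<le> t \<longrightarrow> t \<le> 1 \<longrightarrow>
          2 * real m * (vnorm d z)\<^sup>2 + 4 * t\<^sup>2 * (\<Sum>j<m. (cmod (b j))\<^sup>2) - 1 / 10 * real m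
          \<le> (\<Sum>j<m. hess_form ((adj_dot d (a j) z + complex_of_real t * b j) * cnj (adj_dot d (a j) v))))"
    by (rule holds_except_uniform_lower[where \<epsilon> = "1 / 10" and K = K1]; (use K1 in simp)?; blast)
  define A c where "A = A1 + A2" and "c = min c1 c2"
  have main: "holds_except (gauss_vectors m d) ((C2 + 1) * exp (A * real d - c * real m / ln (real m)) + 2 / real m)
      (\<lambda>a. \<forall>v z. vnorm d v = 1 \<longrightarrow> (1.96 * c0\<^sup>2 - 4.4) * real m \<le> hess_sum m d x b a v z)"
    if d: "d \<ge> 1" and m: "m \<ge> 3" and x: "vnorm d x = 1"
      and bl: "c0\<^sup>2 * real m \<le> (\<Sum>j<m. (cmod (b j))\<^sup>2)"
      and b4: "(\<Sum>j<m. cmod (b j) ^ 4) \<le> K1 * real m"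
      and bmax: "\<And>j. j < m \<Longrightarrow> cmod (b j) \<le> K2 * sqrt (ln (real m))" for m d x b
  proof -
    define b2 where "b2 = (\<Sum>j<m. (cmod (b j))\<^sup>2)"
    have ln1: "1 \<le> ln (real m)" by (rule ge_one_ln[OF m])
    have prob: "exp (A1 * real d - c1 * real m / ln (real m)) + C2 * exp (A2 * real d - c2 * real m) + 2 / real m
        \<le> (C2 + 1) * exp (A * real d - c * real m / ln (real m)) + 2 / real m"
    proof -
      have "A1 * real d \<le> A * real d" "A2 * real d \<le> A * real d"
        using A1 A2 unfolding A_def by (intro mult_right_mono; simp)+
      moreover have "c * real m / ln (real m) \<le> c1 * real m / ln (real m)"
        unfolding c_def using ln1 by (intro divide_right_mono mult_right_mono) auto
      moreover have "c * real m / ln (real m) \<le> c2 * real m"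
      proof -
        have "0 < c2 * real m" using A2 m by simp
        have "c * real m / ln (real m) \<le> c2 * real m / ln (real m)"
          unfolding c_def using ln1 by (intro divide_right_mono mult_right_mono) auto
        also have "\<dots> \<le> c2 * real m / 1"
          using ln1 \<open>0 < c2 * real m\<close> by (intro divide_left_mono) auto
        finally show ?thesis by simp
      qed
      ultimately have "exp (A1 * real d - c1 * real m / ln (real m)) \<le> exp (A * real d - c * real m / ln (real m))"
        "C2 * exp (A2 * real d - c2 * real m) \<le> C2 * exp (A * real d - c * real m / ln (real m))"
        using A2 by auto
      from add_mono[OF this] show ?thesis by (simp add: distrib_right)
    qed
    have m1: "m \<ge> 1" using m by simp
    show ?thesis
    proof (rule holds_except_mono[OF holds_except_conj[OF holds_except_conj[OF up[OF d m x b4 bmax] low[OF d b4]]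
            holds_except_max_adj_dot[OF x m1]] prob]; (assumption | clarify)?)
      fix a v z
      assume U: "\<forall>v. vnorm d v = 1 \<longrightarrow>
        (\<Sum>j<m. trunc_meas (8 * ln (real m)) (adj_dot d (a j) x) (b j) * (cmod (adj_dot d (a j) v))\<^sup>2)
          \<le> 2 * real m + (\<Sum>j<m. (cmod (b j))\<^sup>2) + 1 / 10 * real m"
        and L: "\<forall>v z t. vnorm d v = 1 \<longrightarrow> vnorm d z \<le> 1 \<longrightarrow> 0 \<le> t \<longrightarrow> t \<le> 1 \<longrightarrow>
          2 * real m * (vnorm d z)\<^sup>2 + 4 * t\<^sup>2 * (\<Sum>j<m. (cmod (b j))\<^sup>2) - 1 / 10 * real m
          \<le> (\<Sum>j<m. hess_form ((adj_dot d (a j) z + complex_of_real t * b j) * cnj (adj_dot d (a j) v)))"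
        and T: "\<forall>j\<in>{..<m}. (cmod (adj_dot d (a j) x))\<^sup>2 \<le> 8 * ln (real m)"
        and v: "vnorm d v = 1"
      have upper: "(\<Sum>j<m. (cmod (adj_dot d (a j) x + b j))\<^sup>2 * (cmod (adj_dot d (a j) v))\<^sup>2)
          \<le> 2 * real m + b2 + 1 / 10 * real m"
      proof -
        have "(\<Sum>j<m. (cmod (adj_dot d (a j) x + b j))\<^sup>2 * (cmod (adj_dot d (a j) v))\<^sup>2)
          = (\<Sum>j<m. trunc_meas (8 * ln (real m)) (adj_dot d (a j) x) (b j) * (cmod (adj_dot d (a j) v))\<^sup>2)"
          using T by (intro sum.cong refl) (auto simp: trunc_meas_def)
        then show ?thesis using U v by (simp add: b2_def)
      qed
      have lower: "4 * b2 - 1 / 10 * real m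
          \<le> (\<Sum>j<m. hess_form ((adj_dot d (a j) z + b j) * cnj (adj_dot d (a j) v)))"
      proof (cases "vnorm d z \<le> 1")
        case True
        have "0 \<le> 2 * real m * (vnorm d z)\<^sup>2" by simp
        moreover have "2 * real m * (vnorm d z)\<^sup>2 + 4 * b2 - 1 / 10 * real m
            \<le> (\<Sum>j<m. hess_form ((adj_dot d (a j) z + b j) * cnj (adj_dot d (a j) v)))"
          using L[rule_format, OF v True, of 1] by (simp add: b2_def)
        ultimately show ?thesis by linarith
      next
        case False
        \<comment> \<open>The estimate is applied at (z / r, 1 / r) and multiplied by r^2. Since
          \<open>vnorm d z' = 1\<close>, the term \<open>2 * real m\<close> already absorbs the
          error \<open>1 / 10 * real m\<close>, so no error is left for r^2 to magnify.\<close>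
        define r where "r = vnorm d z"
        define z' where "z' = (\<lambda>k. complex_of_real (1 / r) * z k)"
        have r: "r > 1" using False by (simp add: r_def)
        have z': "vnorm d z' = 1"
          unfolding z'_def r_def by (rule vnorm_normalize) (use False in auto)
        have eq: "hess_form ((adj_dot d (a j) z + b j) * cnj w)
            = r\<^sup>2 * hess_form ((adj_dot d (a j) z' + complex_of_real (1 / r) * b j) * cnj w)" for j w
        proof -
          have "(adj_dot d (a j) z + b j) * cnj w
              = complex_of_real r * ((adj_dot d (a j) z' + complex_of_real (1 / r) * b j) * cnj w)"
            using r unfolding z'_def adj_dot_scale by (simp add: field_simps)
          then show ?thesis by (simp only: hess_form_scale)
        qed
        have "2 * real m * 1\<^sup>2 + 4 * (1 / r)\<^sup>2 * b2 - 1 / 10 * real m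
            \<le> (\<Sum>j<m. hess_form ((adj_dot d (a j) z' + complex_of_real (1 / r) * b j) * cnj (adj_dot d (a j) v)))"
          using L[rule_format, OF v, of z' "1 / r"] z' r by (simp add: b2_def)
        then have "4 * (1 / r)\<^sup>2 * b2
            \<le> (\<Sum>j<m. hess_form ((adj_dot d (a j) z' + complex_of_real (1 / r) * b j) * cnj (adj_dot d (a j) v)))"
          by simp
        from mult_left_mono[OF this, of "r\<^sup>2"]
        have "4 * b2 \<le> (\<Sum>j<m. hess_form ((adj_dot d (a j) z + b j) * cnj (adj_dot d (a j) v)))"
          using r unfolding eq sum_distrib_left[symmetric] by (simp add: power_divide)
        then show ?thesis by simp
      qed
      have "(1.96 * c0\<^sup>2 - 4.4) * real m \<le> 2 * (c0\<^sup>2 * real m) - 4.3 * real m"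
        by (simp add: algebra_simps)
      also have "\<dots> \<le> 2 * b2 - 4.3 * real m" using bl by (simp add: b2_def)
      also have "\<dots> = 4 * b2 - 1 / 10 * real m - 2 * (2 * real m + b2 + 1 / 10 * real m)" by simp
      also have "\<dots> \<le> hess_sum m d x b a v z"
        unfolding hess_sum_def sum_subtractf sum_distrib_left[symmetric]
        using upper lower by (intro diff_mono mult_left_mono) auto
      finally show "(1.96 * c0\<^sup>2 - 4.4) * real m \<le> hess_sum m d x b a v z" .
    qed
  qed
  show thesis
    by (rule that[OF _ _ _ main]) (use A1 A2 in \<open>auto simp: A_def c_def\<close>)
qed

text \<open>Passes from m \<ge> C d log d to m \<ge> M d log m. If m \<le> d^4, the two logarithms
  are comparable. Otherwise d is below q = m^(1/4), and log m = 4 log q \<le> 4 q gives M d log m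
  \<le> 4 M sqrt m, which is at most m by \<open>m0\<close>. The second case also serves
  \<open>d = 1\<close>, where \<open>m\<close> reads only m \<ge> 0.\<close>

lemma sample_size_bound:
  fixes M :: real and d m :: nat
  assumes M: "M > 0" and d: "d \<ge> 1" and m: "real m \<ge> 4 * M * real d * ln (real d)"
    and m0: "real m \<ge> 16 * M\<^sup>2"
  shows "M * real d * ln (real m) \<le> real m"
proof (cases "ln (real m) \<le> 4 * ln (real d)")
  case True
  then have "M * real d * ln (real m) \<le> M * real d * (4 * ln (real d))"
    using M by (intro mult_left_mono) auto
  then show ?thesis using m by (simp add: mult_ac)
next
  case False
  have "0 < 16 * M\<^sup>2" using M by simp
  then have mpos: "0 < real m" using m0 by linarith
  define q where "q = sqrt (sqrt (real m))"
  have q: "q > 0" "q\<^sup>2 = sqrt (real m)" "q ^ 4 = real m"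
  proof -
    show "q > 0" "q\<^sup>2 = sqrt (real m)" using mpos by (simp_all add: q_def)
    then have "q ^ 4 = (sqrt (real m))\<^sup>2" by (metis power_mult mult_2 numeral_Bit0 power2_eq_square power_add)
    then show "q ^ 4 = real m" by simp
  qed
  have lnm: "ln (real m) = 4 * ln q"
    unfolding q(3)[symmetric] using q(1) by (simp add: ln_realpow)
  then have "ln (real d) < ln q" using False by simp
  then have dq: "real d \<le> q" using d q(1) by simp
  have "4 * M \<le> sqrt (real m)"
    using m0 M by (intro real_le_rsqrt) (simp add: power_mult_distrib)
  have "M * real d * ln (real m) \<le> M * q * (4 * q)"
    using M dq q(1) ln_le_minus_one[OF q(1)] d False unfolding lnm
    by (intro mult_mono) (auto intro: order.trans)
  also have "\<dots> = 4 * M * sqrt (real m)" unfolding q(2)[symmetric] by (simp add: power2_eq_square)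
  also have "\<dots> \<le> sqrt (real m) * sqrt (real m)"
    using \<open>4 * M \<le> sqrt (real m)\<close> by (intro mult_right_mono) auto
  finally show ?thesis by simp
qed

text \<open>The one place where the event itself must be measurable: otherwise its
  \<open>measure\<close> would not be comparable with that of the complement of the exceptional
  set.\<close>

lemma holds_except_measure_ge:
  assumes "prob_space M" "holds_except M p P" "{a \<in> space M. P a} \<in> sets M"
  shows "measure M {a \<in> space M. P a} \<ge> 1 - p"
proof -
  interpret prob_space M by fact
  obtain B where B: "B \<in> sets M" "measure M B \<le> p" "\<forall>a\<in>space M - B. P a"
    using assms(2) unfolding holds_except_def by blast
  have "1 - p \<le> measure M (space M - B)" using prob_compl[OF B(1)] B(2) by simp
  also have "\<dots> \<le> measure M {a \<in> space M. P a}"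
    using B assms(3) by (intro finite_measure_mono) auto
  finally show ?thesis .
qed

theorem theorem2:
  fixes c0 K1 K2 :: real
  assumes "c0 > sqrt (4.4 / 1.96)" and "K1 > 0" and "K2 > 0"
  shows "\<exists>C ca cb cc cd :: real. C > 0 \<and> ca > 0 \<and> cb > 0 \<and> cc > 0 \<and> cd > 0 \<and>
    (\<forall>(d::nat) (m::nat) (x::nat \<Rightarrow> complex) (b::nat \<Rightarrow> complex).
       d \<ge> 1 \<longrightarrow> m \<ge> 1 \<longrightarrow>
       vnorm m b \<ge> c0 * sqrt (real m) * vnorm d x \<longrightarrow>
       (\<Sum>j<m. (cmod (b j)) ^ 4) \<le> K1 * real m * (vnorm d x) ^ 4 \<longrightarrow>
       (\<forall>j<m. cmod (b j) \<le> K2 * sqrt (ln (real m)) * vnorm d x) \<longrightarrow>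
       real m \<ge> C * real d * ln (real d) \<longrightarrow>
       measure (gauss_vectors m d)
         {a \<in> space (gauss_vectors m d).
            \<forall>v z. vnorm d v = 1 \<longrightarrow>
              Re (quad_form (2 * d)
                    (wirtinger_hessian m d a b (\<lambda>j. (cmod (adj_dot d (a j) x + b j))\<^sup>2) z)
                    (stack_conj d v))
              \<ge> (1.96 * c0\<^sup>2 - 4.4) * (vnorm d x)\<^sup>2}
       \<ge> 1 - ca / real m - 18 * exp (- cd * real d) - cb * exp (- cc * real m / ln (real m)))"
proof -
  have c0: "c0 > 0"
  proof -
    have "0 \<le> sqrt (4.4 / 1.96 :: real)" by simp
    with assms(1) show ?thesis by linarith
  qed
  obtain C0 A c where C0: "C0 > 0" and A: "A \<ge> 0" and c: "c > 0" and
    main: "\<And>m d x b. d \<ge> 1 \<Longrightarrow> m \<ge> 3 \<Longrightarrow> vnorm d x = 1 \<Longrightarrow> c0\<^sup>2 * real m \<le> (\<Sum>j<m. (cmod (b j))\<^sup>2) \<Longrightarrow>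
      (\<Sum>j<m. cmod (b j) ^ 4) \<le> K1 * real m \<Longrightarrow>
      (\<And>j. j < m \<Longrightarrow> cmod (b j) \<le> K2 * sqrt (ln (real m))) \<Longrightarrow>
      holds_except (gauss_vectors m d) (C0 * exp (A * real d - c * real m / ln (real m)) + 2 / real m)
      (\<lambda>a. \<forall>v z. vnorm d v = 1 \<longrightarrow> (1.96 * c0\<^sup>2 - 4.4) * real m \<le> hess_sum m d x b a v z)"
    by (rule holds_except_hess_sum[OF c0 assms(2), where ?K2.0 = K2]; blast)
  \<comment> \<open>Chosen so that m \<ge> M d log m makes the net term A d at most half of c m /
    log m.\<close>
  define M where "M = 2 * A / c + 1"
  \<comment> \<open>For m below \<open>ca\<close> the claimed probability is at most 0. From
    \<open>ca\<close> on, m is at least 3 and at least 16 M^2 as \<open>sample_size_bound\<close>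
    requires; moreover \<open>ca\<close> dominates the 2 in the bound for the largest
    sample.\<close>
  define ca where "ca = 16 * M\<^sup>2 + 3"
  define \<kappa> where "\<kappa> = 1.96 * c0\<^sup>2 - 4.4"
  have M: "M > 0" using A c by (simp add: M_def add_nonneg_pos)
  have ca: "ca \<ge> 3" by (simp add: ca_def)
  have bound: "measure (gauss_vectors m d)
         {a \<in> space (gauss_vectors m d).
            \<forall>v z. vnorm d v = 1 \<longrightarrow>
              Re (quad_form (2 * d)
                    (wirtinger_hessian m d a b (\<lambda>j. (cmod (adj_dot d (a j) x + b j))\<^sup>2) z)
                    (stack_conj d v))
              \<ge> \<kappa> * (vnorm d x)\<^sup>2}
       \<ge> 1 - ca / real m - 18 * exp (- 1 * real d) - C0 * exp (- (c / 2) * real m / ln (real m))"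
    (is "measure ?P ?good \<ge> _")
    if d: "d \<ge> 1" and m: "m \<ge> 1"
      and b2: "vnorm m b \<ge> c0 * sqrt (real m) * vnorm d x"
      and b4: "(\<Sum>j<m. (cmod (b j)) ^ 4) \<le> K1 * real m * (vnorm d x) ^ 4"
      and bmax: "\<forall>j<m. cmod (b j) \<le> K2 * sqrt (ln (real m)) * vnorm d x"
      and md: "real m \<ge> 4 * M * real d * ln (real d)"
    for d m :: nat and x b :: "nat \<Rightarrow> complex"
  proof -
    interpret prob_space ?P by (rule prob_space_gauss_vectors)
    have pos: "0 \<le> 18 * exp (- 1 * real d)" "0 \<le> C0 * exp (- (c / 2) * real m / ln (real m))" "0 \<le> ca / real m"
      using C0 ca by auto
    have good_eq: "?good = {a \<in> space ?P. \<forall>v z. vnorm d v = 1 \<longrightarrow>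
        \<kappa> * (vnorm d x)\<^sup>2 * real m \<le> hess_sum m d x b a v z}"
      using m by (simp add: Re_quad_form_hessian pos_le_divide_eq)
    consider (zero) "vnorm d x = 0" | (small) "real m < ca" | (large) "vnorm d x \<noteq> 0" "real m \<ge> ca"
      by linarith
    then show ?thesis
    proof cases
      \<comment> \<open>Here the maximum bound forces b = 0, so all y vanish and the form is
        nonnegative for every sample.\<close>
      case zero
      have "b j = 0" if "j < m" for j
        using bmax that by (simp add: zero)
      then have "0 \<le> hess_sum m d x b a v z" for a v z
        unfolding hess_sum_def by (intro sum_nonneg) (simp add: adj_dot_eq_0 zero hess_form_nonneg)
      then have "?good = space ?P" unfolding good_eq by (simp add: zero)
      then show ?thesis using pos by (simp only: prob_space)
    next
      \<comment> \<open>This includes m = 1 with nonzero \<open>x\<close>, where log m = 0 and the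
        quotient by it is 0 by convention.\<close>
      case small
      then have "1 \<le> ca / real m" using m by (simp add: pos_le_divide_eq)
      then have "1 - ca / real m - 18 * exp (- 1 * real d) - C0 * exp (- (c / 2) * real m / ln (real m)) \<le> 0"
        using pos by linarith
      also have "0 \<le> measure ?P ?good" by simp
      finally show ?thesis .
    next
      case large
      define r where "r = vnorm d x"
      define x' b' where "x' = (\<lambda>k. complex_of_real (1 / r) * x k)" and "b' = (\<lambda>j. complex_of_real (1 / r) * b j)"
      have r: "r > 0" using large(1) vnorm_nonneg[of d x] unfolding r_def by linarith
      have m3: "m \<ge> 3" using large(2) ca by linarith
      have ln1: "1 \<le> ln (real m)" by (rule ge_one_ln[OF m3])
      have cb': "cmod (b' j) = cmod (b j) / r" for j
        using r by (simp add: b'_def norm_divide)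
      have "holds_except ?P (C0 * exp (A * real d - c * real m / ln (real m)) + 2 / real m)
          (\<lambda>a. \<forall>v z. vnorm d v = 1 \<longrightarrow> (1.96 * c0\<^sup>2 - 4.4) * real m \<le> hess_sum m d x' b' a v z)"
      proof (rule main[OF d m3])
        show "vnorm d x' = 1" unfolding x'_def r_def by (rule vnorm_normalize[OF large(1)])
        have "(c0 * sqrt (real m) * r)\<^sup>2 \<le> (vnorm m b)\<^sup>2"
          using b2 c0 r unfolding r_def by (intro power_mono) auto
        then have "c0\<^sup>2 * real m * r\<^sup>2 \<le> (\<Sum>j<m. (cmod (b j))\<^sup>2)"
          by (simp add: vnorm_power2 power_mult_distrib)
        then show "c0\<^sup>2 * real m \<le> (\<Sum>j<m. (cmod (b' j))\<^sup>2)"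
          using r by (simp add: cb' power_divide pos_le_divide_eq flip: sum_divide_distrib)
        show "(\<Sum>j<m. cmod (b' j) ^ 4) \<le> K1 * real m"
          using r b4 by (simp add: cb' power_divide pos_divide_le_eq r_def flip: sum_divide_distrib)
        show "cmod (b' j) \<le> K2 * sqrt (ln (real m))" if "j < m" for j
          using r bmax that by (simp add: cb' pos_divide_le_eq r_def)
      qed
      then have "holds_except ?P (C0 * exp (A * real d - c * real m / ln (real m)) + 2 / real m)
          (\<lambda>a. \<forall>v z. vnorm d v = 1 \<longrightarrow> \<kappa> * r\<^sup>2 * real m \<le> hess_sum m d x b a v z)"
      proof (rule holds_except_mono[OF _ order.refl], intro allI impI)
        fix a v and z :: "nat \<Rightarrow> complex"
        assume H: "\<forall>v z. vnorm d v = 1 \<longrightarrow> (1.96 * c0\<^sup>2 - 4.4) * real m \<le> hess_sum m d x' b' a v z"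
          and v: "vnorm d v = 1"
        let ?z = "\<lambda>k. complex_of_real (1 / r) * z k"
        have "\<kappa> * real m \<le> hess_sum m d x' b' a v ?z"
          using H v by (simp add: \<kappa>_def)
        also have "\<dots> = (1 / r)\<^sup>2 * hess_sum m d x b a v z"
          unfolding x'_def b'_def by (rule hess_sum_rescale)
        finally show "\<kappa> * r\<^sup>2 * real m \<le> hess_sum m d x b a v z"
          using r by (simp add: power_divide pos_le_divide_eq mult_ac)
      qed
      then have "1 - (C0 * exp (A * real d - c * real m / ln (real m)) + 2 / real m) \<le> measure ?P ?good"
        unfolding good_eq r_def
        by (intro holds_except_measure_ge prob_space_gauss_vectors sets_hess_sum_ge)
      moreover have "exp (A * real d - c * real m / ln (real m)) \<le> exp (- (c / 2) * real m / ln (real m))"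
      proof -
        have "M * real d * ln (real m) \<le> real m"
          using large(2) by (intro sample_size_bound M d md) (simp add: ca_def)
        moreover have "2 * A / c * (real d * ln (real m)) \<le> M * (real d * ln (real m))"
          unfolding M_def using ln1 by (intro mult_right_mono) auto
        ultimately have "2 * A / c * (real d * ln (real m)) \<le> real m" by (simp only: mult.assoc)
        then have "2 * A * real d \<le> c * real m / ln (real m)"
          using c ln1 by (simp add: pos_le_divide_eq pos_divide_le_eq mult_ac)
        then show ?thesis by simp
      qed
      then have "C0 * exp (A * real d - c * real m / ln (real m)) \<le> C0 * exp (- (c / 2) * real m / ln (real m))"
        using C0 by (intro mult_left_mono) auto
      moreover have "2 / real m \<le> ca / real m"
        using ca by (intro divide_right_mono) auto
      ultimately show ?thesis using pos by linarith
    qed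
  qed
  show ?thesis
  proof (rule exI[of _ "4 * M"], rule exI[of _ ca], rule exI[of _ C0], rule exI[of _ "c / 2"],
      rule exI[of _ 1], intro conjI allI impI)
    show "4 * M > 0" "ca > 0" "C0 > 0" "c / 2 > 0" "(1 :: real) > 0"
      using M ca C0 c by simp_all
  qed (rule bound[unfolded \<kappa>_def])
qed

end
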